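(* Let $G$ be a finite group and $N\trianglelefteq G$. There are direct-sum decompositions $$V_G=\operatorname{Inf}(V_{G/N})\oplus\ker(\operatorname{Fix}:V_G\to V_{G/N}),\qquad \mathfrak D_G=\operatorname{Inf}(\mathfrak D_{G/N})\oplus\ker(\operatorname{Fix}:\mathfrak D_G\to\mathfrak D_{G/N}),$$ and with respect to them $$\operatorname{Def}_G\cong\operatorname{Def}_{G/N}\oplus\left.\operatorname{Def}_G\right|_{\ker\operatorname{Fix}},$$ i.e. $\operatorname{Def}_G$ maps $\operatorname{Inf}(V_{G/N})$ into $\operatorname{Inf}(\mathfrak D_{G/N})$, where it is identified via the injections $\operatorname{Inf}$ with $\operatorname{Def}_{G/N}$, and maps $\ker\operatorname{Fix}\subseteq V_G$ into $\ker\operatorname{Fix}\subseteq\mathfrak D_G$. Consequently, $$\mathcal S_2(G)=\operatorname{Inf}\bigl(\mathcal S_2(G/N)\bigr)\oplus\bigl(\mathcal S_2(G)\cap\ker\operatorname{Fix}\bigr),$$ and, in particular, $$\dim_{\mathbb F_2}\mathcal S_2(G)=\dim_{\mathbb F_2}\mathcal S_2(G/N)+\dim_{\mathbb F_2}\bigl(\mathcal S_2(G)\cap\ker\operatorname{Fix}\bigr).$$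
   Context: For a finite group $G$, $\Omega(G)$ is the Burnside ring, with $\mathbb Z$-basis $[G/H]$, $(H)\in\operatorname{Sub}(G)^c$ (conjugacy classes of subgroups). For $K\le G$, the mark $\varphi_K^G:\Omega(G)\to\mathbb Z$ is $[X]\mapsto\#X^K$; $e_H^G\in\mathbb Q\otimes\Omega(G)$ is the primitive idempotent with $\varphi_K^G(e_H^G)=1$ if $(K)=(H)$ and $0$ otherwise, and $e_S:=\sum_{(H)\in S}e_H^G$. $\operatorname{core}_G(H)=\bigcap_{g\in G}gHg^{-1}$; $\operatorname{Sub}_{\mathrm{ncc}}(G)$ is the set of subgroups $H\le G$ with $H/\operatorname{core}_G(H)$ noncyclic (non-core-cyclic), $\operatorname{Sub}_{\mathrm{ncc}}(G)^c$ the set of their conjugacy classes, $V_G:=\mathbb F_2^{\operatorname{Sub}_{\mathrm{ncc}}(G)^c}$. $\mathcal S_2(G):=\{S\subseteq\operatorname{Sub}_{\mathrm{ncc}}(G)^c\mid 2e_S\in\Omega(G)\}$, viewed as a subspace of $V_G$ by identifying $S$ with its characteristic function. For a finite group $W$, $\operatorname{Cl}_0(W,\mathbb F_2)$ is the $\mathbb F_2$-space of class functions $f:W\to\mathbb F_2$ with $f(1)=0$, and $\mathfrak D(W):=\operatorname{Cl}_0(W,\mathbb F_2)/\operatorname{Hom}(W,\mathbb F_2)$. Put $W_G(K)=N_G(K)/K$. For $x\in V_G$ let $\widetilde x\in\mathbb F_2^{\operatorname{Sub}(G)^c}$ be its extension by $0$. For $K\le G$, $g\in N_G(K)$ put $\lambda_{x,K}(gK)=\widetilde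 x_{(\langle K,g\rangle)}+\widetilde x_{(K)}$, an element of $\operatorname{Cl}_0(W_G(K),\mathbb F_2)$. Choosing one representative $K$ of each class, $\mathfrak D_G:=\bigoplus_{(K)\in\operatorname{Sub}(G)^c}\mathfrak D(W_G(K))$, and $\operatorname{Def}_G:V_G\to\mathfrak D_G$ is the linear map $x\mapsto([\lambda_{x,K}])_{(K)}$. Let $\pi:G\to G/N$ be the quotient map, $\pi(H)=HN/N$, and $\widehat L=\pi^{-1}(L)$ for $L\le G/N$. (If $H$ is core-cyclic so is $\pi(H)$; $L$ is core-cyclic in $G/N$ iff $\widehat L$ is core-cyclic in $G$.) Define linear maps: $\operatorname{Inf}:V_{G/N}\to V_G$ by $\operatorname{Inf}(x)_{(H)}=x_{(\pi(H))}$ if $\pi(H)\in\operatorname{Sub}_{\mathrm{ncc}}(G/N)$ and $0$ otherwise; $\operatorname{Fix}:V_G\to V_{G/N}$ by $\operatorname{Fix}(y)_{(L)}=y_{(\widehat L)}$. For $H\le G$ let $\overline\pi_H:W_G(H)\to W_{G/N}(\pi(H))$, $gH\mapsto\pi(g)\pi(H)$, with induced pullback $\overline\pi_H^*:\mathfrak D(W_{G/N}(\pi(H)))\to\mathfrak D(W_G(H))$; for $H=\widehat L$, $\overline\pi_{\widehat L}$ is an isomorphism onto $W_{G/N}(L)$. Choose class representatives so that for each chosen representative $L$ in $G/N$, $\widehat L$ is a chosen representative in $G$, and identify local defect spaces of conjugate subgroups via conjugation. Define linear maps with the same names: $\operatorname{Inf}:\mathfrak D_{G/N}\to\mathfrak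 D_G$, $\operatorname{Inf}(\omega)_H=\overline\pi_H^*(\omega_{\pi(H)})$; $\operatorname{Fix}:\mathfrak D_G\to\mathfrak D_{G/N}$, $\operatorname{Fix}(\eta)_L=(\overline\pi_{\widehat L}^* )^{-1}(\eta_{\widehat L})$. Known result available (Yoshida's unit criterion): a conjugation-invariant function $H\mapsto\varepsilon_H\in\{\pm1\}$ on subgroups of $G$ is the mark vector of a unit of $\Omega(G)$ if and only if for every $K\le G$ the map $W_G(K)\to\{\pm1\}$, $gK\mapsto\varepsilon_{\langle K,g\rangle}/\varepsilon_K$, is a group homomorphism. *)

theory Defs
  imports
    "Jordan_Normal_Form.VS_Connect"
    "HOL-Library.Z2"
    "HOL-Algebra.AbelCoset"
    "HOL-Algebra.Group_Action"
    "HOL-Algebra.Left_Coset"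
    "HOL-Algebra.Elementary_Groups"
begin

section \<open>Subgroups up to conjugation\<close>

text \<open>This is the action from which the library builds \<^const>\<open>normalizer\<close>.\<close>

definition conj_act :: "('a, 'b) monoid_scheme \<Rightarrow> 'a \<Rightarrow> 'a set \<Rightarrow> 'a set" where
  "conj_act G g = (\<lambda>H \<in> {H. H \<subseteq> carrier G}. g <#\<^bsub>G\<^esub> H #>\<^bsub>G\<^esub> (inv\<^bsub>G\<^esub> g))"

definition conj_class :: "('a, 'b) monoid_scheme \<Rightarrow> 'a set \<Rightarrow> 'a set set" where
  "conj_class G H = orbit G (conj_act G) H"

definition subgroup_classes :: "('a, 'b) monoid_scheme \<Rightarrow> 'a set set set" where
  "subgroup_classes G = orbits G {H. subgroup H G} (conj_act G)"

definition rep :: "'a set set \<Rightarrow> 'a set" where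
  "rep C = (SOME H. H \<in> C)"

definition core :: "('a, 'b) monoid_scheme \<Rightarrow> 'a set \<Rightarrow> 'a set" where
  "core G H = (\<Inter>g\<in>carrier G. conj_act G g H)"

definition ncc_subgroups :: "('a, 'b) monoid_scheme \<Rightarrow> 'a set set" where
  "ncc_subgroups G = {H. subgroup H G \<and> \<not> cyclic_group ((G\<lparr>carrier := H\<rparr>) Mod core G H)}"

definition ncc_classes :: "('a, 'b) monoid_scheme \<Rightarrow> 'a set set set" where
  "ncc_classes G = conj_class G ` ncc_subgroups G"

definition class_reps :: "('a, 'b) monoid_scheme \<Rightarrow> 'a set set \<Rightarrow> bool" where
  "class_reps G R \<longleftrightarrow> R \<subseteq> {H. subgroup H G} \<and> (\<forall>C\<in>subgroup_classes G. \<exists>!K. K \<in> R \<and> K \<in> C)"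

text \<open>\<open>W\<^sub>G(K) = N\<^sub>G(K)/K\<close>\<close>

definition weyl :: "('a, 'b) monoid_scheme \<Rightarrow> 'a set \<Rightarrow> 'a set monoid" where
  "weyl G K = (G\<lparr>carrier := normalizer G K\<rparr>) Mod K"


section \<open>The Burnside ring\<close>

text \<open>
  The rational Burnside algebra is the space of rational functions on the set of classes of
  subgroups, the function \<open>x\<close> standing for the sum of the \<open>x (H) [G/H]\<close>; the Burnside ring
  is the set of integer-valued functions.  The class of a finite \<open>G\<close>-set records how many of
  its orbits are isomorphic to \<open>G/H\<close>.
\<close>

definition gset_class :: "('a, 'b) monoid_scheme \<Rightarrow> 'x set \<Rightarrow> ('a \<Rightarrow> 'x \<Rightarrow> 'x) \<Rightarrow> 'a set set \<Rightarrow> rat" where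
  "gset_class G E \<phi> =
    (\<lambda>C\<in>subgroup_classes G. of_nat (card {Y \<in> orbits G E \<phi>. \<exists>x\<in>Y. stabilizer G \<phi> x \<in> C}))"

definition fixed_points :: "'x set \<Rightarrow> ('a \<Rightarrow> 'x \<Rightarrow> 'x) \<Rightarrow> 'a set \<Rightarrow> 'x set" where
  "fixed_points E \<phi> K = {x \<in> E. \<forall>k\<in>K. \<phi> k x = x}"

definition rat_burnside :: "('a, 'b) monoid_scheme \<Rightarrow> ('a set set \<Rightarrow> rat) ring" where
  "rat_burnside G =
    \<lparr>carrier = subgroup_classes G \<rightarrow>\<^sub>E UNIV,
     mult = (\<lambda>x y. \<lambda>C\<in>subgroup_classes G. \<Sum>A\<in>subgroup_classes G. \<Sum>B\<in>subgroup_classes G.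
       x A * y B * gset_class G ((lcosets\<^bsub>G\<^esub> (rep A)) \<times> (lcosets\<^bsub>G\<^esub> (rep B)))
                     (\<lambda>g (X, Y). (g <#\<^bsub>G\<^esub> X, g <#\<^bsub>G\<^esub> Y)) C),
     one = gset_class G {()} (\<lambda>_ _. ()),
     zero = (\<lambda>C\<in>subgroup_classes G. 0),
     add = (\<lambda>x y. \<lambda>C\<in>subgroup_classes G. x C + y C)\<rparr>"

definition burnside :: "('a, 'b) monoid_scheme \<Rightarrow> ('a set set \<Rightarrow> rat) ring" where
  "burnside G = (rat_burnside G)\<lparr>carrier := subgroup_classes G \<rightarrow>\<^sub>E \<int>\<rparr>"

text \<open>The linear extension of \<open>[G/H] \<mapsto> #(G/H)\<^sup>K\<close>.\<close>

definition mark :: "('a, 'b) monoid_scheme \<Rightarrow> 'a set \<Rightarrow> ('a set set \<Rightarrow> rat) \<Rightarrow> rat" where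
  "mark G K x = (\<Sum>C\<in>subgroup_classes G.
     x C * of_nat (card (fixed_points (lcosets\<^bsub>G\<^esub> (rep C)) (\<lambda>g X. g <#\<^bsub>G\<^esub> X) K)))"

lemma conj_act_eq: "X \<subseteq> carrier G \<Longrightarrow> conj_act G g X = (\<lambda>x. g \<otimes>\<^bsub>G\<^esub> x \<otimes>\<^bsub>G\<^esub> inv\<^bsub>G\<^esub> g) ` X"
  by (auto simp: conj_act_def l_coset_def r_coset_def)

text \<open>\<open>G\<close>-sets, without the extensionality that \<^locale>\<open>group_action\<close> asks of the action.\<close>

locale gset = group G for G (structure) +
  fixes E :: "'x set" and \<phi> :: "'a \<Rightarrow> 'x \<Rightarrow> 'x"
  assumes act_closed: "\<And>g x. g \<in> carrier G \<Longrightarrow> x \<in> E \<Longrightarrow> \<phi> g x \<in> E"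
    and act_one: "\<And>x. x \<in> E \<Longrightarrow> \<phi> \<one> x = x"
    and act_mult: "\<And>g h x. g \<in> carrier G \<Longrightarrow> h \<in> carrier G \<Longrightarrow> x \<in> E \<Longrightarrow> \<phi> (g \<otimes> h) x = \<phi> g (\<phi> h x)"
begin

lemma act_inv: "g \<in> carrier G \<Longrightarrow> x \<in> E \<Longrightarrow> \<phi> (inv g) (\<phi> g x) = x"
  using act_mult[of "inv g" g x] act_one by auto

lemma act_eq_iff: "g \<in> carrier G \<Longrightarrow> h \<in> carrier G \<Longrightarrow> x \<in> E \<Longrightarrow>
   \<phi> g x = \<phi> h x \<longleftrightarrow> inv g \<otimes> h \<in> stabilizer G \<phi> x"
  unfolding stabilizer_def
  by (auto simp: act_mult) (metis act_inv, metis act_closed act_inv act_mult inv_closed inv_inv)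

lemma stab_subgroup: "x \<in> E \<Longrightarrow> subgroup (stabilizer G \<phi> x) G"
  by (rule subgroupI) (auto simp: stabilizer_def act_one act_mult, use act_inv in force)

lemma orbit_eq: "x \<in> E \<Longrightarrow> g \<in> carrier G \<Longrightarrow> orbit G \<phi> (\<phi> g x) = orbit G \<phi> x"
proof -
  assume x: "x \<in> E" and g: "g \<in> carrier G"
  have "\<phi> h x \<in> orbit G \<phi> (\<phi> g x)" if "h \<in> carrier G" for h
  proof -
    have "\<phi> h x = \<phi> (h \<otimes> inv g) (\<phi> g x)"
      using that x g act_inv act_mult act_closed by auto
    then show ?thesis using that g by (auto simp: orbit_def intro!: exI[of _ "h \<otimes> inv g"])
  qed
  moreover have "\<phi> h (\<phi> g x) \<in> orbit G \<phi> x" if "h \<in> carrier G" for h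
    using that x g act_mult[of h g x] by (auto simp: orbit_def intro!: exI[of _ "h \<otimes> g"])
  ultimately show ?thesis unfolding orbit_def by blast
qed

lemma in_own_orbit: "x \<in> E \<Longrightarrow> x \<in> orbit G \<phi> x"
  using act_one by (auto simp: orbit_def intro!: exI[of _ \<one>])

lemma orbits_cases:
  assumes "Y \<in> orbits G E \<phi>" "x \<in> Y" shows "x \<in> E" "Y = orbit G \<phi> x"
proof -
  from assms obtain y g where y: "y \<in> E" "Y = orbit G \<phi> y" "x = \<phi> g y" "g \<in> carrier G"
    by (auto simp: orbits_def orbit_def)
  then show "x \<in> E" "Y = orbit G \<phi> x" using act_closed orbit_eq by auto
qed

lemma stab_conj: "x \<in> E \<Longrightarrow> g \<in> carrier G \<Longrightarrow> stabilizer G \<phi> (\<phi> g x) = conj_act G g (stabilizer G \<phi> x)"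
proof -
  assume x: "x \<in> E" and g: "g \<in> carrier G"
  have sub: "stabilizer G \<phi> x \<subseteq> carrier G" by (auto simp: stabilizer_def)
  have "h \<in> conj_act G g (stabilizer G \<phi> x)" if "h \<in> carrier G" "\<phi> h (\<phi> g x) = \<phi> g x" for h
  proof -
    have "inv g \<otimes> (h \<otimes> g) \<in> stabilizer G \<phi> x"
      using that x g by (subst act_eq_iff[symmetric]) (auto simp: act_mult)
    moreover have "h = g \<otimes> (inv g \<otimes> (h \<otimes> g)) \<otimes> inv g"
      using that g by (metis inv_closed inv_solve_right m_closed m_assoc r_inv l_one)
    ultimately show ?thesis by (auto simp: conj_act_eq[OF sub])
  qed
  moreover have "g \<otimes> h \<otimes> inv g \<in> stabilizer G \<phi> (\<phi> g x)" if "h \<in> stabilizer G \<phi> x" for h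
    using that x g by (auto simp: stabilizer_def act_mult act_closed act_inv)
  moreover have "stabilizer G \<phi> (\<phi> g x) = {h \<in> carrier G. \<phi> h (\<phi> g x) = \<phi> g x}"
    by (simp add: stabilizer_def)
  ultimately show ?thesis unfolding conj_act_eq[OF sub] by blast
qed

lemma finite_orbits: "finite E \<Longrightarrow> finite (orbits G E \<phi>)"
proof -
  have "orbits G E \<phi> = orbit G \<phi> ` E" by (auto simp: orbits_def)
  then show "finite E \<Longrightarrow> finite (orbits G E \<phi>)" by simp
qed

end

lemma (in group) conj_gset: "gset G {H. subgroup H G} (conj_act G)"
proof
  fix g h x assume "g \<in> carrier G" "h \<in> carrier G" "x \<in> {H. subgroup H G}"
  then have s: "subgroup x G" "x \<subseteq> carrier G" by (auto dest: subgroup.subset)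
  have "conj_act G h x \<subseteq> carrier G" using s \<open>h \<in> carrier G\<close> by (auto simp: conj_act_eq subset_iff)
  have "g \<otimes> h \<otimes> a \<otimes> inv (g \<otimes> h) = g \<otimes> (h \<otimes> a \<otimes> inv h) \<otimes> inv g" if "a \<in> x" for a
    using that s(2) \<open>g \<in> carrier G\<close> \<open>h \<in> carrier G\<close> by (simp add: inv_mult_group m_assoc subset_iff)
  then show "conj_act G (g \<otimes> h) x = conj_act G g (conj_act G h x)"
    unfolding conj_act_eq[OF \<open>conj_act G h x \<subseteq> carrier G\<close>] unfolding conj_act_eq[OF s(2)] image_image
    by (rule image_cong[OF refl])
next
  fix g x assume g: "g \<in> carrier G" and "x \<in> {H. subgroup H G}"
  then have s: "subgroup x G" "x \<subseteq> carrier G" by (auto dest: subgroup.subset)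
  have "subgroup (g <# x #> inv g) G" using s g by (simp add: subgroup_conjugation_is_surj2)
  then show "conj_act G g x \<in> {H. subgroup H G}" using s by (simp add: conj_act_def)
next
  fix x assume "x \<in> {H. subgroup H G}"
  then have s: "x \<subseteq> carrier G" by (auto dest: subgroup.subset)
  then have "(\<lambda>a. \<one> \<otimes> a \<otimes> inv \<one>) ` x = (\<lambda>a. a) ` x" by (intro image_cong) auto
  then show "conj_act G \<one> x = x" by (simp add: conj_act_eq[OF s])
qed

text \<open>The mark of the class of a finite \<open>G\<close>-set is the number of its \<open>K\<close>-fixed points.\<close>

lemma (in gset) mark_gset_class:
  assumes fin: "finite (carrier G)" "finite E" and K: "subgroup K G"
  shows "mark G K (gset_class G E \<phi>) = of_nat (card (fixed_points E \<phi> K))"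
proof -
  interpret conj: gset G "{H. subgroup H G}" "conj_act G" by (rule conj_gset)
  let ?Sc = "subgroup_classes G"
  define F where "F C = card (fixed_points (lcosets (rep C)) (\<lambda>g X. g <#\<^bsub>G\<^esub> X) K)" for C
  define cls where "cls Y = conj_class G (stabilizer G \<phi> (SOME x. x \<in> Y))" for Y
  have KG: "K \<subseteq> carrier G" using K by (rule subgroup.subset)
  have Y_nonempty: "(SOME x. x \<in> Y) \<in> Y" if "Y \<in> orbits G E \<phi>" for Y
    using that in_own_orbit some_in_eq[of Y] by (auto simp: orbits_def)
  have cls: "cls Y = conj_class G (stabilizer G \<phi> x)" if "Y \<in> orbits G E \<phi>" "x \<in> Y" for Y x
  proof -
    let ?y = "SOME x. x \<in> Y"
    have y: "?y \<in> Y" "?y \<in> E" using Y_nonempty that orbits_cases by auto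
    then have "x \<in> orbit G \<phi> ?y" using that orbits_cases by metis
    then obtain g where g: "g \<in> carrier G" "x = \<phi> g ?y" by (auto simp: orbit_def)
    show ?thesis using g y stab_conj stab_subgroup conj.orbit_eq
      by (simp add: cls_def conj_class_def)
  qed
  have cls_in: "cls Y \<in> ?Sc" if "Y \<in> orbits G E \<phi>" for Y
    using Y_nonempty[OF that] orbits_cases[OF that] stab_subgroup
    by (auto simp: cls_def conj_class_def subgroup_classes_def orbits_def)
  have in_class: "(\<exists>x\<in>Y. stabilizer G \<phi> x \<in> C) \<longleftrightarrow> cls Y = C"
    if "Y \<in> orbits G E \<phi>" "C \<in> ?Sc" for Y C
  proof
    assume "\<exists>x\<in>Y. stabilizer G \<phi> x \<in> C"
    then obtain x where x: "x \<in> Y" "stabilizer G \<phi> x \<in> C" by auto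
    then have "C = conj_class G (stabilizer G \<phi> x)"
      using conj.orbits_cases(2) that by (simp add: conj_class_def subgroup_classes_def)
    then show "cls Y = C" using cls that x by simp
  next
    assume "cls Y = C"
    moreover have "stabilizer G \<phi> (SOME x. x \<in> Y) \<in> cls Y"
      using conj.in_own_orbit[of "stabilizer G \<phi> (SOME x. x \<in> Y)"] stab_subgroup
        orbits_cases[OF that(1)] Y_nonempty[OF that(1)]
      by (auto simp: cls_def conj_class_def)
    ultimately show "\<exists>x\<in>Y. stabilizer G \<phi> x \<in> C" using Y_nonempty[OF that(1)] by blast
  qed
  have local: "card (fixed_points Y \<phi> K) = F (cls Y)" if Y: "Y \<in> orbits G E \<phi>" for Y
  proof -
    let ?y = "SOME x. x \<in> Y" and ?H = "rep (cls Y)"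
    have y: "?y \<in> Y" "?y \<in> E" using Y_nonempty Y orbits_cases by auto
    have "stabilizer G \<phi> ?y \<in> cls Y"
      using conj.in_own_orbit[of "stabilizer G \<phi> ?y"] stab_subgroup y
      by (auto simp: cls_def conj_class_def)
    then have "?H \<in> cls Y" unfolding rep_def by (rule someI)
    then obtain g where g: "g \<in> carrier G" "?H = conj_act G g (stabilizer G \<phi> ?y)"
      by (auto simp: cls_def conj_class_def orbit_def)
    define x where "x = \<phi> g ?y"
    have x: "x \<in> E" "stabilizer G \<phi> x = ?H" "Y = orbit G \<phi> x"
      using g y stab_conj act_closed orbit_eq orbits_cases(2)[OF Y y(1)] by (auto simp: x_def)
    have H: "subgroup ?H G" using x stab_subgroup by metis
    define f where "f X = \<phi> (SOME a. a \<in> X) x" for X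
    have f: "f (a <# ?H) = \<phi> a x" if a: "a \<in> carrier G" for a
    proof -
      have "(SOME b. b \<in> a <# ?H) \<in> a <# ?H"
        using lcos_self[OF a H] by (rule someI)
      then obtain h where h: "h \<in> ?H" "(SOME b. b \<in> a <# ?H) = a \<otimes> h"
        by (auto simp: l_coset_def)
      then have "h \<in> carrier G" "\<phi> h x = x" using x(2) by (auto simp: stabilizer_def)
      then show ?thesis using h a x(1) by (simp add: f_def act_mult)
    qed
    have cos: "a <# ?H = b <# ?H \<longleftrightarrow> \<phi> a x = \<phi> b x" if "a \<in> carrier G" "b \<in> carrier G" for a b
    proof
      assume "a <# ?H = b <# ?H" then show "\<phi> a x = \<phi> b x" using f that by metis
    next
      assume "\<phi> a x = \<phi> b x"
      then have m: "inv a \<otimes> b \<in> ?H" using act_eq_iff x that by auto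
      have "b = a \<otimes> (inv a \<otimes> b)" using that by (simp add: m_assoc[symmetric])
      then have "b \<in> a <# ?H" using m by (auto simp: l_coset_def)
      then show "a <# ?H = b <# ?H" using l_repr_independence[OF _ that(1) H] by simp
    qed
    have "bij_betw f (fixed_points (lcosets ?H) (\<lambda>g X. g <#\<^bsub>G\<^esub> X) K) (fixed_points Y \<phi> K)"
    proof (rule bij_betwI')
      fix X X' assume "X \<in> fixed_points (lcosets ?H) (\<lambda>g X. g <#\<^bsub>G\<^esub> X) K"
        "X' \<in> fixed_points (lcosets ?H) (\<lambda>g X. g <#\<^bsub>G\<^esub> X) K"
      then obtain a a' where "a \<in> carrier G" "X = a <# ?H" "a' \<in> carrier G" "X' = a' <# ?H"
        by (auto simp: fixed_points_def LCOSETS_def)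
      then show "f X = f X' \<longleftrightarrow> X = X'" using f cos by metis
    next
      fix X assume "X \<in> fixed_points (lcosets ?H) (\<lambda>g X. g <#\<^bsub>G\<^esub> X) K"
      then obtain a where a: "a \<in> carrier G" "X = a <# ?H" "\<And>k. k \<in> K \<Longrightarrow> k <# (a <# ?H) = a <# ?H"
        by (auto simp: fixed_points_def LCOSETS_def)
      have "\<phi> k (\<phi> a x) = \<phi> a x" if "k \<in> K" for k
      proof -
        have "(k \<otimes> a) <# ?H = a <# ?H"
          using a that KG H subgroup.subset lcos_m_assoc by (metis subsetD)
        then show ?thesis using cos[of "k \<otimes> a" a] that a KG x(1) by (auto simp: act_mult)
      qed
      then show "f X \<in> fixed_points Y \<phi> K"
        using a f x by (auto simp: fixed_points_def orbit_def)
    next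
      fix z assume "z \<in> fixed_points Y \<phi> K"
      then obtain a where a: "a \<in> carrier G" "z = \<phi> a x" "\<And>k. k \<in> K \<Longrightarrow> \<phi> k (\<phi> a x) = \<phi> a x"
        using x(3) by (auto simp: fixed_points_def orbit_def)
      have "k <# (a <# ?H) = a <# ?H" if "k \<in> K" for k
      proof -
        have "(k \<otimes> a) <# ?H = a <# ?H" using cos[of "k \<otimes> a" a] that a KG x(1) by (auto simp: act_mult)
        then show ?thesis using a that KG H subgroup.subset lcos_m_assoc by (metis subsetD)
      qed
      then show "\<exists>X\<in>fixed_points (lcosets ?H) (\<lambda>g X. g <#\<^bsub>G\<^esub> X) K. z = f X"
        using a f by (intro bexI[of _ "a <# ?H"]) (auto simp: fixed_points_def LCOSETS_def)
    qed
    then show ?thesis unfolding F_def by (metis bij_betw_same_card)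
  qed
  have finO: "finite (orbits G E \<phi>)" using fin finite_orbits by simp
  have "?Sc \<subseteq> Pow (Pow (carrier G))"
  proof
    fix C assume "C \<in> ?Sc"
    then have "H \<subseteq> carrier G" if "H \<in> C" for H
      using conj.orbits_cases(1)[OF _ that] subgroup.subset by (auto simp: subgroup_classes_def)
    then show "C \<in> Pow (Pow (carrier G))" by blast
  qed
  then have finS: "finite ?Sc" using fin finite_subset by blast
  have "E = \<Union>(orbits G E \<phi>)"
    using in_own_orbit orbits_cases(1) unfolding orbits_def by blast
  then have un: "fixed_points E \<phi> K = (\<Union>Y\<in>orbits G E \<phi>. fixed_points Y \<phi> K)"
    by (auto simp: fixed_points_def)
  have "card (fixed_points E \<phi> K) = (\<Sum>Y\<in>orbits G E \<phi>. card (fixed_points Y \<phi> K))"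
    unfolding un
  proof (rule card_UN_disjoint)
    show "finite (orbits G E \<phi>)" by fact
    show "\<forall>Y\<in>orbits G E \<phi>. finite (fixed_points Y \<phi> K)"
    proof
      fix Y assume "Y \<in> orbits G E \<phi>"
      then have "fixed_points Y \<phi> K \<subseteq> E" using orbits_cases(1) by (auto simp: fixed_points_def)
      then show "finite (fixed_points Y \<phi> K)" using fin finite_subset by blast
    qed
    show "\<forall>Y\<in>orbits G E \<phi>. \<forall>Z\<in>orbits G E \<phi>. Y \<noteq> Z \<longrightarrow> fixed_points Y \<phi> K \<inter> fixed_points Z \<phi> K = {}"
    proof (intro ballI impI equals0I)
      fix Y Z z assume "Y \<in> orbits G E \<phi>" "Z \<in> orbits G E \<phi>" "Y \<noteq> Z"
        "z \<in> fixed_points Y \<phi> K \<inter> fixed_points Z \<phi> K"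
      then show False using orbits_cases(2) unfolding fixed_points_def by blast
    qed
  qed
  also have "\<dots> = (\<Sum>Y\<in>orbits G E \<phi>. F (cls Y))" using local by simp
  also have "\<dots> = (\<Sum>C\<in>?Sc. \<Sum>Y\<in>{Y \<in> orbits G E \<phi>. cls Y = C}. F (cls Y))"
    using finO finS cls_in by (intro sum.group[symmetric]) auto
  also have "\<dots> = (\<Sum>C\<in>?Sc. card {Y \<in> orbits G E \<phi>. cls Y = C} * F C)" by simp
  also have "\<dots> = (\<Sum>C\<in>?Sc. card {Y \<in> orbits G E \<phi>. \<exists>x\<in>Y. stabilizer G \<phi> x \<in> C} * F C)"
    by (rule sum.cong) (auto simp: in_class cong: conj_cong)
  finally show ?thesis
    by (simp add: mark_def gset_class_def F_def)
qed


context group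
begin

lemma lcosets_gset: "subgroup H G \<Longrightarrow> gset G (lcosets H) (\<lambda>g X. g <#\<^bsub>G\<^esub> X)"
proof
  assume H: "subgroup H G"
  then have HG: "H \<subseteq> carrier G" by (rule subgroup.subset)
  show "\<And>g X. g \<in> carrier G \<Longrightarrow> X \<in> lcosets H \<Longrightarrow> g <# X \<in> lcosets H"
    using HG by (auto simp: LCOSETS_def lcos_m_assoc)
  show "\<And>X. X \<in> lcosets H \<Longrightarrow> \<one> <# X = X"
    using HG by (auto simp: LCOSETS_def lcos_m_assoc)
  show "\<And>g h X. g \<in> carrier G \<Longrightarrow> h \<in> carrier G \<Longrightarrow> X \<in> lcosets H \<Longrightarrow> g \<otimes> h <# X = g <# (h <# X)"
    using HG by (auto simp: LCOSETS_def lcos_m_assoc m_assoc)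
qed

lemma rep_class:
  assumes "C \<in> subgroup_classes G" shows "rep C \<in> C" "subgroup (rep C) G" "conj_class G (rep C) = C"
proof -
  interpret conj: gset G "{H. subgroup H G}" "conj_act G" by (rule conj_gset)
  from assms obtain H where "subgroup H G" "C = orbit G (conj_act G) H"
    by (auto simp: subgroup_classes_def orbits_def)
  then have "H \<in> C" using conj.in_own_orbit by simp
  then show *: "rep C \<in> C" unfolding rep_def by (rule someI)
  show "subgroup (rep C) G" "conj_class G (rep C) = C"
    using conj.orbits_cases[OF _ *] assms by (auto simp: subgroup_classes_def conj_class_def)
qed

text \<open>The classes of the transitive \<open>G\<close>-sets \<open>G/H\<close> form the standard basis.\<close>

lemma gset_class_lcosets:
  assumes H: "subgroup H G"
  shows "gset_class G (lcosets H) (\<lambda>g X. g <#\<^bsub>G\<^esub> X) =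
    (\<lambda>C\<in>subgroup_classes G. if C = conj_class G H then 1 else 0)"
proof -
  interpret conj: gset G "{H. subgroup H G}" "conj_act G" by (rule conj_gset)
  interpret cos: gset G "lcosets H" "\<lambda>g X. g <#\<^bsub>G\<^esub> X" using H by (rule lcosets_gset)
  have HG: "H \<subseteq> carrier G" using H by (rule subgroup.subset)
  have one: "\<one> <# H = H" using HG by (rule lcos_mult_one)
  then have HL: "H \<in> lcosets H" unfolding LCOSETS_def by blast
  have E: "lcosets H = orbit G (\<lambda>g X. g <#\<^bsub>G\<^esub> X) H" by (auto simp: LCOSETS_def orbit_def)
  then have orbs: "orbits G (lcosets H) (\<lambda>g X. g <#\<^bsub>G\<^esub> X) = {lcosets H}"
  proof -
    have "Y = lcosets H" if Y: "Y \<in> orbits G (lcosets H) (\<lambda>g X. g <#\<^bsub>G\<^esub> X)" for Y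
    proof -
      obtain X where X: "X \<in> lcosets H" "Y = orbit G (\<lambda>g X. g <#\<^bsub>G\<^esub> X) X"
        using Y by (auto simp: orbits_def)
      then obtain a where "a \<in> carrier G" "X = a <#\<^bsub>G\<^esub> H" by (auto simp: LCOSETS_def)
      then show ?thesis using X(2) cos.orbit_eq[OF HL, of a] E by simp
    qed
    moreover have "lcosets H \<in> orbits G (lcosets H) (\<lambda>g X. g <#\<^bsub>G\<^esub> X)"
      using E HL unfolding orbits_def by blast
    ultimately show ?thesis by blast
  qed
  have stab: "stabilizer G (\<lambda>g X. g <#\<^bsub>G\<^esub> X) H = H"
  proof
    show "stabilizer G (\<lambda>g X. g <#\<^bsub>G\<^esub> X) H \<subseteq> H"
      using lcos_self[OF _ H] by (auto simp: stabilizer_def)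
    show "H \<subseteq> stabilizer G (\<lambda>g X. g <#\<^bsub>G\<^esub> X) H"
      using H HG l_repr_independence[OF _ one_closed H] one by (auto simp: stabilizer_def)
  qed
  have "(\<exists>X\<in>lcosets H. stabilizer G (\<lambda>g X. g <#\<^bsub>G\<^esub> X) X \<in> C) \<longleftrightarrow> C = conj_class G H"
    if C: "C \<in> subgroup_classes G" for C
  proof
    assume "\<exists>X\<in>lcosets H. stabilizer G (\<lambda>g X. g <#\<^bsub>G\<^esub> X) X \<in> C"
    then obtain a where a: "a \<in> carrier G" "stabilizer G (\<lambda>g X. g <#\<^bsub>G\<^esub> X) (a <# H) \<in> C"
      by (auto simp: LCOSETS_def)
    then have "conj_act G a H \<in> C" using cos.stab_conj[OF HL a(1)] stab by simp
    then have "C = conj_class G (conj_act G a H)"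
      using C conj.orbits_cases(2) by (auto simp: subgroup_classes_def conj_class_def)
    then show "C = conj_class G H" using conj.orbit_eq a(1) H by (simp add: conj_class_def)
  next
    assume "C = conj_class G H"
    then have "H \<in> C" using conj.in_own_orbit H by (simp add: conj_class_def)
    then show "\<exists>X\<in>lcosets H. stabilizer G (\<lambda>g X. g <#\<^bsub>G\<^esub> X) X \<in> C"
      using HL stab by (intro bexI[of _ H]) simp_all
  qed
  then show ?thesis by (auto simp: gset_class_def orbs intro!: restrict_ext cong: conj_cong)
qed

text \<open>The marks are multiplicative for the product that comes from products of \<open>G\<close>-sets.\<close>

lemma mark_mult:
  assumes fin: "finite (carrier G)" and K: "subgroup K G"
  shows "mark G K (x \<otimes>\<^bsub>rat_burnside G\<^esub> y) = mark G K x * mark G K y"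
proof -
  let ?Sc = "subgroup_classes G"
  define F where "F C = fixed_points (lcosets\<^bsub>G\<^esub> (rep C)) (\<lambda>g X. g <#\<^bsub>G\<^esub> X) K" for C
  define u where "u A B = gset_class G ((lcosets\<^bsub>G\<^esub> (rep A)) \<times> (lcosets\<^bsub>G\<^esub> (rep B)))
                     (\<lambda>g (X, Y). (g <#\<^bsub>G\<^esub> X, g <#\<^bsub>G\<^esub> Y))" for A B
  have u: "mark G K (u A B) = of_nat (card (F A)) * of_nat (card (F B))"
    if "A \<in> ?Sc" "B \<in> ?Sc" for A B
  proof -
    interpret a: gset G "lcosets (rep A)" "\<lambda>g X. g <#\<^bsub>G\<^esub> X" using that rep_class lcosets_gset by blast
    interpret b: gset G "lcosets (rep B)" "\<lambda>g X. g <#\<^bsub>G\<^esub> X" using that rep_class lcosets_gset by blast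
    interpret ab: gset G "(lcosets (rep A)) \<times> (lcosets (rep B))" "\<lambda>g (X, Y). (g <#\<^bsub>G\<^esub> X, g <#\<^bsub>G\<^esub> Y)"
      by unfold_locales (auto simp: a.act_closed b.act_closed a.act_one b.act_one a.act_mult b.act_mult)
    have "finite (lcosets H)" for H using fin by (simp add: LCOSETS_def)
    then have "mark G K (u A B) = of_nat (card (fixed_points ((lcosets (rep A)) \<times> (lcosets (rep B)))
        (\<lambda>g (X, Y). (g <#\<^bsub>G\<^esub> X, g <#\<^bsub>G\<^esub> Y)) K))"
      unfolding u_def using fin K by (intro ab.mark_gset_class) auto
    also have "fixed_points ((lcosets (rep A)) \<times> (lcosets (rep B))) (\<lambda>g (X, Y). (g <#\<^bsub>G\<^esub> X, g <#\<^bsub>G\<^esub> Y)) K = F A \<times> F B"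
      by (auto simp: fixed_points_def F_def)
    finally show ?thesis by (simp add: card_cartesian_product)
  qed
  have "mark G K (x \<otimes>\<^bsub>rat_burnside G\<^esub> y) =
      (\<Sum>C\<in>?Sc. (\<Sum>A\<in>?Sc. \<Sum>B\<in>?Sc. x A * y B * u A B C) * of_nat (card (F C)))"
    by (simp add: mark_def rat_burnside_def u_def F_def)
  also have "\<dots> = (\<Sum>C\<in>?Sc. \<Sum>A\<in>?Sc. \<Sum>B\<in>?Sc. x A * y B * (u A B C * of_nat (card (F C))))"
    by (simp add: sum_distrib_right mult.assoc)
  also have "\<dots> = (\<Sum>A\<in>?Sc. \<Sum>C\<in>?Sc. \<Sum>B\<in>?Sc. x A * y B * (u A B C * of_nat (card (F C))))"
    by (rule sum.swap)
  also have "\<dots> = (\<Sum>A\<in>?Sc. \<Sum>B\<in>?Sc. \<Sum>C\<in>?Sc. x A * y B * (u A B C * of_nat (card (F C))))"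
    by (rule sum.cong[OF refl], rule sum.swap)
  also have "\<dots> = (\<Sum>A\<in>?Sc. \<Sum>B\<in>?Sc. x A * y B * mark G K (u A B))"
    by (simp add: mark_def F_def sum_distrib_left)
  also have "\<dots> = (\<Sum>A\<in>?Sc. \<Sum>B\<in>?Sc. (x A * of_nat (card (F A))) * (y B * of_nat (card (F B))))"
    by (intro sum.cong refl) (simp add: u)
  also have "\<dots> = mark G K x * mark G K y"
    by (simp add: mark_def F_def sum_product)
  finally show ?thesis .
qed

end

text \<open>
  The idempotent \<open>e\<^sub>H\<close>, for \<open>C\<close> the class of \<open>H\<close>; an element of the Burnside algebra is
  determined by its marks.
\<close>

definition prim_idem :: "('a, 'b) monoid_scheme \<Rightarrow> 'a set set \<Rightarrow> ('a set set \<Rightarrow> rat)" where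
  "prim_idem G C = (THE e. e \<in> carrier (rat_burnside G) \<and>
     (\<forall>K. subgroup K G \<longrightarrow> mark G K e = (if conj_class G K = C then 1 else 0)))"

definition idem_sum :: "('a, 'b) monoid_scheme \<Rightarrow> 'a set set set \<Rightarrow> ('a set set \<Rightarrow> rat)" where
  "idem_sum G S = (\<Oplus>\<^bsub>rat_burnside G\<^esub>C\<in>S. prim_idem G C)"


section \<open>Vector spaces over the field with two elements\<close>

abbreviation F2 :: "bit ring" where
  "F2 \<equiv> class_ring"

definition quot_module :: "('k, 'v, 'm) module_scheme \<Rightarrow> 'v set \<Rightarrow> ('k, 'v set) module" where
  "quot_module M W =
    \<lparr>carrier = a_rcosets\<^bsub>M\<^esub> W, mult = (\<lambda>_ _. W), one = W, zero = W,
     add = (\<lambda>X Y. X <+>\<^bsub>M\<^esub> Y),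
     smult = (\<lambda>c X. \<Union>v\<in>X. W +>\<^bsub>M\<^esub> (c \<odot>\<^bsub>M\<^esub> v))\<rparr>"

text \<open>For a finite index set this is the direct sum.\<close>

definition prod_module :: "'i set \<Rightarrow> ('i \<Rightarrow> ('k, 'v) module) \<Rightarrow> ('k, 'i \<Rightarrow> 'v) module" where
  "prod_module I M =
    \<lparr>carrier = (\<Pi>\<^sub>E i\<in>I. carrier (M i)),
     mult = (\<lambda>_ _. \<lambda>i\<in>I. \<zero>\<^bsub>M i\<^esub>), one = (\<lambda>i\<in>I. \<zero>\<^bsub>M i\<^esub>), zero = (\<lambda>i\<in>I. \<zero>\<^bsub>M i\<^esub>),
     add = (\<lambda>v w. \<lambda>i\<in>I. v i \<oplus>\<^bsub>M i\<^esub> w i),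
     smult = (\<lambda>c v. \<lambda>i\<in>I. c \<odot>\<^bsub>M i\<^esub> v i)\<rparr>"

text \<open>\<open>U\<close> is the internal direct sum of the subspaces \<open>W1\<close> and \<open>W2\<close> of \<open>V\<close>.\<close>

definition internal_direct_sum ::
    "('k, 'r) ring_scheme \<Rightarrow> ('k, 'v, 'm) module_scheme \<Rightarrow> 'v set \<Rightarrow> 'v set \<Rightarrow> 'v set \<Rightarrow> bool" where
  "internal_direct_sum K V U W1 W2 \<longleftrightarrow>
     subspace K W1 V \<and> subspace K W2 V \<and>
     U = module.submodule_sum V W1 W2 \<and> W1 \<inter> W2 = {\<zero>\<^bsub>V\<^esub>}"

definition V_space :: "('a, 'b) monoid_scheme \<Rightarrow> (bit, 'a set set \<Rightarrow> bit) module" where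
  "V_space G = ring.func_space F2 (ncc_classes G)"

definition S2_sets :: "('a, 'b) monoid_scheme \<Rightarrow> 'a set set set set" where
  "S2_sets G = {S. S \<subseteq> ncc_classes G \<and>
     [(2::nat)] \<cdot>\<^bsub>rat_burnside G\<^esub> idem_sum G S \<in> carrier (burnside G)}"

definition S2 :: "('a, 'b) monoid_scheme \<Rightarrow> ('a set set \<Rightarrow> bit) set" where
  "S2 G = (\<lambda>S. \<lambda>C\<in>ncc_classes G. if C \<in> S then 1 else 0) ` S2_sets G"


section \<open>Defect spaces\<close>

definition Cl0 :: "('w, 'b) monoid_scheme \<Rightarrow> (bit, 'w \<Rightarrow> bit) module" where
  "Cl0 W = (ring.func_space F2 (carrier W))
     \<lparr>carrier := {f \<in> carrier W \<rightarrow>\<^sub>E UNIV. f \<one>\<^bsub>W\<^esub> = 0 \<and>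
        (\<forall>g\<in>carrier W. \<forall>h\<in>carrier W. f (h \<otimes>\<^bsub>W\<^esub> g \<otimes>\<^bsub>W\<^esub> inv\<^bsub>W\<^esub> h) = f g)}\<rparr>"

definition Hom_F2 :: "('w, 'b) monoid_scheme \<Rightarrow> ('w \<Rightarrow> bit) set" where
  "Hom_F2 W = hom W (add_monoid F2) \<inter> extensional (carrier W)"

definition defect :: "('w, 'b) monoid_scheme \<Rightarrow> (bit, ('w \<Rightarrow> bit) set) module" where
  "defect W = quot_module (Cl0 W) (Hom_F2 W)"

definition defect_class :: "('w, 'b) monoid_scheme \<Rightarrow> ('w \<Rightarrow> bit) \<Rightarrow> ('w \<Rightarrow> bit) set" where
  "defect_class W f = Hom_F2 W +>\<^bsub>Cl0 W\<^esub> f"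

text \<open>
  The pullback \<open>f\<^sup>*\<close> of defect spaces along a homomorphism \<open>f\<close> with domain \<open>W\<close>.
  The union is over the representatives of the coset \<open>\<omega>\<close>; they all contribute the same coset.
\<close>

definition defect_pullback ::
    "('w, 'b) monoid_scheme \<Rightarrow> ('w \<Rightarrow> 'u) \<Rightarrow> ('u \<Rightarrow> bit) set \<Rightarrow> ('w \<Rightarrow> bit) set" where
  "defect_pullback W f \<omega> = (\<Union>\<phi>\<in>\<omega>. defect_class W (compose (carrier W) \<phi> f))"

definition ext0 :: "('a, 'b) monoid_scheme \<Rightarrow> ('a set set \<Rightarrow> bit) \<Rightarrow> 'a set set \<Rightarrow> bit" where
  "ext0 G x = (\<lambda>C\<in>subgroup_classes G. if C \<in> ncc_classes G then x C else 0)"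

text \<open>For a coset \<open>X = gK\<close>, the subgroup generated by \<open>K\<close> and \<open>g\<close> is the one generated by \<open>K \<union> X\<close>.\<close>

definition lam :: "('a, 'b) monoid_scheme \<Rightarrow> ('a set set \<Rightarrow> bit) \<Rightarrow> 'a set \<Rightarrow> 'a set \<Rightarrow> bit" where
  "lam G x K = (\<lambda>X\<in>carrier (weyl G K).
     ext0 G x (conj_class G (generate G (K \<union> X))) + ext0 G x (conj_class G K))"

text \<open>In what follows \<open>R\<close> is the chosen set of representatives of the classes of subgroups.\<close>

definition D_space :: "('a, 'b) monoid_scheme \<Rightarrow> 'a set set \<Rightarrow> (bit, 'a set \<Rightarrow> ('a set \<Rightarrow> bit) set) module" where
  "D_space G R = prod_module R (\<lambda>K. defect (weyl G K))"

definition Def :: "('a, 'b) monoid_scheme \<Rightarrow> 'a set set \<Rightarrow> ('a set set \<Rightarrow> bit) \<Rightarrow> 'a set \<Rightarrow> ('a set \<Rightarrow> bit) set" where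
  "Def G R x = (\<lambda>K\<in>R. defect_class (weyl G K) (lam G x K))"

text \<open>
  The component of \<open>\<omega>\<close> at an arbitrary subgroup \<open>M\<close>, transported from the representative
  \<open>K = gMg\<^sup>-\<^sup>1\<close> of its class along conjugation \<open>W\<^sub>G(M) \<rightarrow> W\<^sub>G(K)\<close>.  The choice of \<open>g\<close> is
  immaterial, because \<open>N\<^sub>G(K)\<close> acts on \<open>W\<^sub>G(K)\<close> by inner automorphisms, which fix all class functions.
\<close>

definition component ::
    "('a, 'b) monoid_scheme \<Rightarrow> 'a set set \<Rightarrow> ('a set \<Rightarrow> ('a set \<Rightarrow> bit) set) \<Rightarrow> 'a set \<Rightarrow> ('a set \<Rightarrow> bit) set" where
  "component G R \<omega> M = (let g = (SOME g. g \<in> carrier G \<and> conj_act G g M \<in> R)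
     in defect_pullback (weyl G M) (conj_act G g) (\<omega> (conj_act G g M)))"


section \<open>Inflation and fixed points\<close>

text \<open>
  \<open>proj G N H = \<pi>(H) = HN/N\<close>.  On a coset \<open>gH\<close>, an element of \<open>W\<^sub>G(H)\<close>, the same map has the
  value \<open>\<pi>(g)\<pi>(H)\<close>, so it also serves as the homomorphism \<open>W\<^sub>G(H) \<rightarrow> W\<^bsub>G/N\<^esub>(\<pi>(H))\<close>.
\<close>

definition proj :: "('a, 'b) monoid_scheme \<Rightarrow> 'a set \<Rightarrow> 'a set \<Rightarrow> 'a set set" where
  "proj G N H = (\<lambda>g. N #>\<^bsub>G\<^esub> g) ` H"

definition preim :: "('a, 'b) monoid_scheme \<Rightarrow> 'a set \<Rightarrow> 'a set set \<Rightarrow> 'a set" where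
  "preim G N L = {g \<in> carrier G. N #>\<^bsub>G\<^esub> g \<in> L}"

definition Inf_V :: "('a, 'b) monoid_scheme \<Rightarrow> 'a set \<Rightarrow> ('a set set set \<Rightarrow> bit) \<Rightarrow> 'a set set \<Rightarrow> bit" where
  "Inf_V G N x = (\<lambda>C\<in>ncc_classes G.
     if proj G N (rep C) \<in> ncc_subgroups (G Mod N)
     then x (conj_class (G Mod N) (proj G N (rep C))) else 0)"

definition Fix_V :: "('a, 'b) monoid_scheme \<Rightarrow> 'a set \<Rightarrow> ('a set set \<Rightarrow> bit) \<Rightarrow> 'a set set set \<Rightarrow> bit" where
  "Fix_V G N y = (\<lambda>D\<in>ncc_classes (G Mod N). y (conj_class G (preim G N (rep D))))"

definition Inf_D ::
    "('a, 'b) monoid_scheme \<Rightarrow> 'a set \<Rightarrow> 'a set set \<Rightarrow> 'a set set set \<Rightarrow>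
     ('a set set \<Rightarrow> ('a set set \<Rightarrow> bit) set) \<Rightarrow> 'a set \<Rightarrow> ('a set \<Rightarrow> bit) set" where
  "Inf_D G N R RQ \<omega> = (\<lambda>H\<in>R.
     defect_pullback (weyl G H) (proj G N) (component (G Mod N) RQ \<omega> (proj G N H)))"

definition Fix_D ::
    "('a, 'b) monoid_scheme \<Rightarrow> 'a set \<Rightarrow> 'a set set set \<Rightarrow>
     ('a set \<Rightarrow> ('a set \<Rightarrow> bit) set) \<Rightarrow> 'a set set \<Rightarrow> ('a set set \<Rightarrow> bit) set" where
  "Fix_D G N RQ \<eta> = (\<lambda>L\<in>RQ.
     the_inv_into (carrier (defect (weyl (G Mod N) L)))
       (defect_pullback (weyl G (preim G N L)) (proj G N)) (\<eta> (preim G N L)))"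

definition ker_Fix_V :: "('a, 'b) monoid_scheme \<Rightarrow> 'a set \<Rightarrow> ('a set set \<Rightarrow> bit) set" where
  "ker_Fix_V G N = mod_hom.ker (V_space G) (V_space (G Mod N)) (Fix_V G N)"

definition ker_Fix_D ::
    "('a, 'b) monoid_scheme \<Rightarrow> 'a set \<Rightarrow> 'a set set \<Rightarrow> 'a set set set \<Rightarrow> ('a set \<Rightarrow> ('a set \<Rightarrow> bit) set) set" where
  "ker_Fix_D G N R RQ = mod_hom.ker (D_space G R) (D_space (G Mod N) RQ) (Fix_D G N RQ)"

end

theory Submission
  imports Defs "HOL-Algebra.Zassenhaus"
begin

text \<open>
  On \<open>V\<close>, on the defect spaces and on \<open>S2\<close> alike, \<open>Fix\<close> is a retraction of \<open>Inf\<close>, and both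
  maps commute with \<open>Def\<close>; hence all the decompositions.  The values of \<open>Inf x\<close> and \<open>Fix y\<close>,
  extended by zero, at a subgroup \<open>H\<close> are those of \<open>x\<close> at \<open>\<pi>(H)\<close> and of \<open>y\<close> at the preimage of
  \<open>H\<close>, because \<open>H\<close> is non-core-cyclic whenever \<open>\<pi>(H)\<close> is, with equivalence if \<open>H\<close> is a preimage.

  Yoshida's criterion is not needed for \<open>S2\<close>: inflation of \<open>G/N\<close>-sets and \<open>N\<close>-fixed points of
  \<open>G\<close>-sets preserve integrality and transform marks in the same way as \<open>Inf\<close> and \<open>Fix\<close>
  transform \<open>V\<close>.  Moreover \<open>S2\<close> is closed under addition, since for idempotents \<open>e\<close> and \<open>f\<close> the
  element \<open>2e + 2f - (2e)(2f)\<close> has mark \<open>2\<close> exactly where one of \<open>e\<close> and \<open>f\<close> has mark \<open>1\<close> and the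
  other \<open>0\<close>.
\<close>

section \<open>Linear algebra over the field with two elements\<close>

text \<open>\<open>Inf_V\<close>, \<open>Fix_V\<close> and \<open>component\<close> depend on
  arbitrary choices, and the image of a chosen representative in \<open>G/N\<close> need not be a
  chosen one. Comparisons are therefore made at arbitrary subgroups, through \<open>ext0\<close> at
  the class of a subgroup, which depends on the class alone. They are set up for a homomorphism
  \<open>h\<close>, surjective where preimages occur; inner automorphisms are instances besides the
  quotient map, so conjugation invariance follows from the same lemmas.

  \<open>Def\<close> commutes with \<open>Fix\<close> because every subgroup above the preimage of
  \<open>L\<close> is itself a preimage: the local function at that preimage sees no other
  subgroups.

  In the Burnside ring both maps can be written on coefficients. Inflation sends
  \<open>[Q/L]\<close> to \<open>[G/M]\<close> with \<open>M\<close> the preimage of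
  \<open>L\<close>. As \<open>N\<close> is normal, it fixes either all of \<open>G/H\<close>, when
  \<open>N\<close> lies in \<open>H\<close>, or nothing; so taking \<open>N\<close>-fixed points
  keeps the coefficients at preimages and drops all others. Integrality is then immediate, and the
  content lies in the comparison of marks.\<close>

text \<open>The scalars are only \<open>0\<close> and \<open>1\<close>, so the module axioms become
  a case distinction. The condition that \<open>v + v\<close> is zero supplies both negatives and
  distributivity for \<open>1 + 1 = 0\<close>.\<close>

lemma F2_vectorspaceI:
  fixes V :: "(bit, 'v, 'm) module_scheme"
  assumes "\<zero>\<^bsub>V\<^esub> \<in> carrier V"
    and "\<And>v w. v \<in> carrier V \<Longrightarrow> w \<in> carrier V \<Longrightarrow> v \<oplus>\<^bsub>V\<^esub> w \<in> carrier V"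
    and "\<And>u v w. u \<in> carrier V \<Longrightarrow> v \<in> carrier V \<Longrightarrow> w \<in> carrier V \<Longrightarrow>
           u \<oplus>\<^bsub>V\<^esub> v \<oplus>\<^bsub>V\<^esub> w = u \<oplus>\<^bsub>V\<^esub> (v \<oplus>\<^bsub>V\<^esub> w)"
    and "\<And>v w. v \<in> carrier V \<Longrightarrow> w \<in> carrier V \<Longrightarrow> v \<oplus>\<^bsub>V\<^esub> w = w \<oplus>\<^bsub>V\<^esub> v"
    and "\<And>v. v \<in> carrier V \<Longrightarrow> \<zero>\<^bsub>V\<^esub> \<oplus>\<^bsub>V\<^esub> v = v"
    and "\<And>v. v \<in> carrier V \<Longrightarrow> v \<oplus>\<^bsub>V\<^esub> v = \<zero>\<^bsub>V\<^esub>"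
    and smult: "\<And>v. v \<in> carrier V \<Longrightarrow> 0 \<odot>\<^bsub>V\<^esub> v = \<zero>\<^bsub>V\<^esub>" "\<And>v. v \<in> carrier V \<Longrightarrow> 1 \<odot>\<^bsub>V\<^esub> v = v"
  shows "vectorspace F2 V"
proof -
  have V: "abelian_group V" using assms(1-6) by (intro abelian_groupI) blast+
  have "module F2 V"
  proof (intro Module.module.intro V Module.module_axioms.intro)
    show "cring F2" by (rule class_cring.is_cring)
  next
    fix a b :: bit and x assume "x \<in> carrier V"
    then show "(a \<oplus>\<^bsub>F2\<^esub> b) \<odot>\<^bsub>V\<^esub> x = a \<odot>\<^bsub>V\<^esub> x \<oplus>\<^bsub>V\<^esub> b \<odot>\<^bsub>V\<^esub> x"
      using assms by (cases a; cases b) auto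
  next
    fix a b :: bit and x assume "x \<in> carrier V"
    then show "(a \<otimes>\<^bsub>F2\<^esub> b) \<odot>\<^bsub>V\<^esub> x = a \<odot>\<^bsub>V\<^esub> (b \<odot>\<^bsub>V\<^esub> x)"
      using assms by (cases a; cases b) auto
  next
    fix a :: bit and x y assume "x \<in> carrier V" "y \<in> carrier V"
    then show "a \<odot>\<^bsub>V\<^esub> (x \<oplus>\<^bsub>V\<^esub> y) = a \<odot>\<^bsub>V\<^esub> x \<oplus>\<^bsub>V\<^esub> a \<odot>\<^bsub>V\<^esub> y"
      using assms by (cases a) auto
  next
    fix a :: bit and x assume "x \<in> carrier V"
    then show "a \<odot>\<^bsub>V\<^esub> x \<in> carrier V" using assms by (cases a) auto
  qed (use smult in auto)
  moreover have "field F2" by (rule class_field.field_axioms)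
  ultimately show ?thesis by (rule vectorspace.intro)
qed

context
  fixes V :: "(bit, 'v, 'm) module_scheme"
  assumes V: "vectorspace F2 V"
begin

interpretation vectorspace F2 V by (rule V)

lemma F2_smult: "v \<in> carrier V \<Longrightarrow> 0 \<odot>\<^bsub>V\<^esub> v = \<zero>\<^bsub>V\<^esub>" "v \<in> carrier V \<Longrightarrow> 1 \<odot>\<^bsub>V\<^esub> v = v"
  using lmult_0 smult_one by simp_all

lemma F2_add_self: "v \<in> carrier V \<Longrightarrow> v \<oplus>\<^bsub>V\<^esub> v = \<zero>\<^bsub>V\<^esub>"
  using smult_l_distr[of 1 1 v] F2_smult by simp

lemma F2_subspaceI:
  assumes "W \<subseteq> carrier V" "\<zero>\<^bsub>V\<^esub> \<in> W" "\<And>v w. v \<in> W \<Longrightarrow> w \<in> W \<Longrightarrow> v \<oplus>\<^bsub>V\<^esub> w \<in> W"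
  shows "subspace F2 W V"
proof (intro subspace.intro V submodule.intro)
  show "c \<odot>\<^bsub>V\<^esub> v \<in> W" if "v \<in> W" for c v
    using that assms F2_smult by (cases c) (auto simp: subset_iff)
qed (use assms module_axioms in auto)

text \<open>Additivity suffices: it forces \<open>T\<close> to send zero to zero, which settles the
  scalar \<open>0\<close>, and the scalar \<open>1\<close> is trivial.\<close>

lemma F2_linear_mapI:
  fixes W :: "(bit, 'w, 'n) module_scheme"
  assumes W: "vectorspace F2 W"
    and T: "T \<in> carrier V \<rightarrow> carrier W"
    and add: "\<And>v w. v \<in> carrier V \<Longrightarrow> w \<in> carrier V \<Longrightarrow> T (v \<oplus>\<^bsub>V\<^esub> w) = T v \<oplus>\<^bsub>W\<^esub> T w"
  shows "linear_map F2 V W T"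
proof -
  interpret W: vectorspace F2 W by (rule W)
  have "T \<zero>\<^bsub>V\<^esub> \<oplus>\<^bsub>W\<^esub> T \<zero>\<^bsub>V\<^esub> = T \<zero>\<^bsub>V\<^esub>" "T \<zero>\<^bsub>V\<^esub> \<in> carrier W"
    using add[of "\<zero>\<^bsub>V\<^esub>" "\<zero>\<^bsub>V\<^esub>"] T by auto
  then have zero: "T \<zero>\<^bsub>V\<^esub> = \<zero>\<^bsub>W\<^esub>" by simp
  have smult: "T (c \<odot>\<^bsub>V\<^esub> v) = c \<odot>\<^bsub>W\<^esub> T v" if "v \<in> carrier V" for c v
  proof -
    have "T v \<in> carrier W" using T that by auto
    then show ?thesis using that zero F2_smult W.lmult_0 W.smult_one by (cases c) auto
  qed
  show ?thesis
    by (intro linear_map.intro V W mod_hom.intro module_axioms W.module_axioms mod_hom_axioms.intro)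
      (use T add smult in \<open>auto simp: LinearCombinations.module_hom_def\<close>)
qed

end

lemma linear_map_comp:
  assumes "linear_map K U V S" "linear_map K V W T" shows "linear_map K U W (\<lambda>u. T (S u))"
proof -
  interpret S: linear_map K U V S by fact
  interpret T: linear_map K V W T by fact
  show ?thesis
    by (intro linear_map.intro mod_hom.intro mod_hom_axioms.intro S.V.vectorspace_axioms
        T.W.vectorspace_axioms vectorspace.axioms(1)[OF S.V.vectorspace_axioms] vectorspace.axioms(1)[OF T.W.vectorspace_axioms]) (auto simp: LinearCombinations.module_hom_def)
qed

text \<open>Serves \<open>Fix_D\<close>, whose components are inverses of pullbacks.\<close>

lemma linear_map_the_inv_into:
  assumes T: "linear_map K V W T" and bij: "bij_betw T (carrier V) (carrier W)"
  shows "linear_map K W V (the_inv_into (carrier V) T)"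
proof -
  interpret T: linear_map K V W T by fact
  let ?S = "the_inv_into (carrier V) T"
  have inj: "inj_on T (carrier V)" and im: "T ` carrier V = carrier W" using bij by (auto simp: bij_betw_def)
  have S: "?S w \<in> carrier V" "T (?S w) = w" if "w \<in> carrier W" for w
    using that im the_inv_into_into[OF inj, of w "carrier V"] f_the_inv_into_f[OF inj, of w] by auto
  have eq: "?S w = v" if "v \<in> carrier V" "T v = w" for v w using inj that the_inv_into_f_eq by metis
  show ?thesis
    by (intro linear_map.intro mod_hom.intro mod_hom_axioms.intro T.V.vectorspace_axioms
        T.W.vectorspace_axioms vectorspace.axioms(1)[OF T.V.vectorspace_axioms] vectorspace.axioms(1)[OF T.W.vectorspace_axioms])
      (auto simp: LinearCombinations.module_hom_def S intro!: eq)
qed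

section \<open>Products of spaces and linear maps into them\<close>

lemma prod_module_sel:
  "carrier (prod_module I M) = (\<Pi>\<^sub>E i\<in>I. carrier (M i))"
  "\<zero>\<^bsub>prod_module I M\<^esub> = (\<lambda>i\<in>I. \<zero>\<^bsub>M i\<^esub>)"
  "v \<oplus>\<^bsub>prod_module I M\<^esub> w = (\<lambda>i\<in>I. v i \<oplus>\<^bsub>M i\<^esub> w i)"
  "c \<odot>\<^bsub>prod_module I M\<^esub> v = (\<lambda>i\<in>I. c \<odot>\<^bsub>M i\<^esub> v i)"
  by (simp_all add: prod_module_def)

lemma vectorspace_prod_module:
  assumes "\<And>i. i \<in> I \<Longrightarrow> vectorspace F2 (M i)"
  shows "vectorspace F2 (prod_module I M)"
proof -
  have grp: "abelian_group (M i)" if "i \<in> I" for i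
    by (rule Module.module.axioms(2)[OF vectorspace.axioms(1)[OF assms[OF that]]])
  note ab = abelian_monoid.a_closed[OF abelian_group.axioms(1)[OF grp]]
    abelian_monoid.zero_closed[OF abelian_group.axioms(1)[OF grp]]
    abelian_monoid.a_assoc[OF abelian_group.axioms(1)[OF grp]]
    abelian_monoid.a_comm[OF abelian_group.axioms(1)[OF grp]]
    abelian_monoid.l_zero[OF abelian_group.axioms(1)[OF grp]]
  have self: "x \<oplus>\<^bsub>M i\<^esub> x = \<zero>\<^bsub>M i\<^esub>" "0 \<odot>\<^bsub>M i\<^esub> x = \<zero>\<^bsub>M i\<^esub>" "1 \<odot>\<^bsub>M i\<^esub> x = x"
    if "i \<in> I" "x \<in> carrier (M i)" for i x
    using that F2_add_self[OF assms] F2_smult[OF assms] by auto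
  have mem: "v i \<in> carrier (M i)" if "v \<in> (\<Pi>\<^sub>E i\<in>I. carrier (M i))" "i \<in> I" for v i
    using that by (rule PiE_mem)
  have id: "(\<lambda>i\<in>I. f i) = v" if "v \<in> (\<Pi>\<^sub>E i\<in>I. carrier (M i))" "\<And>i. i \<in> I \<Longrightarrow> f i = v i" for f v
    using that by (metis PiE_restrict restrict_ext)
  show ?thesis
    by (rule F2_vectorspaceI; unfold prod_module_sel)
      (auto simp: ab(1,2,3,5) self mem intro!: restrict_ext id, rule ab(4), auto simp: mem)
qed

text \<open>\<open>Def\<close>, \<open>Inf_D\<close> and \<open>Fix_D\<close> are all given
  component by component; this reduces their linearity to one component.\<close>

lemma linear_map_into_prod:
  assumes V: "vectorspace F2 V" and T: "\<And>i. i \<in> I \<Longrightarrow> linear_map F2 V (M i) (T i)"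
  shows "linear_map F2 V (prod_module I M) (\<lambda>v. \<lambda>i\<in>I. T i v)"
proof (rule F2_linear_mapI[OF V vectorspace_prod_module])
  have hom: "T i \<in> LinearCombinations.module_hom F2 V (M i)" if "i \<in> I" for i
    by (rule mod_hom.f_hom[OF linear_map.axioms(3)[OF T[OF that]]])
  show "(\<lambda>v. \<lambda>i\<in>I. T i v) \<in> carrier V \<rightarrow> carrier (prod_module I M)"
    using hom by (fastforce simp: prod_module_sel LinearCombinations.module_hom_def)
  show "(\<lambda>i\<in>I. T i (v \<oplus>\<^bsub>V\<^esub> w)) = (\<lambda>i\<in>I. T i v) \<oplus>\<^bsub>prod_module I M\<^esub> (\<lambda>i\<in>I. T i w)"
    if "v \<in> carrier V" "w \<in> carrier V" for v w
    using hom that by (auto simp: prod_module_sel LinearCombinations.module_hom_def)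
  show "vectorspace F2 (M i)" if "i \<in> I" for i by (rule linear_map.axioms(2)[OF T[OF that]])
qed

lemma linear_map_prod_component:
  assumes "\<And>i. i \<in> I \<Longrightarrow> vectorspace F2 (M i)" and "i \<in> I"
  shows "linear_map F2 (prod_module I M) (M i) (\<lambda>v. v i)"
  by (rule F2_linear_mapI[OF vectorspace_prod_module]) (use assms in \<open>auto simp: prod_module_sel\<close>)


section \<open>Quotients by a subspace\<close>

context
  fixes M :: "(bit, 'v, 'm) module_scheme" and H :: "'v set"
  assumes sub: "subspace F2 H M"
begin

interpretation M: vectorspace F2 M using sub by (rule subspace.vs)
interpretation H: submodule F2 H M using sub by (rule subspace.submod)

interpretation abelian_subgroup H M
proof -
  \<comment> \<open>Every vector is its own negative, so a subspace is closed under negatives for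
    free.\<close>
  have *: "\<ominus>\<^bsub>M\<^esub> v = v" if "v \<in> carrier M" for v
    using M.minus_equality[of v v] F2_add_self[OF M.vectorspace_axioms] that by simp
  have "additive_subgroup H M"
    unfolding additive_subgroup_def
    by (rule group.subgroupI[OF M.add.is_group])
      (use H.subset H.zero_closed * in \<open>auto simp: subset_iff a_inv_def[symmetric] simp del: H.zero_closed\<close>)
  then show "abelian_subgroup H M"
    by (intro abelian_subgroupI3 M.abelian_group_axioms)
qed

lemma quot_module_carrier: "carrier (quot_module M H) = (\<lambda>v. H +>\<^bsub>M\<^esub> v) ` carrier M"
  by (auto simp: quot_module_def A_RCOSETS_def')

lemma quot_module_zero: "\<zero>\<^bsub>quot_module M H\<^esub> = H +>\<^bsub>M\<^esub> \<zero>\<^bsub>M\<^esub>"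
  using H.subset by (simp add: quot_module_def)

lemma quot_module_add:
  "v \<in> carrier M \<Longrightarrow> w \<in> carrier M \<Longrightarrow>
   (H +>\<^bsub>M\<^esub> v) \<oplus>\<^bsub>quot_module M H\<^esub> (H +>\<^bsub>M\<^esub> w) = H +>\<^bsub>M\<^esub> (v \<oplus>\<^bsub>M\<^esub> w)"
  by (simp add: quot_module_def a_rcos_sum)

lemma coset_self: "v \<in> carrier M \<Longrightarrow> v \<in> H +>\<^bsub>M\<^esub> v"
  by (rule a_rcos_self)

lemma coset_mem: "v \<in> carrier M \<Longrightarrow> w \<in> H +>\<^bsub>M\<^esub> v \<Longrightarrow> w \<in> carrier M \<and> H +>\<^bsub>M\<^esub> w = H +>\<^bsub>M\<^esub> v"
  using a_repr_independence' by (metis a_elemrcos_carrier)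

lemma coset_eq_iff:
  assumes "v \<in> carrier M" "w \<in> carrier M"
  shows "H +>\<^bsub>M\<^esub> v = H +>\<^bsub>M\<^esub> w \<longleftrightarrow> v \<oplus>\<^bsub>M\<^esub> w \<in> H"
proof -
  have "\<ominus>\<^bsub>M\<^esub> w = w"
    using M.minus_equality[of w w] F2_add_self[OF M.vectorspace_axioms] assms by simp
  then have "v \<oplus>\<^bsub>M\<^esub> w \<in> H \<longleftrightarrow> v \<in> H +>\<^bsub>M\<^esub> w"
    using a_rcos_module[OF assms(2,1)] by simp
  then show ?thesis using assms coset_self coset_mem by metis
qed

lemma vectorspace_quot_module: "vectorspace F2 (quot_module M H)"
proof (rule F2_vectorspaceI; (unfold quot_module_carrier)?)
  fix X assume "X \<in> (\<lambda>v. H +>\<^bsub>M\<^esub> v) ` carrier M"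
  then obtain v where v: "v \<in> carrier M" "X = H +>\<^bsub>M\<^esub> v" by auto
  have [simp]: "0 \<odot>\<^bsub>M\<^esub> w = \<zero>\<^bsub>M\<^esub>" "1 \<odot>\<^bsub>M\<^esub> w = w" if "w \<in> X" for w
    using coset_mem[OF v(1)] v(2) that F2_smult[OF M.vectorspace_axioms] by auto
  \<comment> \<open>The scalar action is a union over the members of the coset; without a member,
    multiplication by \<open>0\<close> would give the empty set instead of the zero coset.\<close>
  have ne: "X \<noteq> {}" using coset_self v by auto
  have "(\<Union>w\<in>X. H +>\<^bsub>M\<^esub> w) = X" using coset_mem[OF v(1)] ne v(2) by auto
  then show "1 \<odot>\<^bsub>quot_module M H\<^esub> X = X" by (simp add: quot_module_def)
  show "0 \<odot>\<^bsub>quot_module M H\<^esub> X = \<zero>\<^bsub>quot_module M H\<^esub>"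
    unfolding quot_module_zero using ne by (simp add: quot_module_def)
next
  fix X Y assume "X \<in> (\<lambda>v. H +>\<^bsub>M\<^esub> v) ` carrier M" "Y \<in> (\<lambda>v. H +>\<^bsub>M\<^esub> v) ` carrier M"
  then show "X \<oplus>\<^bsub>quot_module M H\<^esub> Y = Y \<oplus>\<^bsub>quot_module M H\<^esub> X"
    using M.a_comm by (auto simp: quot_module_add)
qed (auto simp: quot_module_add quot_module_zero M.a_assoc F2_add_self[OF M.vectorspace_axioms] simp del: M.a_comm)

lemma linear_map_coset: "linear_map F2 M (quot_module M H) (\<lambda>v. H +>\<^bsub>M\<^esub> v)"
  by (rule F2_linear_mapI[OF M.vectorspace_axioms vectorspace_quot_module])
    (auto simp: quot_module_add quot_module_carrier)

end

section \<open>Subspaces respected by a linear retraction\<close>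

context
  fixes K :: "('k, 'r) ring_scheme" and V :: "('k, 'v, 'm) module_scheme"
    and W :: "('k, 'w, 'n) module_scheme" and I F U U'
  assumes I: "linear_map K W V I" and F: "linear_map K V W F"
    and FI: "\<And>w. w \<in> carrier W \<Longrightarrow> F (I w) = w"
    and U: "subspace K U V" and U': "subspace K U' W"
    and IU: "I ` U' \<subseteq> U" and FU: "F ` U \<subseteq> U'"
begin

interpretation F: linear_map K V W F by (rule F)
interpretation I: linear_map K W V I by (rule I)
interpretation U: submodule K U V using U by (rule subspace.submod)
interpretation U': submodule K U' W using U' by (rule subspace.submod)

lemma subspace_Int_ker: "subspace K (U \<inter> mod_hom.ker V W F) V"
  by (intro subspace.intro F.V.vectorspace_axioms submodule.intro vectorspace.axioms(1)[OF F.V.vectorspace_axioms])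
    (use U.subset in \<open>auto simp: F.ker_def subset_iff\<close>)

text \<open>The splitting is \<open>v = I (F v) + (v - I (F v))\<close>. It stays inside
  \<open>U\<close> because \<open>F\<close> maps \<open>U\<close> to \<open>U'\<close> and
  \<open>I\<close> maps \<open>U'\<close> back to \<open>U\<close>.\<close>

lemma internal_direct_sum_retraction:
  "internal_direct_sum K V U (I ` U') (U \<inter> mod_hom.ker V W F)"
  unfolding internal_direct_sum_def
proof (intro conjI subspace_Int_ker)
  show "subspace K (I ` U') V"
  proof (intro subspace.intro F.V.vectorspace_axioms submodule.intro vectorspace.axioms(1)[OF F.V.vectorspace_axioms])
    show "I ` U' \<subseteq> carrier V" using U'.subset by auto
    show "\<zero>\<^bsub>V\<^esub> \<in> I ` U'" using U'.zero_closed by (metis I.f0_is_0 image_eqI)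
  next
    fix v w assume "v \<in> I ` U'" "w \<in> I ` U'"
    then obtain a b where *: "a \<in> U'" "b \<in> U'" "v = I a" "w = I b" by auto
    then have "v \<oplus>\<^bsub>V\<^esub> w = I (a \<oplus>\<^bsub>W\<^esub> b)" using U'.subset by (auto simp: subset_iff)
    then show "v \<oplus>\<^bsub>V\<^esub> w \<in> I ` U'" using * by auto
  next
    fix c v assume c: "c \<in> carrier K" and "v \<in> I ` U'"
    then obtain a where *: "a \<in> U'" "v = I a" by auto
    then have "c \<odot>\<^bsub>V\<^esub> v = I (c \<odot>\<^bsub>W\<^esub> a)" using U'.subset c by (auto simp: subset_iff)
    then show "c \<odot>\<^bsub>V\<^esub> v \<in> I ` U'" using * c by auto
  qed
  show "I ` U' \<inter> (U \<inter> mod_hom.ker V W F) = {\<zero>\<^bsub>V\<^esub>}"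
  proof
    show "I ` U' \<inter> (U \<inter> mod_hom.ker V W F) \<subseteq> {\<zero>\<^bsub>V\<^esub>}"
    proof
      fix v assume "v \<in> I ` U' \<inter> (U \<inter> mod_hom.ker V W F)"
      then obtain w where "w \<in> U'" "v = I w" "F v = \<zero>\<^bsub>W\<^esub>" by (auto simp: F.ker_def)
      then have "v = I \<zero>\<^bsub>W\<^esub>" using FI U'.subset by (metis subsetD)
      then show "v \<in> {\<zero>\<^bsub>V\<^esub>}" by simp
    qed
    have "\<zero>\<^bsub>V\<^esub> \<in> I ` U'" using U'.zero_closed by (metis I.f0_is_0 image_eqI)
    then show "{\<zero>\<^bsub>V\<^esub>} \<subseteq> I ` U' \<inter> (U \<inter> mod_hom.ker V W F)" by (simp add: F.ker_def)
  qed
  show "U = module.submodule_sum V (I ` U') (U \<inter> mod_hom.ker V W F)"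
  proof
    show "U \<subseteq> module.submodule_sum V (I ` U') (U \<inter> mod_hom.ker V W F)"
    proof
      fix v assume v: "v \<in> U"
      let ?p = "I (F v)"
      have V: "v \<in> carrier V" "?p \<in> carrier V" "F v \<in> U'" "?p \<in> U" "F v \<in> carrier W"
        using v U.subset U'.subset FU IU by (auto simp: subset_iff)
      \<comment> \<open>A submodule is closed under scalars, so the negative is obtained as the
        multiple by minus one.\<close>
      have neg: "\<ominus>\<^bsub>V\<^esub> ?p \<in> U"
        using U.smult_closed[OF _ V(4), of "\<ominus>\<^bsub>K\<^esub> \<one>\<^bsub>K\<^esub>"] module.smult_minus_1[OF vectorspace.axioms(1)[OF F.V.vectorspace_axioms] V(2)] by simp
      have U: "v \<ominus>\<^bsub>V\<^esub> ?p \<in> U" using neg v by (simp add: a_minus_def)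
      have "F (v \<ominus>\<^bsub>V\<^esub> ?p) = \<zero>\<^bsub>W\<^esub>" using V FI F.f_minus by simp
      then have "v \<ominus>\<^bsub>V\<^esub> ?p \<in> U \<inter> mod_hom.ker V W F" using U U.subset by (simp add: F.ker_def subset_iff)
      moreover have "v = ?p \<oplus>\<^bsub>V\<^esub> (v \<ominus>\<^bsub>V\<^esub> ?p)"
      proof -
        have ab: "abelian_group V"
          by (rule Module.module.axioms(2)[OF vectorspace.axioms(1)[OF F.V.vectorspace_axioms]])
        have "v \<ominus>\<^bsub>V\<^esub> ?p = \<ominus>\<^bsub>V\<^esub> ?p \<oplus>\<^bsub>V\<^esub> v"
          unfolding a_minus_def
          by (rule abelian_monoid.a_comm[OF abelian_group.axioms(1)[OF ab]])
            (use V in \<open>auto intro: abelian_group.a_inv_closed[OF ab]\<close>)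
        then show ?thesis using abelian_group.r_neg2[OF ab V(2,1)] by simp
      qed
      ultimately show "v \<in> module.submodule_sum V (I ` U') (U \<inter> mod_hom.ker V W F)"
        unfolding module.submodule_sum_def[OF vectorspace.axioms(1)[OF F.V.vectorspace_axioms]] using V(3)
        by (intro image_eqI[of _ _ "(?p, v \<ominus>\<^bsub>V\<^esub> ?p)"]) auto
    qed
    show "module.submodule_sum V (I ` U') (U \<inter> mod_hom.ker V W F) \<subseteq> U"
      unfolding module.submodule_sum_def[OF vectorspace.axioms(1)[OF F.V.vectorspace_axioms]] using IU by auto
  qed
qed

text \<open>Rank-nullity for the restriction of \<open>F\<close> to \<open>U\<close>. Its image is
  all of \<open>U'\<close>, since each \<open>w\<close> in \<open>U'\<close> is
  \<open>F (I w)\<close> with \<open>I w\<close> in \<open>U\<close>.\<close>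

lemma dim_retraction:
  assumes fin: "finite U"
  shows "vectorspace.dim K (V\<lparr>carrier := U\<rparr>) =
    vectorspace.dim K (W\<lparr>carrier := U'\<rparr>) +
    vectorspace.dim K (V\<lparr>carrier := U \<inter> mod_hom.ker V W F\<rparr>)"
proof -
  have VU: "vectorspace K (V\<lparr>carrier := U\<rparr>)" by (rule F.V.subspace_is_vs[OF U])
  have WU: "vectorspace K (W\<lparr>carrier := U'\<rparr>)" by (rule F.W.subspace_is_vs[OF U'])
  interpret VU: vectorspace K "V\<lparr>carrier := U\<rparr>" by (rule VU)
  interpret WU: vectorspace K "W\<lparr>carrier := U'\<rparr>" by (rule WU)
  interpret R: linear_map K "V\<lparr>carrier := U\<rparr>" "W\<lparr>carrier := U'\<rparr>" F
    by (intro linear_map.intro VU WU mod_hom.intro mod_hom_axioms.intro VU.module_axioms WU.module_axioms)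
      (use FU U.subset in \<open>auto simp: LinearCombinations.module_hom_def subset_iff\<close>)
  \<comment> \<open>The finite set \<open>U\<close> generates itself, which gives the finite
    dimension that rank-nullity asks for.\<close>
  have "VU.gen_set U" using VU.in_own_span[of U] VU.span_is_subset2[of U] by auto
  then have "VU.fin_dim" unfolding VU.fin_dim_def using fin by (intro exI[of _ U]) auto
  note R.rank_nullity[OF this]
  moreover have "R.im = U'"
  proof -
    have "F ` I ` U' = U'" using FI U'.subset by (simp add: image_image subset_iff cong: image_cong)
    moreover have "R.im = F ` U" by (simp add: R.im_def)
    ultimately show ?thesis using IU FU by blast
  qed
  moreover have "R.ker = U \<inter> mod_hom.ker V W F" using U.subset by (auto simp: R.ker_def F.ker_def)
  ultimately show ?thesis by simp
qed

end

lemma subspace_carrier: "vectorspace K V \<Longrightarrow> subspace K (carrier V) V"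
proof (intro subspace.intro)
  assume V: "vectorspace K V"
  interpret vectorspace K V by (rule V)
  show "submodule K (carrier V) V" by (intro submodule.intro module_axioms) auto
qed

lemma internal_direct_sum_carrier:
  assumes I: "linear_map K W V I" and F: "linear_map K V W F"
    and FI: "\<And>w. w \<in> carrier W \<Longrightarrow> F (I w) = w"
  shows "internal_direct_sum K V (carrier V) (I ` carrier W) (mod_hom.ker V W F)"
proof -
  interpret F: linear_map K V W F by (rule F)
  interpret I: linear_map K W V I by (rule I)
  have "internal_direct_sum K V (carrier V) (I ` carrier W) (carrier V \<inter> F.ker)"
    by (rule internal_direct_sum_retraction[OF I F FI subspace_carrier[OF F.V.vectorspace_axioms]
          subspace_carrier[OF F.W.vectorspace_axioms]]) auto
  moreover have "carrier V \<inter> F.ker = F.ker" by (auto simp: F.ker_def)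
  ultimately show ?thesis by simp
qed


section \<open>Pullback of defect classes\<close>

declare add_bit_eq_xor [simp del] mult_bit_eq_and [simp del]

lemma bit_add_self: "(a::bit) + a = 0"
  by (cases a) simp_all

lemma bit_add_eq_0_iff: "(a::bit) + b = 0 \<longleftrightarrow> a = b"
  by (cases a; cases b) simp_all

lemma V_space_sel:
  "carrier (V_space G) = extensional (ncc_classes G)"
  "\<zero>\<^bsub>V_space G\<^esub> = (\<lambda>C\<in>ncc_classes G. 0)"
  "x \<oplus>\<^bsub>V_space G\<^esub> y = (\<lambda>C\<in>ncc_classes G. x C + y C)"
  "c \<odot>\<^bsub>V_space G\<^esub> y = (\<lambda>C\<in>ncc_classes G. c * y C)"
  by (simp_all add: V_space_def class_ring.func_space_def PiE_def)

lemma Cl0_sel: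
  "carrier (Cl0 W) = {f \<in> carrier W \<rightarrow>\<^sub>E UNIV. f \<one>\<^bsub>W\<^esub> = 0 \<and>
     (\<forall>g\<in>carrier W. \<forall>h\<in>carrier W. f (h \<otimes>\<^bsub>W\<^esub> g \<otimes>\<^bsub>W\<^esub> inv\<^bsub>W\<^esub> h) = f g)}"
  "\<zero>\<^bsub>Cl0 W\<^esub> = (\<lambda>w\<in>carrier W. 0)"
  "x \<oplus>\<^bsub>Cl0 W\<^esub> y = (\<lambda>w\<in>carrier W. x w + y w)"
  "c \<odot>\<^bsub>Cl0 W\<^esub> y = (\<lambda>w\<in>carrier W. c * y w)"
  by (simp_all add: Cl0_def class_ring.func_space_def)

lemma Cl0_iff:
  "f \<in> carrier (Cl0 W) \<longleftrightarrow> f \<in> extensional (carrier W) \<and> f \<one>\<^bsub>W\<^esub> = 0 \<and>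
     (\<forall>g\<in>carrier W. \<forall>h\<in>carrier W. f (h \<otimes>\<^bsub>W\<^esub> g \<otimes>\<^bsub>W\<^esub> inv\<^bsub>W\<^esub> h) = f g)"
  by (auto simp: Cl0_sel PiE_def)

lemma Hom_F2_iff:
  "f \<in> Hom_F2 W \<longleftrightarrow> f \<in> extensional (carrier W) \<and>
     (\<forall>g\<in>carrier W. \<forall>h\<in>carrier W. f (g \<otimes>\<^bsub>W\<^esub> h) = f g + f h)"
  by (auto simp: Hom_F2_def hom_def)

lemma vectorspace_V_space: "vectorspace F2 (V_space G)"
  by (rule F2_vectorspaceI; unfold V_space_sel)
    (simp_all add: add.assoc bit_add_self add.commute add.left_commute extensional_restrict cong: restrict_cong)

section \<open>Class functions modulo homomorphisms\<close>

context
  fixes W :: "('w, 'b) monoid_scheme" (structure)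
  assumes W: "group W"
begin

interpretation W: group W by (rule W)

lemma vectorspace_Cl0: "vectorspace F2 (Cl0 W)"
  by (rule F2_vectorspaceI; (unfold Cl0_iff)?; (unfold Cl0_sel(2-))?)
    (simp_all add: add.assoc bit_add_self add.commute add.left_commute extensional_restrict cong: restrict_cong)

lemma Hom_F2_one: "f \<in> Hom_F2 W \<Longrightarrow> f \<one> = 0"
  unfolding Hom_F2_iff by (metis W.one_closed W.r_one add_cancel_right_right)

text \<open>A homomorphism into a group of exponent two is a class function, because its values at
  \<open>h\<close> and at the inverse of \<open>h\<close> agree and cancel.\<close>

lemma subspace_Hom_F2: "subspace F2 (Hom_F2 W) (Cl0 W)"
proof (rule F2_subspaceI[OF vectorspace_Cl0])
  show "Hom_F2 W \<subseteq> carrier (Cl0 W)"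
  proof
    fix f assume f: "f \<in> Hom_F2 W"
    have "f (h \<otimes> g \<otimes> inv h) = f g" if "g \<in> carrier W" "h \<in> carrier W" for g h
    proof -
      have hom: "f (a \<otimes> b) = f a + f b" if "a \<in> carrier W" "b \<in> carrier W" for a b
        using f that by (simp add: Hom_F2_iff)
      have "f h + f (inv h) = 0" using hom[of h "inv h"] that Hom_F2_one[OF f] by simp
      then have "f (inv h) = f h" by (simp add: bit_add_eq_0_iff)
      then have "f (h \<otimes> g \<otimes> inv h) = (f h + f h) + f g" using hom that by (simp add: add.commute add.left_commute)
      then show ?thesis by (simp add: bit_add_self)
    qed
    then show "f \<in> carrier (Cl0 W)" using f Hom_F2_one[OF f] by (simp add: Cl0_iff Hom_F2_iff)
  qed
qed (simp_all add: Hom_F2_iff Cl0_sel(2-) add.assoc add.left_commute)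

lemma vectorspace_defect: "vectorspace F2 (defect W)"
  unfolding defect_def by (rule vectorspace_quot_module[OF subspace_Hom_F2])

lemma linear_map_defect_class: "linear_map F2 (Cl0 W) (defect W) (defect_class W)"
  unfolding defect_def defect_class_def[abs_def] by (rule linear_map_coset[OF subspace_Hom_F2])

lemma carrier_defect: "carrier (defect W) = defect_class W ` carrier (Cl0 W)"
  by (simp add: defect_def defect_class_def quot_module_carrier[OF subspace_Hom_F2])

lemma defect_class_add:
  "f \<in> carrier (Cl0 W) \<Longrightarrow> g \<in> carrier (Cl0 W) \<Longrightarrow>
   defect_class W f \<oplus>\<^bsub>defect W\<^esub> defect_class W g = defect_class W (f \<oplus>\<^bsub>Cl0 W\<^esub> g)"
  by (simp add: defect_def defect_class_def quot_module_add[OF subspace_Hom_F2])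

lemma defect_class_eq_iff:
  "f \<in> carrier (Cl0 W) \<Longrightarrow> g \<in> carrier (Cl0 W) \<Longrightarrow>
   defect_class W f = defect_class W g \<longleftrightarrow> f \<oplus>\<^bsub>Cl0 W\<^esub> g \<in> Hom_F2 W"
  by (simp add: defect_class_def coset_eq_iff[OF subspace_Hom_F2])

lemma defect_class_self: "f \<in> carrier (Cl0 W) \<Longrightarrow> f \<in> defect_class W f"
  by (simp add: defect_class_def coset_self[OF subspace_Hom_F2])

lemma defect_class_mem:
  "f \<in> carrier (Cl0 W) \<Longrightarrow> g \<in> defect_class W f \<Longrightarrow> g \<in> carrier (Cl0 W) \<and> defect_class W g = defect_class W f"
  unfolding defect_class_def by (rule coset_mem[OF subspace_Hom_F2])

end

section \<open>Pullback along a homomorphism\<close>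

context
  fixes W :: "('w, 'b) monoid_scheme" and U :: "('u, 'c) monoid_scheme" and f
  assumes W: "group W" and U: "group U" and f: "f \<in> hom W U"
begin

interpretation group_hom W U f
  using W U f by (simp add: group_hom_def group_hom_axioms_def)

lemma compose_Cl0: "\<phi> \<in> carrier (Cl0 U) \<Longrightarrow> compose (carrier W) \<phi> f \<in> carrier (Cl0 W)"
  by (auto simp: Cl0_iff compose_def)

lemma compose_Hom_F2: "\<phi> \<in> Hom_F2 U \<Longrightarrow> compose (carrier W) \<phi> f \<in> Hom_F2 W"
  by (auto simp: Hom_F2_iff compose_def)

lemma compose_Cl0_add:
  "compose (carrier W) (\<phi> \<oplus>\<^bsub>Cl0 U\<^esub> \<psi>) f = compose (carrier W) \<phi> f \<oplus>\<^bsub>Cl0 W\<^esub> compose (carrier W) \<psi> f"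
  by (auto simp: Cl0_sel(2-) compose_def)

text \<open>Two members of the coset differ by a homomorphism, and its composite with
  \<open>f\<close> is again one. All terms of the union are hence the same coset, and there is at
  least one term.\<close>

lemma defect_pullback_class:
  assumes "\<phi> \<in> carrier (Cl0 U)"
  shows "defect_pullback W f (defect_class U \<phi>) = defect_class W (compose (carrier W) \<phi> f)"
proof -
  have "defect_class W (compose (carrier W) \<psi> f) = defect_class W (compose (carrier W) \<phi> f)"
    if "\<psi> \<in> defect_class U \<phi>" for \<psi>
  proof -
    have "\<psi> \<in> carrier (Cl0 U)" "\<psi> \<oplus>\<^bsub>Cl0 U\<^esub> \<phi> \<in> Hom_F2 U"
      using defect_class_mem[OF U assms that] by (simp_all add: defect_class_eq_iff[OF U _ assms, symmetric])
    then show ?thesis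
      using assms compose_Cl0 compose_Hom_F2 by (simp add: defect_class_eq_iff[OF W] compose_Cl0_add[symmetric])
  qed
  moreover have "defect_class U \<phi> \<noteq> {}" using defect_class_self[OF U assms] by auto
  ultimately show ?thesis unfolding defect_pullback_def by simp
qed

lemma linear_map_defect_pullback: "linear_map F2 (defect U) (defect W) (defect_pullback W f)"
proof (rule F2_linear_mapI[OF vectorspace_defect[OF U] vectorspace_defect[OF W]])
  show "defect_pullback W f \<in> carrier (defect U) \<rightarrow> carrier (defect W)"
    by (auto simp: carrier_defect[OF U] carrier_defect[OF W] defect_pullback_class compose_Cl0)
  fix v w assume "v \<in> carrier (defect U)" "w \<in> carrier (defect U)"
  then obtain \<phi> \<psi> where *: "\<phi> \<in> carrier (Cl0 U)" "v = defect_class U \<phi>"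
      "\<psi> \<in> carrier (Cl0 U)" "w = defect_class U \<psi>"
    by (auto simp: carrier_defect[OF U])
  then have "\<phi> \<oplus>\<^bsub>Cl0 U\<^esub> \<psi> \<in> carrier (Cl0 U)"
    by (intro abelian_monoid.a_closed abelian_group.axioms(1)
        Module.module.axioms(2)[OF vectorspace.axioms(1)[OF vectorspace_Cl0[OF U]]])
  then show "defect_pullback W f (v \<oplus>\<^bsub>defect U\<^esub> w) =
      defect_pullback W f v \<oplus>\<^bsub>defect W\<^esub> defect_pullback W f w"
    using * by (simp add: defect_class_add[OF U] defect_pullback_class compose_Cl0_add
        defect_class_add[OF W] compose_Cl0)
qed

text \<open>For injectivity, a function on \<open>U\<close> whose pullback is a homomorphism is one
  itself, since every element of \<open>U\<close> is a value of \<open>f\<close>. For surjectivity,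
  a class function on \<open>W\<close> is transported along the inverse of \<open>f\<close>.\<close>

lemma bij_betw_defect_pullback:
  assumes bij: "bij_betw f (carrier W) (carrier U)"
  shows "bij_betw (defect_pullback W f) (carrier (defect U)) (carrier (defect W))"
proof -
  have im: "f ` carrier W = carrier U" and inj: "inj_on f (carrier W)" using bij by (auto simp: bij_betw_def)
  have "inj_on (defect_pullback W f) (carrier (defect U))"
  proof (rule inj_onI)
    fix v w assume "v \<in> carrier (defect U)" "w \<in> carrier (defect U)"
      and eq: "defect_pullback W f v = defect_pullback W f w"
    then obtain \<phi> \<psi> where *: "\<phi> \<in> carrier (Cl0 U)" "v = defect_class U \<phi>"
        "\<psi> \<in> carrier (Cl0 U)" "w = defect_class U \<psi>"
      by (auto simp: carrier_defect[OF U])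
    then have hom: "compose (carrier W) (\<phi> \<oplus>\<^bsub>Cl0 U\<^esub> \<psi>) f \<in> Hom_F2 W"
      using eq by (simp add: defect_pullback_class defect_class_eq_iff[OF W] compose_Cl0 compose_Cl0_add)
    have "\<phi> \<oplus>\<^bsub>Cl0 U\<^esub> \<psi> \<in> Hom_F2 U"
      unfolding Hom_F2_iff
    proof (intro conjI ballI)
      fix a b assume "a \<in> carrier U" "b \<in> carrier U"
      then obtain a' b' where *: "a' \<in> carrier W" "b' \<in> carrier W" "a = f a'" "b = f b'" unfolding im[symmetric] by blast
      then show "(\<phi> \<oplus>\<^bsub>Cl0 U\<^esub> \<psi>) (a \<otimes>\<^bsub>U\<^esub> b) = (\<phi> \<oplus>\<^bsub>Cl0 U\<^esub> \<psi>) a + (\<phi> \<oplus>\<^bsub>Cl0 U\<^esub> \<psi>) b"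
        using hom * by (simp add: Hom_F2_iff compose_eq flip: hom_mult)
    qed (simp add: Cl0_sel)
    then show "v = w" using * by (simp add: defect_class_eq_iff[OF U])
  qed
  moreover have "carrier (defect W) \<subseteq> defect_pullback W f ` carrier (defect U)"
  proof
    fix v assume "v \<in> carrier (defect W)"
    then obtain \<phi> where \<phi>: "\<phi> \<in> carrier (Cl0 W)" "v = defect_class W \<phi>" by (auto simp: carrier_defect[OF W])
    define \<psi> where "\<psi> = (\<lambda>u\<in>carrier U. \<phi> (inv_into (carrier W) f u))"
    have \<psi>: "\<psi> (f w) = \<phi> w" if "w \<in> carrier W" for w
      using that inj by (simp add: \<psi>_def)
    have "\<psi> \<in> carrier (Cl0 U)"
      unfolding Cl0_iff
    proof (intro conjI ballI)
      show "\<psi> \<one>\<^bsub>U\<^esub> = 0" using \<psi>[of "\<one>\<^bsub>W\<^esub>"] \<phi>(1) by (simp add: Cl0_iff)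
      fix a b assume "a \<in> carrier U" "b \<in> carrier U"
      then obtain a' b' where *: "a' \<in> carrier W" "b' \<in> carrier W" "a = f a'" "b = f b'" unfolding im[symmetric] by blast
      then have "b \<otimes>\<^bsub>U\<^esub> a \<otimes>\<^bsub>U\<^esub> inv\<^bsub>U\<^esub> b = f (b' \<otimes>\<^bsub>W\<^esub> a' \<otimes>\<^bsub>W\<^esub> inv\<^bsub>W\<^esub> b')" by simp
      then show "\<psi> (b \<otimes>\<^bsub>U\<^esub> a \<otimes>\<^bsub>U\<^esub> inv\<^bsub>U\<^esub> b) = \<psi> a"
        using * \<phi>(1) by (simp add: \<psi> Cl0_iff del: hom_mult hom_inv)
    qed (simp add: \<psi>_def)
    moreover have "compose (carrier W) \<psi> f = \<phi>"
      using \<psi> \<phi>(1) by (intro extensionalityI[of _ "carrier W"]) (auto simp: Cl0_iff compose_def)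
    ultimately show "v \<in> defect_pullback W f ` carrier (defect U)"
      using \<phi>(2) by (intro image_eqI[of _ _ "defect_class U \<psi>"]) (simp_all add: defect_pullback_class carrier_defect[OF U])
  qed
  moreover have "defect_pullback W f ` carrier (defect U) \<subseteq> carrier (defect W)"
    by (auto simp: carrier_defect[OF U] carrier_defect[OF W] defect_pullback_class compose_Cl0)
  ultimately show ?thesis unfolding bij_betw_def by blast
qed

end

text \<open>Class functions do not notice inner automorphisms. This removes the choice of the
  conjugating element from \<open>component\<close> at a representative.\<close>

lemma defect_pullback_inner:
  assumes W: "group W" and n: "n \<in> carrier W"
    and f: "\<And>w. w \<in> carrier W \<Longrightarrow> f w = n \<otimes>\<^bsub>W\<^esub> w \<otimes>\<^bsub>W\<^esub> inv\<^bsub>W\<^esub> n"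
    and \<omega>: "\<omega> \<in> carrier (defect W)"
  shows "defect_pullback W f \<omega> = \<omega>"
proof -
  interpret group W by (rule W)
  obtain \<phi> where \<phi>: "\<phi> \<in> carrier (Cl0 W)" "\<omega> = defect_class W \<phi>"
    using \<omega> by (auto simp: carrier_defect[OF W])
  have "compose (carrier W) \<psi> f = \<psi>" if "\<psi> \<in> carrier (Cl0 W)" for \<psi>
    using that f n by (intro extensionalityI[of _ "carrier W"]) (auto simp: Cl0_iff compose_def)
  then have "defect_class W (compose (carrier W) \<psi> f) = \<omega>" if "\<psi> \<in> \<omega>" for \<psi>
    using defect_class_mem[OF W \<phi>(1), of \<psi>] that \<phi>(2) by simp
  moreover have "\<omega> \<noteq> {}" using defect_class_self[OF W \<phi>(1)] \<phi>(2) by auto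
  ultimately show ?thesis unfolding defect_pullback_def by auto
qed

section \<open>Images and preimages of subgroups\<close>

context group
begin

lemma inv_mult_cancel:
  assumes "g \<in> carrier G" "x \<in> carrier G"
  shows "inv g \<otimes> (g \<otimes> x) = x" "g \<otimes> (inv g \<otimes> x) = x"
  using assms by (simp_all add: m_assoc[symmetric])

lemma conj_act_mem:
  assumes "X \<subseteq> carrier G" "g \<in> carrier G"
  shows "x \<in> conj_act G g X \<longleftrightarrow> x \<in> carrier G \<and> inv g \<otimes> x \<otimes> g \<in> X"
proof
  assume "x \<in> conj_act G g X"
  then obtain y where y: "y \<in> X" "x = g \<otimes> y \<otimes> inv g" using assms by (auto simp: conj_act_eq)
  then have "y \<in> carrier G" using assms by auto
  then show "x \<in> carrier G \<and> inv g \<otimes> x \<otimes> g \<in> X" using y assms by (simp add: m_assoc inv_mult_cancel)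
next
  assume x: "x \<in> carrier G \<and> inv g \<otimes> x \<otimes> g \<in> X"
  then have "x = g \<otimes> (inv g \<otimes> x \<otimes> g) \<otimes> inv g" using assms by (simp add: m_assoc inv_mult_cancel)
  then show "x \<in> conj_act G g X" using x assms unfolding conj_act_eq[OF assms(1)] by blast
qed

lemma group_hom_conj: "g \<in> carrier G \<Longrightarrow> group_hom G G (\<lambda>x. g \<otimes> x \<otimes> inv g)"
  by (unfold_locales) (auto simp: hom_def m_assoc inv_mult_cancel)

lemma conj_surj: "g \<in> carrier G \<Longrightarrow> (\<lambda>x. g \<otimes> x \<otimes> inv g) ` carrier G = carrier G"
  using conj_act_mem[of "carrier G" g] by (auto simp: conj_act_eq[symmetric])

lemma normalizer_iff:
  "K \<subseteq> carrier G \<Longrightarrow> g \<in> normalizer G K \<longleftrightarrow> g \<in> carrier G \<and> conj_act G g K = K"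
  by (simp add: normalizer_def stabilizer_def conj_act_def)

lemma weyl_sel:
  "carrier (weyl G K) = (\<lambda>g. K #> g) ` normalizer G K"
  "X \<otimes>\<^bsub>weyl G K\<^esub> Y = X <#> Y"
  "\<one>\<^bsub>weyl G K\<^esub> = K"
  by (auto simp: weyl_def FactGroup_def RCOSETS_def r_coset_def set_mult_def)

lemma group_weyl: "subgroup K G \<Longrightarrow> group (weyl G K)"
  unfolding weyl_def by (intro normal.factorgroup_is_group subgroup_in_normalizer)

lemma weyl_subset: "subgroup K G \<Longrightarrow> X \<in> carrier (weyl G K) \<Longrightarrow> X \<subseteq> carrier G"
  using r_coset_subset_G[OF subgroup.subset] normalizer_iff[OF subgroup.subset]
  by (fastforce simp: weyl_sel)

lemma subgroup_conj_act: "subgroup K G \<Longrightarrow> g \<in> carrier G \<Longrightarrow> subgroup (conj_act G g K) G"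
  using gset.act_closed[OF conj_gset] by auto

lemma conj_class_conj_act: "subgroup K G \<Longrightarrow> g \<in> carrier G \<Longrightarrow> conj_class G (conj_act G g K) = conj_class G K"
  unfolding conj_class_def using gset.orbit_eq[OF conj_gset] by auto

lemma conj_class_self: "subgroup K G \<Longrightarrow> K \<in> conj_class G K"
  unfolding conj_class_def using gset.in_own_orbit[OF conj_gset] by auto

lemma conj_class_eqD:
  assumes "subgroup K G" "conj_class G H = conj_class G K"
  shows "\<exists>g\<in>carrier G. K = conj_act G g H"
proof -
  have "K \<in> conj_class G H" using conj_class_self assms by simp
  then show ?thesis unfolding conj_class_def orbit_def by auto
qed

lemma conj_class_in: "subgroup K G \<Longrightarrow> conj_class G K \<in> subgroup_classes G"
  by (auto simp: conj_class_def subgroup_classes_def orbits_def)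

text \<open>Describes the core by conjugates of elements, the form in which homomorphisms act on it.
  The quantifier over \<open>g\<close> absorbs the inverse.\<close>

lemma core_eq:
  assumes H: "subgroup H G"
  shows "core G H = {x \<in> carrier G. \<forall>g\<in>carrier G. g \<otimes> x \<otimes> inv g \<in> H}"
proof -
  have "x \<in> core G H \<longleftrightarrow> x \<in> carrier G \<and> (\<forall>g\<in>carrier G. inv g \<otimes> x \<otimes> g \<in> H)" for x
    unfolding core_def using conj_act_mem[OF subgroup.subset[OF H]] by auto
  moreover have "(\<forall>g\<in>carrier G. inv g \<otimes> x \<otimes> g \<in> H) \<longleftrightarrow> (\<forall>g\<in>carrier G. g \<otimes> x \<otimes> inv g \<in> H)" for x
    by (metis inv_closed inv_inv)
  ultimately show ?thesis by auto
qed

lemma core_subset: "subgroup H G \<Longrightarrow> core G H \<subseteq> H"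
  by (auto simp: core_eq dest!: bspec[of _ _ \<one>])

lemma normal_core:
  assumes H: "subgroup H G"
  shows "core G H \<lhd> G"
proof (rule normal_invI)
  interpret H: subgroup H G by (rule H)
  show "subgroup (core G H) G"
  proof (rule subgroupI)
    show "core G H \<noteq> {}" using H.one_closed by (auto simp: core_eq[OF H] intro!: exI[of _ \<one>])
  next
    fix a assume "a \<in> core G H"
    then have a: "a \<in> carrier G" "\<And>g. g \<in> carrier G \<Longrightarrow> g \<otimes> a \<otimes> inv g \<in> H" by (auto simp: core_eq[OF H])
    have "g \<otimes> inv a \<otimes> inv g \<in> H" if "g \<in> carrier G" for g
      using H.m_inv_closed[OF a(2)[OF that]] a(1) that by (simp add: inv_mult_group m_assoc)
    then show "inv a \<in> core G H" using a by (simp add: core_eq[OF H])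
  next
    fix a b assume "a \<in> core G H" "b \<in> core G H"
    then have a: "a \<in> carrier G" "\<And>g. g \<in> carrier G \<Longrightarrow> g \<otimes> a \<otimes> inv g \<in> H"
      and b: "b \<in> carrier G" "\<And>g. g \<in> carrier G \<Longrightarrow> g \<otimes> b \<otimes> inv g \<in> H" by (auto simp: core_eq[OF H])
    have "g \<otimes> (a \<otimes> b) \<otimes> inv g \<in> H" if g: "g \<in> carrier G" for g
    proof -
      have "g \<otimes> (a \<otimes> b) \<otimes> inv g = (g \<otimes> a \<otimes> inv g) \<otimes> (g \<otimes> b \<otimes> inv g)"
        using a(1) b(1) g by (simp add: m_assoc inv_mult_cancel)
      then show ?thesis using H.m_closed[OF a(2)[OF g] b(2)[OF g]] by simp
    qed
    then show "a \<otimes> b \<in> core G H" using a(1) b(1) by (simp add: core_eq[OF H])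
  qed (auto simp: core_eq[OF H])
next
  fix x h assume x: "x \<in> carrier G" and "h \<in> core G H"
  then have h: "h \<in> carrier G" "\<And>g. g \<in> carrier G \<Longrightarrow> g \<otimes> h \<otimes> inv g \<in> H" by (auto simp: core_eq[OF H])
  have "g \<otimes> (x \<otimes> h \<otimes> inv x) \<otimes> inv g \<in> H" if g: "g \<in> carrier G" for g
    using h(2)[of "g \<otimes> x"] h(1) x g by (simp add: m_assoc inv_mult_group)
  then show "x \<otimes> h \<otimes> inv x \<in> core G H" using x h(1) by (simp add: core_eq[OF H])
qed

text \<open>Cyclicity of the quotient in terms of elements of \<open>H\<close>: some
  \<open>a\<close> generates \<open>H\<close> modulo the core. In this form it can be pushed forward
  and lifted along a homomorphism without comparing quotient groups.\<close>

lemma cyclic_mod_core_iff: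
  assumes H: "subgroup H G"
  shows "cyclic_group ((G\<lparr>carrier := H\<rparr>) Mod core G H) \<longleftrightarrow>
    (\<exists>a\<in>H. \<forall>h\<in>H. \<exists>i::int. h \<otimes> inv (a [^] i) \<in> core G H)"
proof -
  let ?C = "core G H" and ?H = "G\<lparr>carrier := H\<rparr>"
  interpret n: normal ?C ?H
    by (rule normal_restrict_supergroup[OF H normal_core[OF H] core_subset[OF H]])
  have C: "subgroup ?C G" using normal_core[OF H] by (rule normal_imp_subgroup)
  have HG: "H \<subseteq> carrier G" by (rule subgroup.subset[OF H])
  interpret q: group "?H Mod ?C" by (rule n.factorgroup_is_group)
  have car: "carrier (?H Mod ?C) = (\<lambda>h. ?C #> h) ` H"
    by (simp add: carrier_FactGroup r_coset_def)
  have pow: "(?C #> a) [^]\<^bsub>?H Mod ?C\<^esub> i = ?C #> (a [^] i)" if "a \<in> H" for a and i :: int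
    using n.FactGroup_int_pow[of a i] that int_pow_consistent[OF H that, of i] by (simp add: r_coset_def)
  have powH: "a [^] i \<in> H" if "a \<in> H" for a and i :: int
    using that int_pow_consistent[OF H that, of i] group.int_pow_closed[OF subgroup_imp_group[OF H], of a i] by simp
  have eq: "?C #> h = ?C #> b \<longleftrightarrow> h \<otimes> inv b \<in> ?C" if "h \<in> carrier G" "b \<in> carrier G" for h b
    using that C by (metis is_group rcos_self repr_independence subgroup.rcos_module)
  have "cyclic_group (?H Mod ?C) \<longleftrightarrow>
      (\<exists>a\<in>H. (\<lambda>h. ?C #> h) ` H = range (\<lambda>i::int. ?C #> (a [^] i)))"
    unfolding q.cyclic_group car by (simp add: pow cong: bex_cong)
  also have "\<dots> \<longleftrightarrow> (\<exists>a\<in>H. \<forall>h\<in>H. \<exists>i::int. ?C #> h = ?C #> (a [^] i))"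
    using powH by (intro bex_cong refl) (auto simp: set_eq_iff image_iff, metis+)
  also have "\<dots> \<longleftrightarrow> (\<exists>a\<in>H. \<forall>h\<in>H. \<exists>i::int. h \<otimes> inv (a [^] i) \<in> ?C)"
    using HG powH by (intro bex_cong ball_cong ex_cong1 refl) (auto simp: eq subset_iff)
  finally show ?thesis .
qed

end

section \<open>Images under a homomorphism\<close>

context group_hom
begin

lemma img_conj_act:
  "X \<subseteq> carrier G \<Longrightarrow> g \<in> carrier G \<Longrightarrow> h ` conj_act G g X = conj_act H (h g) (h ` X)"
  by (subst (1 2) conj_act_eq) (auto simp: image_image subset_iff intro!: image_cong)

lemma img_normalizer:
  "K \<subseteq> carrier G \<Longrightarrow> g \<in> normalizer G K \<Longrightarrow> h g \<in> normalizer H (h ` K)"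
proof -
  assume K: "K \<subseteq> carrier G" and "g \<in> normalizer G K"
  then have "g \<in> carrier G" "conj_act G g K = K" using G.normalizer_iff by auto
  moreover have "h ` K \<subseteq> carrier H" using K by auto
  ultimately show ?thesis using img_conj_act[OF K, of g] H.normalizer_iff by simp
qed

lemma img_r_coset: "X \<subseteq> carrier G \<Longrightarrow> g \<in> carrier G \<Longrightarrow> h ` (X #> g) = h ` X #>\<^bsub>H\<^esub> h g"
  by (force simp: r_coset_def)

lemma img_l_coset: "X \<subseteq> carrier G \<Longrightarrow> g \<in> carrier G \<Longrightarrow> h ` (g <# X) = h g <#\<^bsub>H\<^esub> h ` X"
  by (force simp: l_coset_def)

lemma img_set_mult: "X \<subseteq> carrier G \<Longrightarrow> Y \<subseteq> carrier G \<Longrightarrow> h ` (X <#> Y) = h ` X <#>\<^bsub>H\<^esub> h ` Y"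
  unfolding set_mult_def by (auto simp: image_iff subset_iff) (metis hom_mult)+

text \<open>\<open>F\<close> is only asked to agree with the image map on subsets of the carrier, so
  that it can be \<open>proj G N\<close> as well as the restricted function
  \<open>conj_act G g\<close>.\<close>

lemma weyl_hom:
  assumes K: "subgroup K G" and F: "\<And>X. X \<subseteq> carrier G \<Longrightarrow> F X = h ` X"
  shows "F \<in> hom (weyl G K) (weyl H (h ` K))"
proof (rule homI)
  note KG = subgroup.subset[OF K]
  fix X assume X: "X \<in> carrier (weyl G K)"
  then obtain g where "g \<in> normalizer G K" "X = K #> g" by (auto simp: G.weyl_sel)
  then show "F X \<in> carrier (weyl H (h ` K))"
    using F[OF G.weyl_subset[OF K X]] img_normalizer[OF KG] G.normalizer_iff[OF KG]
    by (simp add: H.weyl_sel img_r_coset KG)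
next
  fix X Y assume "X \<in> carrier (weyl G K)" "Y \<in> carrier (weyl G K)"
  then have "X \<subseteq> carrier G" "Y \<subseteq> carrier G" using G.weyl_subset[OF K] by auto
  then show "F (X \<otimes>\<^bsub>weyl G K\<^esub> Y) = F X \<otimes>\<^bsub>weyl H (h ` K)\<^esub> F Y"
    by (simp add: G.weyl_sel H.weyl_sel F img_set_mult G.set_mult_closed)
qed

lemma conj_class_img:
  assumes "subgroup K G" "subgroup L G" "conj_class G K = conj_class G L"
  shows "conj_class H (h ` K) = conj_class H (h ` L)"
proof -
  obtain g where g: "g \<in> carrier G" "L = conj_act G g K" using G.conj_class_eqD assms by metis
  then have "h ` L = conj_act H (h g) (h ` K)" using img_conj_act subgroup.subset[OF assms(1)] by simp
  then show ?thesis using g assms(1) H.conj_class_conj_act subgroup_img_is_subgroup by simp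
qed

text \<open>The image of the subgroup generated by \<open>K\<close> and \<open>X\<close> is
  generated by their images. Only subgroups above \<open>K\<close> enter, and the restriction of
  \<open>xy\<close> to these matters for \<open>Fix\<close>: there the values are known to agree
  only at subgroups containing a preimage.\<close>

lemma lam_pullback:
  assumes K: "subgroup K G" and F: "\<And>X. X \<subseteq> carrier G \<Longrightarrow> F X = h ` X"
    and xy: "\<And>L. subgroup L G \<Longrightarrow> K \<subseteq> L \<Longrightarrow> ext0 G x (conj_class G L) = ext0 H y (conj_class H (h ` L))"
  shows "compose (carrier (weyl G K)) (lam H y (h ` K)) F = lam G x K"
proof (rule extensionalityI[of _ "carrier (weyl G K)"])
  fix X assume X: "X \<in> carrier (weyl G K)"
  note KG = subgroup.subset[OF K] and XG = G.weyl_subset[OF K X]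
  have "h ` generate G (K \<union> X) = generate H (h ` K \<union> F X)"
    using generate_img[of "K \<union> X"] KG XG by (simp add: F image_Un)
  moreover have "subgroup (generate G (K \<union> X)) G" using KG XG by (intro G.generate_is_subgroup) auto
  moreover have "K \<subseteq> generate G (K \<union> X)" using generate.incl[of _ "K \<union> X" G] by auto
  moreover have "F X \<in> carrier (weyl H (h ` K))" using weyl_hom[OF K F] X by (auto simp: hom_def)
  ultimately show "compose (carrier (weyl G K)) (lam H y (h ` K)) F X = lam G x K X"
    using X xy[of "generate G (K \<union> X)"] xy[OF K] by (simp add: compose_eq lam_def)
qed (auto simp: lam_def)

end

section \<open>Preimages under a surjective homomorphism\<close>

locale surj_group_hom = group_hom +
  assumes surj: "h ` carrier G = carrier H"
begin

definition pre :: "'c set \<Rightarrow> 'a set" where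
  "pre L = {g \<in> carrier G. h g \<in> L}"

lemma surjE: assumes "y \<in> carrier H" obtains x where "x \<in> carrier G" "y = h x"
  using assms surj by blast

lemma mem_pre: "g \<in> pre L \<longleftrightarrow> g \<in> carrier G \<and> h g \<in> L"
  by (simp add: pre_def)

lemma pre_subset: "pre L \<subseteq> carrier G"
  by (auto simp: pre_def)

lemma img_pre: "L \<subseteq> carrier H \<Longrightarrow> h ` pre L = L"
  using surj by (auto simp: pre_def)

lemma subgroup_pre:
  assumes "subgroup L H" shows "subgroup (pre L) G"
proof -
  interpret L: subgroup L H by fact
  have "\<one> \<in> pre L" by (simp add: mem_pre)
  then have "pre L \<noteq> {}" by blast
  then show ?thesis
    by (intro G.subgroupI) (auto simp: mem_pre)
qed

text \<open>\<open>L\<close> is there to put the kernel of \<open>h\<close> inside \<open>K\<close>: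
  elements with the same image differ by an element of the kernel, which lies in every
  \<open>pre L\<close>.\<close>

lemma pre_img:
  assumes "subgroup K G" "subgroup L H" "pre L \<subseteq> K"
  shows "pre (h ` K) = K"
proof
  show "K \<subseteq> pre (h ` K)" using subgroup.subset[OF assms(1)] by (auto simp: pre_def)
  show "pre (h ` K) \<subseteq> K"
  proof
    fix x assume "x \<in> pre (h ` K)"
    then obtain k where k: "x \<in> carrier G" "k \<in> K" "h x = h k" by (auto simp: pre_def)
    then have kG: "k \<in> carrier G" using subgroup.subset[OF assms(1)] by auto
    then have "x \<otimes> inv k \<in> pre L" using k subgroup.one_closed[OF assms(2)] by (simp add: pre_def)
    then have "x \<otimes> inv k \<otimes> k \<in> K" using subgroup.m_closed[OF assms(1) _ k(2)] assms(3) by auto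
    then show "x \<in> K" using k(1) kG by (simp add: G.m_assoc)
  qed
qed

lemma conj_act_pre:
  "L \<subseteq> carrier H \<Longrightarrow> g \<in> carrier G \<Longrightarrow> conj_act G g (pre L) = pre (conj_act H (h g) L)"
  by (auto simp: set_eq_iff G.conj_act_mem[OF pre_subset] H.conj_act_mem mem_pre)

text \<open>A conjugating element of \<open>H\<close> lifts along \<open>h\<close>. Taking preimages
  thus embeds the classes of subgroups of \<open>H\<close> into those of \<open>G\<close>.\<close>

lemma conj_class_pre_iff:
  assumes "subgroup L H" "subgroup M H"
  shows "conj_class G (pre L) = conj_class G (pre M) \<longleftrightarrow> conj_class H L = conj_class H M"
proof
  assume "conj_class G (pre L) = conj_class G (pre M)"
  then show "conj_class H L = conj_class H M"
    using conj_class_img[OF subgroup_pre subgroup_pre] assms img_pre[OF subgroup.subset] by metis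
next
  assume "conj_class H L = conj_class H M"
  then obtain y where "y \<in> carrier H" "M = conj_act H y L" using H.conj_class_eqD assms by metis
  moreover from this obtain g where "g \<in> carrier G" "y = h g" by (auto elim: surjE)
  ultimately have "pre M = conj_act G g (pre L)" "g \<in> carrier G"
    using conj_act_pre[OF subgroup.subset[OF assms(1)]] by auto
  then show "conj_class G (pre L) = conj_class G (pre M)"
    using G.conj_class_conj_act subgroup_pre assms by metis
qed

text \<open>A coset of \<open>pre L\<close> is the full preimage of its image, so \<open>pre\<close>
  undoes \<open>F\<close>; normalizing elements lift. This is the isomorphism of Weyl groups that
  \<open>Fix_D\<close> inverts on defect spaces.\<close>

lemma weyl_pre_bij:
  assumes L: "subgroup L H" and F: "\<And>X. X \<subseteq> carrier G \<Longrightarrow> F X = h ` X"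
  shows "bij_betw F (carrier (weyl G (pre L))) (carrier (weyl H L))"
proof -
  note pL = subgroup_pre[OF L] and LH = subgroup.subset[OF L]
  have FX: "F X = h ` X" if "X \<in> carrier (weyl G (pre L))" for X using that F G.weyl_subset[OF pL] by auto
  have pre_coset: "pre L #> g = pre (L #>\<^bsub>H\<^esub> h g)" if g: "g \<in> carrier G" for g
  proof -
    have "x \<in> pre L #> g \<longleftrightarrow> h x \<in> L #>\<^bsub>H\<^esub> h g" if x: "x \<in> carrier G" for x
      using subgroup.rcos_module[OF pL G.is_group g x] subgroup.rcos_module[OF L H.is_group, of "h g" "h x"] g x
      by (simp add: pre_def)
    then show ?thesis using G.r_coset_subset_G[OF pre_subset g] by (auto simp: pre_def)
  qed
  have "inj_on F (carrier (weyl G (pre L)))"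
  proof (rule inj_onI)
    fix X Y assume "X \<in> carrier (weyl G (pre L))" "Y \<in> carrier (weyl G (pre L))" and eq: "F X = F Y"
    moreover have "pre (F X) = X" if X: "X \<in> carrier (weyl G (pre L))" for X
    proof -
      obtain g where g: "g \<in> carrier G" "X = pre L #> g"
        using X G.normalizer_iff[OF pre_subset] by (auto simp: G.weyl_sel)
      then have "F X = L #>\<^bsub>H\<^esub> h g" using FX[OF X] by (simp add: img_r_coset[OF pre_subset] img_pre[OF LH])
      then show ?thesis using g pre_coset by simp
    qed
    ultimately show "X = Y" by metis
  qed
  moreover have "F ` carrier (weyl G (pre L)) = carrier (weyl H L)"
  proof
    show "F ` carrier (weyl G (pre L)) \<subseteq> carrier (weyl H L)"
      using weyl_hom[OF pL F] img_pre[OF LH] by (auto simp: hom_def)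
    show "carrier (weyl H L) \<subseteq> F ` carrier (weyl G (pre L))"
    proof
      fix Y assume "Y \<in> carrier (weyl H L)"
      then obtain y where y: "y \<in> carrier H" "conj_act H y L = L" "Y = L #>\<^bsub>H\<^esub> y"
        using H.normalizer_iff[OF LH] by (auto simp: H.weyl_sel)
      then obtain g where g: "g \<in> carrier G" "y = h g" by (auto elim: surjE)
      then have "g \<in> normalizer G (pre L)" using y conj_act_pre[OF LH] G.normalizer_iff[OF pre_subset] by simp
      then have "pre L #> g \<in> carrier (weyl G (pre L))" by (auto simp: G.weyl_sel)
      moreover have "F (pre L #> g) = Y" using FX[OF calculation] g y by (simp add: img_r_coset[OF pre_subset] img_pre[OF LH])
      ultimately show "Y \<in> F ` carrier (weyl G (pre L))" by blast
    qed
  qed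
  ultimately show ?thesis by (simp add: bij_betw_def)
qed

lemma core_pre: "subgroup L H \<Longrightarrow> core G (pre L) = pre (core H L)"
  using surj by (auto simp: set_eq_iff G.core_eq[OF subgroup_pre] H.core_eq mem_pre elim!: surjE)

text \<open>Conjugating elements of \<open>H\<close> lift to \<open>G\<close>. One inclusion is
  enough to carry a generator modulo the core to the image.\<close>

lemma img_core:
  assumes K: "subgroup K G" shows "h ` core G K \<subseteq> core H (h ` K)"
proof -
  have "y \<otimes>\<^bsub>H\<^esub> h x \<otimes>\<^bsub>H\<^esub> inv\<^bsub>H\<^esub> y \<in> h ` K" if x: "x \<in> core G K" and y: "y \<in> carrier H" for x y
  proof -
    obtain g where g: "g \<in> carrier G" "y = h g" using y by (rule surjE)
    then have "x \<in> carrier G" "g \<otimes> x \<otimes> inv g \<in> K" using x G.core_eq[OF K] by auto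
    moreover from this have "y \<otimes>\<^bsub>H\<^esub> h x \<otimes>\<^bsub>H\<^esub> inv\<^bsub>H\<^esub> y = h (g \<otimes> x \<otimes> inv g)" using g by simp
    ultimately show ?thesis by (simp del: hom_mult)
  qed
  then show ?thesis using G.core_eq[OF K] by (auto simp: H.core_eq[OF subgroup_img_is_subgroup[OF K]])
qed

text \<open>By contraposition: if \<open>a\<close> generates \<open>K\<close> modulo its core, then
  \<open>h a\<close> generates the image modulo its core, because the core maps into the
  core.\<close>

lemma img_ncc:
  assumes K: "subgroup K G" and ncc: "h ` K \<in> ncc_subgroups H"
  shows "K \<in> ncc_subgroups G"
proof (rule ccontr)
  note hK = subgroup_img_is_subgroup[OF K] and KG = subgroup.subset[OF K]
  assume "K \<notin> ncc_subgroups G"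
  then obtain a where a: "a \<in> K" "\<And>k. k \<in> K \<Longrightarrow> \<exists>i::int. k \<otimes> inv (a [^] i) \<in> core G K"
    using K by (auto simp: ncc_subgroups_def G.cyclic_mod_core_iff)
  have "\<exists>i::int. h k \<otimes>\<^bsub>H\<^esub> inv\<^bsub>H\<^esub> (h a [^]\<^bsub>H\<^esub> i) \<in> core H (h ` K)" if "k \<in> K" for k
  proof -
    obtain i :: int where i: "k \<otimes> inv (a [^] i) \<in> core G K" using a(2) \<open>k \<in> K\<close> by blast
    then have "h (k \<otimes> inv (a [^] i)) \<in> core H (h ` K)" using img_core[OF K] by auto
    moreover have "k \<in> carrier G" "a \<in> carrier G" using that a(1) KG by auto
    ultimately show ?thesis by (auto simp: hom_int_pow)
  qed
  then have "cyclic_group ((H\<lparr>carrier := h ` K\<rparr>) Mod core H (h ` K))"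
    unfolding H.cyclic_mod_core_iff[OF hK] using a(1) by blast
  then show False using ncc by (simp add: ncc_subgroups_def)
qed

text \<open>The core of a preimage is the preimage of the core, so any lift of a generator of
  \<open>L\<close> modulo its core generates \<open>pre L\<close> modulo its core.\<close>

lemma pre_ncc_iff:
  assumes L: "subgroup L H" shows "pre L \<in> ncc_subgroups G \<longleftrightarrow> L \<in> ncc_subgroups H"
proof
  note pL = subgroup_pre[OF L] and LH = subgroup.subset[OF L]
  show "L \<in> ncc_subgroups H \<Longrightarrow> pre L \<in> ncc_subgroups G" using img_ncc[OF pL] img_pre[OF LH] by simp
  assume ncc: "pre L \<in> ncc_subgroups G"
  show "L \<in> ncc_subgroups H"
  proof (rule ccontr)
    assume "L \<notin> ncc_subgroups H"
    then obtain b where b: "b \<in> L" "\<And>l. l \<in> L \<Longrightarrow> \<exists>i::int. l \<otimes>\<^bsub>H\<^esub> inv\<^bsub>H\<^esub> (b [^]\<^bsub>H\<^esub> i) \<in> core H L"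
      using L by (auto simp: ncc_subgroups_def H.cyclic_mod_core_iff)
    obtain a where a: "a \<in> carrier G" "b = h a" using b(1) LH by (auto elim: surjE)
    have "\<exists>i::int. k \<otimes> inv (a [^] i) \<in> core G (pre L)" if "k \<in> pre L" for k
    proof -
      have k: "k \<in> carrier G" "h k \<in> L" using that by (auto simp: pre_def)
      then obtain i :: int where "h k \<otimes>\<^bsub>H\<^esub> inv\<^bsub>H\<^esub> (b [^]\<^bsub>H\<^esub> i) \<in> core H L" using b(2) by blast
      then have "k \<otimes> inv (a [^] i) \<in> core G (pre L)"
        unfolding core_pre[OF L] using k(1) a by (simp add: pre_def hom_int_pow)
      then show ?thesis ..
    qed
    moreover have "a \<in> pre L" using a b(1) by (simp add: pre_def)
    ultimately have "cyclic_group ((G\<lparr>carrier := pre L\<rparr>) Mod core G (pre L))"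
      unfolding G.cyclic_mod_core_iff[OF pL] by blast
    then show False using ncc by (simp add: ncc_subgroups_def)
  qed
qed

end

section \<open>Conjugation invariance of V and of the local functions\<close>

context group
begin

lemma surj_group_hom_conj: "g \<in> carrier G \<Longrightarrow> surj_group_hom G G (\<lambda>x. g \<otimes> x \<otimes> inv g)"
  by (intro surj_group_hom.intro surj_group_hom_axioms.intro group_hom_conj conj_surj)

text \<open>Inner automorphisms are surjective homomorphisms, so \<open>img_ncc\<close> applies to
  conjugation by \<open>g\<close> and by its inverse.\<close>

lemma ncc_conj_act:
  assumes K: "subgroup K G" and g: "g \<in> carrier G"
  shows "conj_act G g K \<in> ncc_subgroups G \<longleftrightarrow> K \<in> ncc_subgroups G"
proof -
  have *: "conj_act G a L \<in> ncc_subgroups G \<Longrightarrow> L \<in> ncc_subgroups G"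
    if "subgroup L G" "a \<in> carrier G" for a L
    using surj_group_hom.img_ncc[OF surj_group_hom_conj] that by (simp add: conj_act_eq subgroup.subset)
  have "conj_act G (inv g) (conj_act G g K) = K"
    using gset.act_inv[OF conj_gset g, of K] K by simp
  then show ?thesis using *[OF K g] *[OF subgroup_conj_act[OF K g], of "inv g"] g by auto
qed

lemma conj_class_ncc_iff:
  assumes K: "subgroup K G" shows "conj_class G K \<in> ncc_classes G \<longleftrightarrow> K \<in> ncc_subgroups G"
proof
  assume "conj_class G K \<in> ncc_classes G"
  then obtain L where "L \<in> ncc_subgroups G" "conj_class G L = conj_class G K" by (auto simp: ncc_classes_def)
  then show "K \<in> ncc_subgroups G"
    using conj_class_eqD[OF K] ncc_conj_act by (metis (no_types, lifting) mem_Collect_eq ncc_subgroups_def)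
qed (simp add: ncc_classes_def)

lemma ext0_conj_class:
  "subgroup K G \<Longrightarrow> ext0 G x (conj_class G K) = (if K \<in> ncc_subgroups G then x (conj_class G K) else 0)"
  by (simp add: ext0_def conj_class_in conj_class_ncc_iff)

text \<open>Lets identities in \<open>V\<close> be checked at subgroups, away from the
  representatives that occur in the definitions of \<open>Inf_V\<close> and
  \<open>Fix_V\<close>.\<close>

lemma V_space_eqI:
  assumes "x \<in> carrier (V_space G)" "y \<in> carrier (V_space G)"
    and "\<And>K. subgroup K G \<Longrightarrow> ext0 G x (conj_class G K) = ext0 G y (conj_class G K)"
  shows "x = y"
proof (rule extensionalityI[of _ "ncc_classes G"])
  fix C assume "C \<in> ncc_classes G"
  then obtain K where "K \<in> ncc_subgroups G" "C = conj_class G K" by (auto simp: ncc_classes_def)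
  moreover from this have "subgroup K G" by (simp add: ncc_subgroups_def)
  ultimately show "x C = y C" using assms(3)[of K] by (simp add: ext0_conj_class)
qed (use assms in \<open>auto simp: V_space_sel\<close>)

lemma ext0_add:
  "subgroup K G \<Longrightarrow> ext0 G (x \<oplus>\<^bsub>V_space G\<^esub> y) (conj_class G K) =
     ext0 G x (conj_class G K) + ext0 G y (conj_class G K)"
  by (simp add: ext0_conj_class V_space_sel conj_class_ncc_iff)

text \<open>Conjugation by an element of the normalizer is an inner automorphism of the Weyl group,
  the situation of \<open>defect_pullback_inner\<close>.\<close>

lemma weyl_conj_act:
  assumes K: "subgroup K G" and g: "g \<in> normalizer G K" and X: "X \<in> carrier (weyl G K)"
  shows "conj_act G g X = (K #> g) \<otimes>\<^bsub>weyl G K\<^esub> X \<otimes>\<^bsub>weyl G K\<^esub> inv\<^bsub>weyl G K\<^esub> (K #> g)"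
proof -
  note KG = subgroup.subset[OF K]
  let ?N = "G\<lparr>carrier := normalizer G K\<rparr>"
  have N: "subgroup (normalizer G K) G" by (rule normalizer_imp_subgroup[OF KG])
  interpret p: group_hom ?N "weyl G K" "\<lambda>a. K #> a"
  proof (intro group_hom.intro group_hom_axioms.intro subgroup_imp_group[OF N] group_weyl[OF K])
    show "(\<lambda>a. K #> a) \<in> hom ?N (weyl G K)"
      using normal.r_coset_hom_Mod[OF subgroup_in_normalizer[OF K]] by (simp add: weyl_def r_coset_def)
  qed
  obtain x where x: "x \<in> normalizer G K" "X = K #> x" using X by (auto simp: weyl_sel)
  have gx: "g \<in> carrier G" "conj_act G g K = K" "x \<in> carrier G" using g x normalizer_iff[OF KG] by auto
  interpret c: group_hom G G "\<lambda>x. g \<otimes> x \<otimes> inv g" by (rule group_hom_conj[OF gx(1)])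
  have "conj_act G g X = K #> (g \<otimes> x \<otimes> inv g)"
    using c.img_r_coset[OF KG gx(3)] gx r_coset_subset_G[OF KG gx(3)] KG by (simp add: x(2) conj_act_eq)
  also have "\<dots> = (K #> g) \<otimes>\<^bsub>weyl G K\<^esub> (K #> x) \<otimes>\<^bsub>weyl G K\<^esub> (K #> inv g)"
    using p.hom_mult[of "g \<otimes> x" "inv g"] p.hom_mult[of g x] g x(1) subgroup.m_closed[OF N g x(1)]
      subgroup.m_inv_closed[OF N g] by simp
  also have "K #> inv g = inv\<^bsub>weyl G K\<^esub> (K #> g)"
    using p.hom_inv[of g] g m_inv_consistent[OF N g] by simp
  finally show ?thesis by (simp add: x(2))
qed

text \<open>Conjugation by \<open>g\<close> in the normalizer fixes \<open>K\<close> and preserves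
  all values of \<open>ext0\<close>, so by \<open>lam_pullback\<close> the function is its own
  pullback; and this conjugation is the inner automorphism given by the coset of \<open>g\<close>.
  At the identity coset \<open>K\<close> the generated subgroup is \<open>K\<close>, and the two
  values cancel.\<close>

lemma lam_Cl0:
  assumes K: "subgroup K G" shows "lam G x K \<in> carrier (Cl0 (weyl G K))"
  unfolding Cl0_iff
proof (intro conjI ballI)
  interpret W: group "weyl G K" by (rule group_weyl[OF K])
  note KG = subgroup.subset[OF K]
  have "generate G (K \<union> K) = K" using generate_subgroup_incl[OF _ K] generate.incl by (auto simp: subset_iff)
  then show "lam G x K \<one>\<^bsub>weyl G K\<^esub> = 0"
    using W.one_closed by (simp add: lam_def weyl_sel(3) bit_add_self)
  fix X Y assume X: "X \<in> carrier (weyl G K)" and Y: "Y \<in> carrier (weyl G K)"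
  show "lam G x K (Y \<otimes>\<^bsub>weyl G K\<^esub> X \<otimes>\<^bsub>weyl G K\<^esub> inv\<^bsub>weyl G K\<^esub> Y) = lam G x K X"
  proof -
    obtain g where g: "g \<in> normalizer G K" "Y = K #> g" using Y by (auto simp: weyl_sel)
    then have gG: "g \<in> carrier G" "conj_act G g K = K" using normalizer_iff[OF KG] by auto
    interpret c: group_hom G G "\<lambda>x. g \<otimes> x \<otimes> inv g" by (rule group_hom_conj[OF gG(1)])
    have "(\<lambda>x. g \<otimes> x \<otimes> inv g) ` K = K" using gG(2) by (simp add: conj_act_eq[OF KG])
    moreover have "ext0 G x (conj_class G L) = ext0 G x (conj_class G ((\<lambda>x. g \<otimes> x \<otimes> inv g) ` L))"
      if "subgroup L G" for L
      using conj_class_conj_act[OF that gG(1)] by (simp add: conj_act_eq[OF subgroup.subset[OF that]])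
    ultimately have "compose (carrier (weyl G K)) (lam G x K) (conj_act G g) = lam G x K"
      using c.lam_pullback[OF K, of "conj_act G g" x x] by (simp add: conj_act_eq)
    then show ?thesis
      using X Y weyl_conj_act[OF K g(1) X] g(2) by (metis compose_eq)
  qed
qed (simp add: lam_def)

end

section \<open>Marks\<close>

text \<open>A triangular matrix with nonzero diagonal is invertible. It is applied to the table of
  marks, with \<open>s\<close> the order of a representative.\<close>

lemma
  fixes M :: "'i \<Rightarrow> 'i \<Rightarrow> 'k::field" and s :: "'i \<Rightarrow> nat"
  assumes "finite I"
    and diag: "\<And>i. i \<in> I \<Longrightarrow> M i i \<noteq> 0"
    and tri: "\<And>i j. i \<in> I \<Longrightarrow> j \<in> I \<Longrightarrow> M i j \<noteq> 0 \<Longrightarrow> i \<noteq> j \<Longrightarrow> s i < s j"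
  shows triangular_ex: "\<exists>x. \<forall>i\<in>I. (\<Sum>j\<in>I. x j * M i j) = f i"
    and triangular_zero: "(\<And>i. i \<in> I \<Longrightarrow> (\<Sum>j\<in>I. x j * M i j) = 0) \<Longrightarrow> i \<in> I \<Longrightarrow> x i = 0"
proof -
  have "(\<exists>x. \<forall>i\<in>S. (\<Sum>j\<in>S. x j * M i j) = f i) \<and>
      (\<forall>x. (\<forall>i\<in>S. (\<Sum>j\<in>S. x j * M i j) = 0) \<longrightarrow> (\<forall>i\<in>S. x i = 0))"
    if "finite S" "S \<subseteq> I" for S
    using that
  \<comment> \<open>Indices are added in order of decreasing \<open>s\<close>. The column of a new
    index \<open>a\<close> then vanishes in all earlier rows, so the earlier equations stay as they
    are and the new one determines the entry at \<open>a\<close>.\<close>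
  proof (induction S rule: finite_ranking_induct[where f = "\<lambda>i. - int (s i)"])
    case (insert a S)
    show ?case
    proof (cases "a \<in> S")
      case True
      then show ?thesis using insert by (simp add: insert_absorb)
    next
      case False
      have zero: "M i a = 0" if "i \<in> S" for i
        using tri[of i a] insert.hyps(2)[OF that] insert.prems that False by fastforce
      note IH = insert.IH[OF order.trans[OF subset_insertI insert.prems]]
      obtain x where x: "\<forall>i\<in>S. (\<Sum>j\<in>S. x j * M i j) = f i" using conjunct1[OF IH] ..
      define y where "y = x(a := (f a - (\<Sum>j\<in>S. x j * M a j)) / M a a)"
      have "(\<Sum>j\<in>S. y j * M i j) = (\<Sum>j\<in>S. x j * M i j)" for i
        using False by (intro sum.cong refl) (auto simp: y_def)
      then have "\<forall>i\<in>insert a S. (\<Sum>j\<in>insert a S. y j * M i j) = f i"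
        using insert.hyps False insert.prems diag[of a] x zero by (auto simp: y_def)
      moreover have "\<forall>i\<in>insert a S. z i = 0" if "\<forall>i\<in>insert a S. (\<Sum>j\<in>insert a S. z j * M i j) = 0" for z
      proof -
        have "\<forall>i\<in>S. (\<Sum>j\<in>S. z j * M i j) = 0" using that insert.hyps False zero by auto
        then have S: "\<forall>i\<in>S. z i = 0" by (rule conjunct2[OF IH, THEN spec, THEN mp])
        then have "(\<Sum>j\<in>S. z j * M a j) = 0" by simp
        then have "z a * M a a = 0" using that insert.hyps False by simp
        then show ?thesis using S diag[of a] insert.prems by auto
      qed
      ultimately show ?thesis by blast
    qed
  qed simp
  note * = this[OF \<open>finite I\<close> subset_refl]
  show "\<exists>x. \<forall>i\<in>I. (\<Sum>j\<in>I. x j * M i j) = f i" using conjunct1[OF *] .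
  show "x i = 0" if "\<And>i. i \<in> I \<Longrightarrow> (\<Sum>j\<in>I. x j * M i j) = 0" "i \<in> I"
    by (rule bspec[OF conjunct2[OF *, THEN spec, THEN mp]]) (use that in auto)
qed

definition table_of_marks :: "('a, 'b) monoid_scheme \<Rightarrow> 'a set \<Rightarrow> 'a set \<Rightarrow> nat" where
  "table_of_marks G K H = card (fixed_points (lcosets\<^bsub>G\<^esub> H) (\<lambda>g X. g <#\<^bsub>G\<^esub> X) K)"

lemma mark_table_of_marks: "mark G K x = (\<Sum>C\<in>subgroup_classes G. x C * of_nat (table_of_marks G K (rep C)))"
  by (simp add: mark_def table_of_marks_def)

text \<open>Acting by \<open>g\<close> maps the points fixed by \<open>K\<close> bijectively onto
  those fixed by its conjugate.\<close>

lemma (in gset) card_fixed_points_conj_act: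
  assumes K: "subgroup K G" and g: "g \<in> carrier G"
  shows "card (fixed_points E \<phi> (conj_act G g K)) = card (fixed_points E \<phi> K)"
proof -
  have fix_conj: "\<phi> a x \<in> fixed_points E \<phi> (conj_act G a L)"
    if a: "a \<in> carrier G" and L: "subgroup L G" and x: "x \<in> fixed_points E \<phi> L" for a L x
  proof -
    have xE: "x \<in> E" using x by (simp add: fixed_points_def)
    have "\<phi> (a \<otimes> l \<otimes> inv a) (\<phi> a x) = \<phi> a x" if l: "l \<in> L" for l
    proof -
      have "l \<in> carrier G" using l subgroup.subset[OF L] by auto
      then have "\<phi> (a \<otimes> l \<otimes> inv a) (\<phi> a x) = \<phi> (a \<otimes> l \<otimes> inv a \<otimes> a) x" using a xE by (simp add: act_mult)
      also have "a \<otimes> l \<otimes> inv a \<otimes> a = a \<otimes> l" using a \<open>l \<in> carrier G\<close> by (simp add: m_assoc)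
      also have "\<phi> (a \<otimes> l) x = \<phi> a x" using a l \<open>l \<in> carrier G\<close> xE x by (simp add: act_mult fixed_points_def)
      finally show ?thesis .
    qed
    then show ?thesis using xE a by (auto simp: fixed_points_def act_closed conj_act_eq[OF subgroup.subset[OF L]])
  qed
  have conj_inv: "conj_act G (inv g) (conj_act G g K) = K"
    using gset.act_inv[OF conj_gset g, of K] K by simp
  have "bij_betw (\<phi> g) (fixed_points E \<phi> K) (fixed_points E \<phi> (conj_act G g K))"
  proof (rule bij_betw_byWitness[where f' = "\<phi> (inv g)"])
    show "\<forall>x\<in>fixed_points E \<phi> K. \<phi> (inv g) (\<phi> g x) = x" using g by (auto simp: fixed_points_def act_inv)
    show "\<forall>x\<in>fixed_points E \<phi> (conj_act G g K). \<phi> g (\<phi> (inv g) x) = x"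
      using g act_inv[of "inv g"] by (auto simp: fixed_points_def)
    show "\<phi> g ` fixed_points E \<phi> K \<subseteq> fixed_points E \<phi> (conj_act G g K)" using fix_conj[OF g K] by blast
    show "\<phi> (inv g) ` fixed_points E \<phi> (conj_act G g K) \<subseteq> fixed_points E \<phi> K"
      using fix_conj[of "inv g" "conj_act G g K"] g subgroup_conj_act[OF K g] conj_inv by auto
  qed
  then show ?thesis by (metis bij_betw_same_card)
qed

section \<open>The table of marks, idempotents and S2\<close>

locale finite_group = group +
  assumes fin: "finite (carrier G)"
begin

lemma finite_subgroup_classes: "finite (subgroup_classes G)"
proof (rule finite_subset)
  show "subgroup_classes G \<subseteq> Pow (Pow (carrier G))"
    using gset.orbits_cases(1)[OF conj_gset] subgroup.subset
    unfolding subgroup_classes_def by fast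
qed (simp add: fin)

lemma ncc_classes_subset: "ncc_classes G \<subseteq> subgroup_classes G"
  by (auto simp: ncc_classes_def ncc_subgroups_def conj_class_in)

lemma finite_ncc_classes: "finite (ncc_classes G)"
  using ncc_classes_subset finite_subgroup_classes by (rule finite_subset)

text \<open>Evaluates the mark of the basis element \<open>[G/H]\<close> in two ways: as the number
  of fixed points on \<open>G/H\<close>, and by the definition of \<open>mark\<close>, which uses
  the chosen representative.\<close>

lemma table_of_marks_rep:
  assumes "subgroup K G" "subgroup H G" shows "table_of_marks G K (rep (conj_class G H)) = table_of_marks G K H"
proof -
  have "finite (lcosets H)" using fin by (simp add: LCOSETS_def)
  then have "mark G K (\<lambda>C\<in>subgroup_classes G. if C = conj_class G H then 1 else 0) = of_nat (table_of_marks G K H)"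
    using gset.mark_gset_class[OF lcosets_gset[OF assms(2)] fin _ assms(1)] gset_class_lcosets[OF assms(2)]
    by (simp add: table_of_marks_def)
  moreover have "mark G K (\<lambda>C\<in>subgroup_classes G. if C = conj_class G H then 1 else 0) =
      (\<Sum>C\<in>subgroup_classes G. if C = conj_class G H then of_nat (table_of_marks G K (rep C)) else 0)"
    unfolding mark_table_of_marks by (intro sum.cong refl) simp
  ultimately show ?thesis using finite_subgroup_classes conj_class_in[OF assms(2)] by simp
qed

lemma table_of_marks_conj_act: "subgroup K G \<Longrightarrow> subgroup H G \<Longrightarrow> g \<in> carrier G \<Longrightarrow> table_of_marks G (conj_act G g K) H = table_of_marks G K H"
  unfolding table_of_marks_def by (rule gset.card_fixed_points_conj_act[OF lcosets_gset])

lemma mark_conj_act: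
  "subgroup K G \<Longrightarrow> g \<in> carrier G \<Longrightarrow> mark G (conj_act G g K) x = mark G K x"
  unfolding mark_table_of_marks by (intro sum.cong refl) (simp add: table_of_marks_conj_act rep_class)

lemma mark_rep: 
  assumes "subgroup K G" shows "mark G (rep (conj_class G K)) x = mark G K x"
proof -
  have "conj_class G K = conj_class G (rep (conj_class G K))" "subgroup (rep (conj_class G K)) G"
    using rep_class[OF conj_class_in[OF assms]] by auto
  then obtain g where "g \<in> carrier G" "rep (conj_class G K) = conj_act G g K" using conj_class_eqD by metis
  then show ?thesis using mark_conj_act[OF assms] by simp
qed

text \<open>If \<open>K\<close> fixes the coset \<open>aH\<close>, then the inverse of
  \<open>a\<close> conjugates \<open>K\<close> into \<open>H\<close>.\<close>

lemma table_of_marks_nonzeroD: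
  assumes K: "subgroup K G" and H: "subgroup H G" and "table_of_marks G K H \<noteq> 0"
  shows "\<exists>g\<in>carrier G. conj_act G g K \<subseteq> H"
proof -
  have "fixed_points (lcosets H) (\<lambda>g X. g <# X) K \<noteq> {}" using assms(3) by (auto simp: table_of_marks_def)
  then obtain a where a: "a \<in> carrier G" "\<And>k. k \<in> K \<Longrightarrow> k <# (a <# H) = a <# H"
    by (auto simp: fixed_points_def LCOSETS_def)
  have "inv a \<otimes> k \<otimes> a \<in> H" if k: "k \<in> K" for k
  proof -
    have kG: "k \<in> carrier G" using k subgroup.subset[OF K] by auto
    have "k \<otimes> a \<in> a <# H"
      using lcos_self[OF _ H, of "k \<otimes> a"] a kG k by (simp add: lcos_m_assoc[OF subgroup.subset[OF H], symmetric])
    then have "inv a \<otimes> (k \<otimes> a) \<in> H" using subgroup.lcos_module_imp[OF H is_group] a(1) by simp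
    then show ?thesis using a(1) kG by (simp add: m_assoc)
  qed
  then have "conj_act G (inv a) K \<subseteq> H" using a(1) by (auto simp: conj_act_eq[OF subgroup.subset[OF K]])
  then show ?thesis using a(1) by blast
qed

lemma table_of_marks_self:
  assumes H: "subgroup H G" shows "table_of_marks G H H \<noteq> 0"
proof -
  have "H = \<one> <# H" using subgroup.subset[OF H] by (simp add: lcos_mult_one)
  then have "H \<in> lcosets H" unfolding LCOSETS_def by blast
  moreover have "h <# H = H" if "h \<in> H" for h
    using that H l_repr_independence[OF _ one_closed H, of h] subgroup.subset[OF H] by (simp add: lcos_mult_one)
  ultimately have "H \<in> fixed_points (lcosets H) (\<lambda>g X. g <# X) H" by (simp add: fixed_points_def)
  moreover have "finite (fixed_points (lcosets H) (\<lambda>g X. g <# X) H)"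
    using fin by (simp add: fixed_points_def LCOSETS_def)
  ultimately show ?thesis by (auto simp: table_of_marks_def)
qed

lemma card_conj_act:
  assumes "X \<subseteq> carrier G" "g \<in> carrier G" shows "card (conj_act G g X) = card X"
proof -
  have "inj_on (\<lambda>x. g \<otimes> x \<otimes> inv g) X" using assms by (auto intro!: inj_onI simp: subset_iff)
  then show ?thesis using assms by (simp add: conj_act_eq card_image)
qed

text \<open>A nonzero entry means that \<open>rep C\<close> is conjugate to a subgroup of
  \<open>rep D\<close>. If it is not smaller than \<open>rep D\<close>, that subgroup is all of
  \<open>rep D\<close> and the classes coincide.\<close>

lemma table_of_marks_triangular:
  assumes C: "C \<in> subgroup_classes G" and D: "D \<in> subgroup_classes G"
    and "table_of_marks G (rep C) (rep D) \<noteq> 0" "C \<noteq> D"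
  shows "card (rep C) < card (rep D)"
proof (rule ccontr)
  note C' = rep_class[OF C] and D' = rep_class[OF D]
  assume "\<not> card (rep C) < card (rep D)"
  moreover obtain g where g: "g \<in> carrier G" "conj_act G g (rep C) \<subseteq> rep D"
    using table_of_marks_nonzeroD[OF C'(2) D'(2) assms(3)] by blast
  moreover have "finite (rep D)" using subgroup.subset[OF D'(2)] fin finite_subset by blast
  ultimately have "conj_act G g (rep C) = rep D"
    using card_conj_act[OF subgroup.subset[OF C'(2)], of g] by (intro card_seteq) auto
  then have "C = D" using conj_class_conj_act[OF C'(2) g(1)] C'(3) D'(3) by simp
  with \<open>C \<noteq> D\<close> show False ..
qed

lemma rat_burnside_sel:
  "carrier (rat_burnside G) = extensional (subgroup_classes G)"
  "\<zero>\<^bsub>rat_burnside G\<^esub> = (\<lambda>C\<in>subgroup_classes G. 0)"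
  "x \<oplus>\<^bsub>rat_burnside G\<^esub> y = (\<lambda>C\<in>subgroup_classes G. x C + y C)"
  by (simp_all add: rat_burnside_def PiE_def)

text \<open>Triangularity of the table of marks, applied to the difference of the
  coefficients.\<close>

lemma mark_inj:
  assumes x: "x \<in> carrier (rat_burnside G)" and y: "y \<in> carrier (rat_burnside G)"
    and eq: "\<And>K. subgroup K G \<Longrightarrow> mark G K x = mark G K y"
  shows "x = y"
proof (rule extensionalityI[of _ "subgroup_classes G"])
  fix C assume C: "C \<in> subgroup_classes G"
  have "(\<lambda>C. x C - y C) C = 0"
  proof (rule triangular_zero[where M = "\<lambda>C D. of_nat (table_of_marks G (rep C) (rep D))" and s = "\<lambda>C. card (rep C)",
        OF finite_subgroup_classes _ _ _ C])
    fix C assume "C \<in> subgroup_classes G"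
    then show "(\<Sum>D\<in>subgroup_classes G. (x D - y D) * of_nat (table_of_marks G (rep C) (rep D))) = (0::rat)"
      using eq[OF rep_class(2)] unfolding mark_table_of_marks by (simp add: left_diff_distrib sum_subtractf)
  qed (auto simp: table_of_marks_self rep_class intro: table_of_marks_triangular)
  then show "x C = y C" by simp
qed (use x y in \<open>auto simp: rat_burnside_sel\<close>)

lemma mark_surj:
  "\<exists>x\<in>carrier (rat_burnside G). \<forall>K. subgroup K G \<longrightarrow> mark G K x = f (conj_class G K)"
proof -
  have "\<exists>x. \<forall>C\<in>subgroup_classes G. (\<Sum>D\<in>subgroup_classes G. x D * of_nat (table_of_marks G (rep C) (rep D))) = f C"
    by (rule triangular_ex[where s = "\<lambda>C. card (rep C)", OF finite_subgroup_classes])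
      (auto simp: table_of_marks_self rep_class intro: table_of_marks_triangular)
  then obtain x where x: "\<And>C. C \<in> subgroup_classes G \<Longrightarrow>
      (\<Sum>D\<in>subgroup_classes G. x D * of_nat (table_of_marks G (rep C) (rep D))) = f C" by blast
  have "mark G K (restrict x (subgroup_classes G)) = f (conj_class G K)" if K: "subgroup K G" for K
    using x[OF conj_class_in[OF K]] mark_rep[OF K, of "restrict x (subgroup_classes G)"] by (simp add: mark_table_of_marks)
  then show ?thesis by (intro bexI[of _ "restrict x (subgroup_classes G)"]) (auto simp: rat_burnside_sel)
qed

text \<open>The definite description is meaningful: \<open>mark_surj\<close> gives existence and
  \<open>mark_inj\<close> uniqueness.\<close>

lemma
  shows prim_idem_closed: "prim_idem G C \<in> carrier (rat_burnside G)"
    and mark_prim_idem: "subgroup K G \<Longrightarrow> mark G K (prim_idem G C) = (if conj_class G K = C then 1 else 0)"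
proof -
  let ?P = "\<lambda>e. e \<in> carrier (rat_burnside G) \<and>
     (\<forall>K. subgroup K G \<longrightarrow> mark G K e = (if conj_class G K = C then 1 else 0))"
  obtain e where "?P e" using mark_surj[of "\<lambda>D. if D = C then 1 else 0"] by blast
  moreover have "d = e" if "?P d" "?P e" for d e using that by (intro mark_inj) auto
  ultimately have "?P (prim_idem G C)" unfolding prim_idem_def by (intro theI[of ?P]) auto
  then show "prim_idem G C \<in> carrier (rat_burnside G)"
    "subgroup K G \<Longrightarrow> mark G K (prim_idem G C) = (if conj_class G K = C then 1 else 0)" by auto
qed

lemma abelian_monoid_rat_burnside: "abelian_monoid (rat_burnside G)"
  by (rule abelian_monoidI; unfold rat_burnside_sel)
    (simp_all add: add.assoc add.commute add.left_commute extensional_restrict cong: restrict_cong)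

lemma mark_add: "mark G K (x \<oplus>\<^bsub>rat_burnside G\<^esub> y) = mark G K x + mark G K y"
  by (simp add: mark_table_of_marks rat_burnside_sel distrib_right sum.distrib)

lemma
  assumes "finite S"
  shows idem_sum_closed: "idem_sum G S \<in> carrier (rat_burnside G)"
    and mark_idem_sum: "subgroup K G \<Longrightarrow> mark G K (idem_sum G S) = (if conj_class G K \<in> S then 1 else 0)"
proof -
  interpret abelian_monoid "rat_burnside G" by (rule abelian_monoid_rat_burnside)
  show closed: "idem_sum G S \<in> carrier (rat_burnside G)"
    unfolding idem_sum_def by (rule finsum_closed) (simp add: prim_idem_closed)
  assume K: "subgroup K G"
  from assms show "mark G K (idem_sum G S) = (if conj_class G K \<in> S then 1 else 0)"
    unfolding idem_sum_def
  proof induction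
    case empty
    then show ?case by (simp add: mark_table_of_marks rat_burnside_sel)
  next
    case (insert C S)
    then show ?case by (simp add: prim_idem_closed mark_add mark_prim_idem[OF K])
  qed
qed

lemma burnside_carrier: "carrier (burnside G) = subgroup_classes G \<rightarrow>\<^sub>E \<int>"
  by (simp add: burnside_def)

text \<open>Since marks determine elements, an integral element with these marks can only be twice
  the idempotent sum. From here on membership in \<open>S2\<close> is a matter of marks
  alone.\<close>

lemma S2_sets_iff:
  "S \<in> S2_sets G \<longleftrightarrow> S \<subseteq> ncc_classes G \<and>
    (\<exists>z\<in>carrier (burnside G). \<forall>K. subgroup K G \<longrightarrow> mark G K z = (if conj_class G K \<in> S then 2 else 0))"
proof (cases "S \<subseteq> ncc_classes G")
  case True
  then have S: "finite S" using finite_ncc_classes finite_subset by blast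
  interpret abelian_monoid "rat_burnside G" by (rule abelian_monoid_rat_burnside)
  let ?e = "idem_sum G S"
  have e: "?e \<in> carrier (rat_burnside G)" by (rule idem_sum_closed[OF S])
  have two: "[(2::nat)] \<cdot>\<^bsub>rat_burnside G\<^esub> ?e = ?e \<oplus>\<^bsub>rat_burnside G\<^esub> ?e"
    using e by (simp add: numeral_2_eq_2 add_pow_def nat_pow_def)
  have mark: "mark G K ([(2::nat)] \<cdot>\<^bsub>rat_burnside G\<^esub> ?e) = (if conj_class G K \<in> S then 2 else 0)"
    if "subgroup K G" for K
    unfolding two mark_add using mark_idem_sum[OF S that] by simp
  have "z = [(2::nat)] \<cdot>\<^bsub>rat_burnside G\<^esub> ?e"
    if "z \<in> carrier (burnside G)" "\<forall>K. subgroup K G \<longrightarrow> mark G K z = (if conj_class G K \<in> S then 2 else 0)" for z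
    using that mark two e by (intro mark_inj) (auto simp: burnside_carrier rat_burnside_sel PiE_def)
  then show ?thesis unfolding S2_sets_def using True mark by blast
qed (simp add: S2_sets_def)

lemma S2_iff:
  "x \<in> S2 G \<longleftrightarrow> x \<in> carrier (V_space G) \<and> (\<exists>z\<in>carrier (burnside G). \<forall>K. subgroup K G \<longrightarrow>
     mark G K z = (if ext0 G x (conj_class G K) = 1 then 2 else 0))" (is "_ \<longleftrightarrow> ?R")
proof
  assume "x \<in> S2 G"
  then obtain S where S: "S \<in> S2_sets G" "x = (\<lambda>C\<in>ncc_classes G. if C \<in> S then 1 else 0)"
    by (auto simp: S2_def)
  have "ext0 G x (conj_class G K) = 1 \<longleftrightarrow> conj_class G K \<in> S" if "subgroup K G" for K
    using that S conj_class_ncc_iff[OF that] by (auto simp: ext0_conj_class S2_sets_iff)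
  then show ?R using S unfolding S2_sets_iff by (auto simp: V_space_sel)
next
  assume R: ?R
  let ?S = "{C \<in> ncc_classes G. x C = 1}"
  have "ext0 G x (conj_class G K) = 1 \<longleftrightarrow> conj_class G K \<in> ?S" if "subgroup K G" for K
    using that conj_class_ncc_iff[OF that] by (auto simp: ext0_conj_class)
  then have "?S \<in> S2_sets G" using R unfolding S2_sets_iff by auto
  moreover have "x = (\<lambda>C\<in>ncc_classes G. if C \<in> ?S then 1 else 0)"
    using R by (intro extensionalityI[of _ "ncc_classes G"]) (auto simp: V_space_sel)
  ultimately show "x \<in> S2 G" unfolding S2_def by blast
qed

text \<open>The structure constants count orbits in products of coset spaces, hence are
  integers.\<close>

lemma burnside_mult_closed:
  "x \<in> carrier (burnside G) \<Longrightarrow> y \<in> carrier (burnside G) \<Longrightarrow> x \<otimes>\<^bsub>rat_burnside G\<^esub> y \<in> carrier (burnside G)"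
  by (auto simp: burnside_carrier rat_burnside_def gset_class_def PiE_iff intro!: Ints_sum Ints_mult)

lemma subspace_S2: "subspace F2 (S2 G) (V_space G)"
proof (rule F2_subspaceI[OF vectorspace_V_space])
  show "S2 G \<subseteq> carrier (V_space G)" using S2_iff by auto
  have "ext0 G (\<lambda>C\<in>ncc_classes G. 0) (conj_class G K) = 0" if "subgroup K G" for K
    using that by (simp add: ext0_conj_class conj_class_ncc_iff)
  then show "\<zero>\<^bsub>V_space G\<^esub> \<in> S2 G"
    unfolding S2_iff by (auto simp: V_space_sel mark_table_of_marks burnside_carrier
        intro!: bexI[of _ "\<lambda>C\<in>subgroup_classes G. 0"])
  fix x y assume x: "x \<in> S2 G" and y: "y \<in> S2 G"
  from x obtain v where v: "v \<in> carrier (burnside G)"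
    "\<And>K. subgroup K G \<Longrightarrow> mark G K v = (if ext0 G x (conj_class G K) = 1 then 2 else 0)" by (auto simp: S2_iff)
  from y obtain w where w: "w \<in> carrier (burnside G)"
    "\<And>K. subgroup K G \<Longrightarrow> mark G K w = (if ext0 G y (conj_class G K) = 1 then 2 else 0)" by (auto simp: S2_iff)
  define u where "u = v \<otimes>\<^bsub>rat_burnside G\<^esub> w"
  have u: "u \<in> carrier (burnside G)" unfolding u_def by (rule burnside_mult_closed[OF v(1) w(1)])
  let ?z = "\<lambda>C\<in>subgroup_classes G. v C + w C - u C"
  have "mark G K ?z = mark G K v + mark G K w - mark G K u" for K
    by (simp add: mark_table_of_marks left_diff_distrib distrib_right sum_subtractf sum.distrib)
  then have "mark G K ?z = (if ext0 G (x \<oplus>\<^bsub>V_space G\<^esub> y) (conj_class G K) = 1 then 2 else 0)" if K: "subgroup K G" for K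
    unfolding ext0_add[OF K] using mark_mult[OF fin K, of v w] v(2)[OF K] w(2)[OF K]
    by (cases "ext0 G x (conj_class G K)"; cases "ext0 G y (conj_class G K)") (simp_all add: u_def)
  moreover have "?z \<in> carrier (burnside G)" using u v(1) w(1) by (auto simp: burnside_carrier PiE_iff)
  moreover have "x \<oplus>\<^bsub>V_space G\<^esub> y \<in> carrier (V_space G)" by (simp add: V_space_sel)
  ultimately show "x \<oplus>\<^bsub>V_space G\<^esub> y \<in> S2 G" unfolding S2_iff by blast
qed

end

section \<open>Inflation and fixed points in the Burnside ring\<close>

context surj_group_hom
begin

text \<open>The image map identifies the cosets of \<open>pre L\<close> in \<open>G\<close> with the
  cosets of \<open>L\<close> in \<open>H\<close>, and under it \<open>K\<close> acts through
  \<open>h\<close>. Its inverse is \<open>pre\<close>.\<close>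

lemma table_of_marks_pre:
  assumes K: "subgroup K G" and L: "subgroup L H"
  shows "table_of_marks G K (pre L) = table_of_marks H (h ` K) L"
proof -
  note pL = subgroup_pre[OF L] and LH = subgroup.subset[OF L] and KG = subgroup.subset[OF K]
  have pre_coset: "pre (h g <#\<^bsub>H\<^esub> L) = g <# pre L" if g: "g \<in> carrier G" for g
  proof -
    have "x \<in> g <# pre L \<longleftrightarrow> h x \<in> h g <#\<^bsub>H\<^esub> L" if x: "x \<in> carrier G" for x
    proof -
      have "x \<in> g <# pre L \<longleftrightarrow> inv g \<otimes> x \<in> pre L"
        using subgroup.lcos_module_imp[OF pL G.is_group g] subgroup.lcos_module_rev[OF pL G.is_group g x] by blast
      also have "\<dots> \<longleftrightarrow> inv\<^bsub>H\<^esub> (h g) \<otimes>\<^bsub>H\<^esub> h x \<in> L" using g x by (simp add: mem_pre)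
      also have "\<dots> \<longleftrightarrow> h x \<in> h g <#\<^bsub>H\<^esub> L"
        using subgroup.lcos_module_imp[OF L H.is_group hom_closed[OF g]]
          subgroup.lcos_module_rev[OF L H.is_group hom_closed[OF g] hom_closed[OF x]] by blast
      finally show ?thesis .
    qed
    then show ?thesis using G.l_coset_subset_G[OF pre_subset[of L] g] by (auto simp: mem_pre)
  qed
  have img_coset: "h ` (g <# pre L) = h g <#\<^bsub>H\<^esub> L" if "g \<in> carrier G" for g
    using that by (simp add: img_l_coset[OF pre_subset] img_pre[OF LH])
  have pre_img: "pre (h ` X) = X" if "X \<in> lcosets (pre L)" for X
    using that by (auto simp: LCOSETS_def img_coset pre_coset)
  have sub: "X \<subseteq> carrier G" if "X \<in> lcosets (pre L)" for X
    using that G.l_coset_subset_G[OF pre_subset[of L]] by (auto simp: LCOSETS_def)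
  have mult: "k <# X \<in> lcosets (pre L)" if "k \<in> carrier G" "X \<in> lcosets (pre L)" for k X
    using gset.act_closed[OF G.lcosets_gset[OF pL]] that by simp
  let ?F = "fixed_points (lcosets (pre L)) (\<lambda>g X. g <# X) K"
  let ?F' = "fixed_points (lcosets\<^bsub>H\<^esub> L) (\<lambda>g X. g <#\<^bsub>H\<^esub> X) (h ` K)"
  have "inj_on ((`) h) ?F" by (rule inj_on_inverseI[of _ pre]) (simp add: fixed_points_def pre_img)
  moreover have "(`) h ` ?F = ?F'"
  proof
    show "(`) h ` ?F \<subseteq> ?F'"
    proof
      fix Y assume "Y \<in> (`) h ` ?F"
      then obtain X where X: "X \<in> lcosets (pre L)" "\<And>k. k \<in> K \<Longrightarrow> k <# X = X" "Y = h ` X"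
        by (auto simp: fixed_points_def)
      then have "h k <#\<^bsub>H\<^esub> Y = Y" if "k \<in> K" for k
        using img_l_coset[OF sub[OF X(1)], of k] that KG by (auto simp: subset_iff)
      moreover have "Y \<in> lcosets\<^bsub>H\<^esub> L"
      proof -
        obtain g where "g \<in> carrier G" "X = g <# pre L" using X(1) by (auto simp: LCOSETS_def)
        then have "h g \<in> carrier H" "Y = h g <#\<^bsub>H\<^esub> L" using X(3) by (auto simp: img_coset)
        then show ?thesis unfolding LCOSETS_def by blast
      qed
      ultimately show "Y \<in> ?F'" by (auto simp: fixed_points_def)
    qed
    show "?F' \<subseteq> (`) h ` ?F"
    proof
      fix Y assume Y: "Y \<in> ?F'"
      then obtain y where "y \<in> carrier H" "Y = y <#\<^bsub>H\<^esub> L" by (auto simp: fixed_points_def LCOSETS_def)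
      then obtain g where g: "g \<in> carrier G" "Y = h ` (g <# pre L)" by (auto elim!: surjE simp: img_coset)
      have X: "g <# pre L \<in> lcosets (pre L)" using g(1) by (auto simp: LCOSETS_def)
      have "k <# (g <# pre L) = g <# pre L" if k: "k \<in> K" for k
      proof -
        have kG: "k \<in> carrier G" using k KG by auto
        have "h ` (k <# (g <# pre L)) = h ` (g <# pre L)"
          using Y k img_l_coset[OF sub[OF X] kG] g(2) by (simp add: fixed_points_def)
        then show ?thesis using pre_img[OF X] pre_img[OF mult[OF kG X]] by simp
      qed
      then show "Y \<in> (`) h ` ?F" using X g(2) by (auto simp: fixed_points_def)
    qed
  qed
  ultimately show ?thesis unfolding table_of_marks_def by (metis card_image)
qed

context
  assumes finG: "finite (carrier G)"
begin

interpretation fG: finite_group G by unfold_locales (rule finG)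
interpretation fH: finite_group H by unfold_locales (use finG surj in \<open>metis finite_imageI\<close>)

text \<open>Linear extension of \<open>[H/L]\<close> to \<open>[G/pre L]\<close>. Distinct classes
  have distinct preimage classes, so the sum has at most one term; as a sum it can be regrouped when
  marks are computed.\<close>

definition infl :: "('c set set \<Rightarrow> rat) \<Rightarrow> 'a set set \<Rightarrow> rat" where
  "infl z = (\<lambda>C\<in>subgroup_classes G. \<Sum>D | D \<in> subgroup_classes H \<and> conj_class G (pre (rep D)) = C. z D)"

text \<open>Fixed points of the kernel of \<open>h\<close>, on coefficients: the kernel fixes all of
  \<open>G/U\<close> if it lies in \<open>U\<close>, that is, if \<open>U\<close> is a preimage, and
  no point otherwise.\<close>

definition fixp :: "('a set set \<Rightarrow> rat) \<Rightarrow> 'c set set \<Rightarrow> rat" where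
  "fixp z = (\<lambda>D\<in>subgroup_classes H. z (conj_class G (pre (rep D))))"

lemma infl_burnside: "z \<in> carrier (burnside H) \<Longrightarrow> infl z \<in> carrier (burnside G)"
  by (auto simp: infl_def fG.burnside_carrier fH.burnside_carrier PiE_iff intro!: Ints_sum)

lemma fixp_burnside: "z \<in> carrier (burnside G) \<Longrightarrow> fixp z \<in> carrier (burnside H)"
  by (auto simp: fixp_def fG.burnside_carrier fH.burnside_carrier PiE_iff
      intro!: G.conj_class_in subgroup_pre H.rep_class)

lemma class_pre_in: "D \<in> subgroup_classes H \<Longrightarrow> conj_class G (pre (rep D)) \<in> subgroup_classes G"
  by (intro G.conj_class_in subgroup_pre H.rep_class)

lemma table_of_marks_class_pre:
  "subgroup K G \<Longrightarrow> D \<in> subgroup_classes H \<Longrightarrow>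
   table_of_marks G K (rep (conj_class G (pre (rep D)))) = table_of_marks H (h ` K) (rep D)"
  by (simp add: fG.table_of_marks_rep table_of_marks_pre subgroup_pre H.rep_class)

lemma mark_infl:
  assumes K: "subgroup K G" shows "mark G K (infl z) = mark H (h ` K) z"
proof -
  let ?c = "\<lambda>D. conj_class G (pre (rep D))"
  have "mark G K (infl z) = (\<Sum>C\<in>subgroup_classes G. \<Sum>D | D \<in> subgroup_classes H \<and> ?c D = C.
      z D * of_nat (table_of_marks G K (rep (?c D))))"
    by (simp add: mark_table_of_marks infl_def sum_distrib_right)
  also have "\<dots> = (\<Sum>D\<in>subgroup_classes H. z D * of_nat (table_of_marks G K (rep (?c D))))"
    using fH.finite_subgroup_classes fG.finite_subgroup_classes class_pre_in by (intro sum.group) auto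
  also have "\<dots> = mark H (h ` K) z"
    unfolding mark_table_of_marks by (intro sum.cong refl) (simp add: table_of_marks_class_pre K)
  finally show ?thesis .
qed

text \<open>A subgroup containing a conjugate of \<open>pre L\<close> contains the kernel and is a
  preimage. The coefficients that \<open>fixp\<close> drops are thus multiplied by zero entries of
  the table of marks.\<close>

lemma mark_fixp:
  assumes L: "subgroup L H" shows "mark H L (fixp z) = mark G (pre L) z"
proof -
  let ?c = "\<lambda>D. conj_class G (pre (rep D))"
  note pL = subgroup_pre[OF L] and LH = subgroup.subset[OF L]
  have inj: "inj_on ?c (subgroup_classes H)"
  proof (rule inj_onI)
    fix D E assume "D \<in> subgroup_classes H" "E \<in> subgroup_classes H" "?c D = ?c E"
    then show "D = E" using conj_class_pre_iff H.rep_class(2,3) by metis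
  qed
  have zero: "table_of_marks G (pre L) (rep C) = 0" if C: "C \<in> subgroup_classes G" "C \<notin> ?c ` subgroup_classes H" for C
  proof (rule ccontr)
    note C' = G.rep_class[OF C(1)]
    assume "table_of_marks G (pre L) (rep C) \<noteq> 0"
    then obtain g where g: "g \<in> carrier G" "conj_act G g (pre L) \<subseteq> rep C"
      using fG.table_of_marks_nonzeroD[OF pL C'(2)] by blast
    let ?M = "h ` rep C"
    have M: "subgroup ?M H" using C'(2) by (rule subgroup_img_is_subgroup)
    have "pre ?M = rep C"
      using pre_img[OF C'(2) H.subgroup_conj_act[OF L hom_closed[OF g(1)]]] g(2) conj_act_pre[OF LH g(1)] by simp
    moreover have "?c (conj_class H ?M) = conj_class G (pre ?M)"
      using H.rep_class[OF H.conj_class_in[OF M]] M conj_class_pre_iff by simp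
    ultimately have "C = ?c (conj_class H ?M)" using C'(3) by simp
    then show False using C(2) H.conj_class_in[OF M] by blast
  qed
  have "mark H L (fixp z) = (\<Sum>D\<in>subgroup_classes H. z (?c D) * of_nat (table_of_marks G (pre L) (rep (?c D))))"
    unfolding mark_table_of_marks by (intro sum.cong refl) (simp add: table_of_marks_class_pre[OF pL] img_pre[OF LH] fixp_def)
  also have "\<dots> = (\<Sum>C\<in>?c ` subgroup_classes H. z C * of_nat (table_of_marks G (pre L) (rep C)))"
    using sum.reindex[OF inj, of "\<lambda>C. z C * of_nat (table_of_marks G (pre L) (rep C))"] by simp
  also have "\<dots> = mark G (pre L) z"
    unfolding mark_table_of_marks using fG.finite_subgroup_classes class_pre_in zero
    by (intro sum.mono_neutral_left) auto
  finally show ?thesis .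
qed

lemma S2_infl:
  assumes x: "x \<in> S2 H" and y: "y \<in> carrier (V_space G)"
    and xy: "\<And>K. subgroup K G \<Longrightarrow> ext0 G y (conj_class G K) = ext0 H x (conj_class H (h ` K))"
  shows "y \<in> S2 G"
proof -
  from x obtain z where "z \<in> carrier (burnside H)"
    "\<And>L. subgroup L H \<Longrightarrow> mark H L z = (if ext0 H x (conj_class H L) = 1 then 2 else 0)" by (auto simp: fH.S2_iff)
  then have "infl z \<in> carrier (burnside G)"
    "\<And>K. subgroup K G \<Longrightarrow> mark G K (infl z) = (if ext0 G y (conj_class G K) = 1 then 2 else 0)"
    by (simp_all add: infl_burnside mark_infl xy subgroup_img_is_subgroup)
  then show ?thesis using y unfolding fG.S2_iff by blast
qed

lemma S2_fixp:
  assumes y: "y \<in> S2 G" and x: "x \<in> carrier (V_space H)"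
    and xy: "\<And>L. subgroup L H \<Longrightarrow> ext0 H x (conj_class H L) = ext0 G y (conj_class G (pre L))"
  shows "x \<in> S2 H"
proof -
  from y obtain z where "z \<in> carrier (burnside G)"
    "\<And>K. subgroup K G \<Longrightarrow> mark G K z = (if ext0 G y (conj_class G K) = 1 then 2 else 0)" by (auto simp: fG.S2_iff)
  then have "fixp z \<in> carrier (burnside H)"
    "\<And>L. subgroup L H \<Longrightarrow> mark H L (fixp z) = (if ext0 H x (conj_class H L) = 1 then 2 else 0)"
    by (simp_all add: fixp_burnside mark_fixp xy subgroup_pre)
  then show ?thesis using x unfolding fH.S2_iff by blast
qed

end

end

section \<open>Inflation and fixed points for a quotient\<close>

context group
begin

lemma class_reps_subgroup: "class_reps G R \<Longrightarrow> K \<in> R \<Longrightarrow> subgroup K G"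
  by (auto simp: class_reps_def)

lemma class_reps_ex:
  assumes "class_reps G R" "subgroup M G" shows "\<exists>g. g \<in> carrier G \<and> conj_act G g M \<in> R"
proof -
  obtain K where "K \<in> R" "K \<in> conj_class G M"
    using assms conj_class_in[OF assms(2)] unfolding class_reps_def by blast
  then show ?thesis unfolding conj_class_def orbit_def by auto
qed

lemma class_reps_unique:
  assumes "class_reps G R" "M \<in> R" "g \<in> carrier G" "conj_act G g M \<in> R" shows "conj_act G g M = M"
proof -
  have M: "subgroup M G" using assms class_reps_subgroup by blast
  have "\<exists>!K. K \<in> R \<and> K \<in> conj_class G M" using assms(1) conj_class_in[OF M] by (simp add: class_reps_def)
  moreover have "conj_act G g M \<in> conj_class G M" using assms(3) by (auto simp: conj_class_def orbit_def)
  ultimately show ?thesis using assms(2,4) conj_class_self[OF M] by blast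
qed

lemma vectorspace_D_space:
  assumes "class_reps G R" shows "vectorspace F2 (D_space G R)"
  unfolding D_space_def
  using assms by (intro vectorspace_prod_module vectorspace_defect group_weyl class_reps_subgroup)

lemma linear_map_D_component:
  assumes "class_reps G R" "K \<in> R"
  shows "linear_map F2 (D_space G R) (defect (weyl G K)) (\<lambda>\<omega>. \<omega> K)"
  unfolding D_space_def
  using assms by (intro linear_map_prod_component[where M = "\<lambda>K. defect (weyl G K)"]
      vectorspace_defect group_weyl class_reps_subgroup)

lemma linear_map_lam:
  assumes K: "subgroup K G" shows "linear_map F2 (V_space G) (Cl0 (weyl G K)) (\<lambda>x. lam G x K)"
proof (rule F2_linear_mapI[OF vectorspace_V_space vectorspace_Cl0[OF group_weyl[OF K]]])
  fix x y
  show "lam G (x \<oplus>\<^bsub>V_space G\<^esub> y) K = lam G x K \<oplus>\<^bsub>Cl0 (weyl G K)\<^esub> lam G y K"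
  proof (rule extensionalityI[of _ "carrier (weyl G K)"])
    fix X assume X: "X \<in> carrier (weyl G K)"
    then have "subgroup (generate G (K \<union> X)) G"
      using weyl_subset[OF K] subgroup.subset[OF K] by (intro generate_is_subgroup) auto
    then show "lam G (x \<oplus>\<^bsub>V_space G\<^esub> y) K X = (lam G x K \<oplus>\<^bsub>Cl0 (weyl G K)\<^esub> lam G y K) X"
      using X K by (simp add: lam_def Cl0_sel(2-) ext0_add add.assoc add.left_commute)
  qed (auto simp: lam_def Cl0_sel(2-))
qed (simp add: lam_Cl0[OF K])

lemma linear_map_Def:
  assumes R: "class_reps G R" shows "linear_map F2 (V_space G) (D_space G R) (Def G R)"
  unfolding D_space_def Def_def[abs_def]
proof (rule linear_map_into_prod[OF vectorspace_V_space])
  fix K assume "K \<in> R"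
  then have K: "subgroup K G" by (rule class_reps_subgroup[OF R])
  show "linear_map F2 (V_space G) (defect (weyl G K)) (\<lambda>x. defect_class (weyl G K) (lam G x K))"
    by (rule linear_map_comp[OF linear_map_lam[OF K] linear_map_defect_class[OF group_weyl[OF K]]])
qed

lemma conj_act_weyl_hom:
  assumes M: "subgroup M G" and g: "g \<in> carrier G"
  shows "conj_act G g \<in> hom (weyl G M) (weyl G (conj_act G g M))"
proof -
  interpret c: group_hom G G "\<lambda>x. g \<otimes> x \<otimes> inv g" by (rule group_hom_conj[OF g])
  show ?thesis using c.weyl_hom[OF M, of "conj_act G g"] by (simp add: conj_act_eq subgroup.subset[OF M])
qed

lemma componentE:
  assumes R: "class_reps G R" and M: "subgroup M G"
  obtains g where "g \<in> carrier G" "conj_act G g M \<in> R"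
    "\<And>\<omega>. component G R \<omega> M = defect_pullback (weyl G M) (conj_act G g) (\<omega> (conj_act G g M))"
  using someI_ex[OF class_reps_ex[OF R M]] unfolding component_def Let_def by blast

lemma linear_map_component:
  assumes R: "class_reps G R" and M: "subgroup M G"
  shows "linear_map F2 (D_space G R) (defect (weyl G M)) (\<lambda>\<omega>. component G R \<omega> M)"
proof -
  obtain g where g: "g \<in> carrier G" "conj_act G g M \<in> R"
    and eq: "\<And>\<omega>. component G R \<omega> M = defect_pullback (weyl G M) (conj_act G g) (\<omega> (conj_act G g M))"
    using componentE[OF R M] by blast
  show ?thesis
    unfolding eq
    by (rule linear_map_comp[OF linear_map_D_component[OF R g(2)] linear_map_defect_pullback])
      (intro group_weyl M subgroup_conj_act conj_act_weyl_hom g(1))+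
qed

text \<open>A class has one representative in \<open>R\<close>, so the conjugating element chosen by
  \<open>component\<close> normalizes \<open>M\<close> and acts on its Weyl group by an inner
  automorphism.\<close>

lemma component_rep:
  assumes R: "class_reps G R" and M: "M \<in> R" and \<omega>: "\<omega> \<in> carrier (D_space G R)"
  shows "component G R \<omega> M = \<omega> M"
proof -
  note M' = class_reps_subgroup[OF R M] and MG = subgroup.subset[OF class_reps_subgroup[OF R M]]
  obtain g where g: "g \<in> carrier G" "conj_act G g M \<in> R"
    and eq: "\<And>\<omega>. component G R \<omega> M = defect_pullback (weyl G M) (conj_act G g) (\<omega> (conj_act G g M))"
    using componentE[OF R M'] by blast
  have gM: "conj_act G g M = M" by (rule class_reps_unique[OF R M g])
  then have n: "g \<in> normalizer G M" using g(1) normalizer_iff[OF MG] by simp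
  have "\<omega> M \<in> carrier (defect (weyl G M))" using \<omega> M by (auto simp: D_space_def prod_module_sel)
  moreover have "M #> g \<in> carrier (weyl G M)" using n by (auto simp: weyl_sel)
  ultimately show ?thesis
    unfolding eq gM using weyl_conj_act[OF M' n] by (intro defect_pullback_inner[OF group_weyl[OF M']])
qed

text \<open>Conjugation preserves \<open>ext0\<close>, so the local function at \<open>M\<close> is
  the pullback of the one at its representative. This is what allows \<open>Inf_D\<close> to be
  evaluated on \<open>Def\<close> when the image of a representative is not itself a
  representative.\<close>

lemma component_Def:
  assumes R: "class_reps G R" and M: "subgroup M G"
  shows "component G R (Def G R x) M = defect_class (weyl G M) (lam G x M)"
proof -
  obtain g where g: "g \<in> carrier G" "conj_act G g M \<in> R"
    and eq: "\<And>\<omega>. component G R \<omega> M = defect_pullback (weyl G M) (conj_act G g) (\<omega> (conj_act G g M))"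
    using componentE[OF R M] by blast
  interpret c: group_hom G G "\<lambda>x. g \<otimes> x \<otimes> inv g" by (rule group_hom_conj[OF g(1)])
  note gM = subgroup_conj_act[OF M g(1)]
  have "ext0 G x (conj_class G L) = ext0 G x (conj_class G ((\<lambda>x. g \<otimes> x \<otimes> inv g) ` L))" if "subgroup L G" for L
    using conj_class_conj_act[OF that g(1)] by (simp add: conj_act_eq[OF subgroup.subset[OF that]])
  then have "compose (carrier (weyl G M)) (lam G x (conj_act G g M)) (conj_act G g) = lam G x M"
    using c.lam_pullback[OF M, of "conj_act G g" x x] by (simp add: conj_act_eq subgroup.subset[OF M])
  then show ?thesis
    unfolding eq using g(2) defect_pullback_class[OF group_weyl[OF M] group_weyl[OF gM]
        conj_act_weyl_hom[OF M g(1)] lam_Cl0[OF gM]] by (simp add: Def_def)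
qed

end

section \<open>The quotient map on V and on S2\<close>

lemma (in normal) surj_group_hom_Mod: "surj_group_hom G (G Mod H) (\<lambda>g. H #> g)"
  by (intro surj_group_hom.intro group_hom.intro group_hom_axioms.intro surj_group_hom_axioms.intro
      is_group factorgroup_is_group r_coset_hom_Mod) (simp add: carrier_FactGroup)

locale finite_quotient =
  fixes G :: "('a, 'b) monoid_scheme" (structure) and N :: "'a set"
  assumes fin_group: "finite_group G" and normal: "N \<lhd> G"
begin

abbreviation Q :: "'a set monoid" where "Q \<equiv> G Mod N"

sublocale G: finite_group G by (rule fin_group)

sublocale Q: finite_group Q
  by (intro finite_group.intro finite_group_axioms.intro normal.factorgroup_is_group normal)
    (simp add: carrier_FactGroup G.fin)

sublocale p: surj_group_hom G Q "\<lambda>g. N #> g"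
  by (rule normal.surj_group_hom_Mod[OF normal])

lemma preim_eq: "preim G N L = p.pre L"
  by (simp add: preim_def p.pre_def)

lemma ext0_Inf_V:
  assumes K: "subgroup K G"
  shows "ext0 G (Inf_V G N x) (conj_class G K) = ext0 Q x (conj_class Q (proj G N K))"
proof -
  let ?K = "rep (conj_class G K)"
  have pK: "subgroup (proj G N L) Q" if "subgroup L G" for L
    unfolding proj_def using that by (rule p.subgroup_img_is_subgroup)
  have r: "subgroup ?K G" "conj_class G ?K = conj_class G K" using G.rep_class G.conj_class_in[OF K] by auto
  \<comment> \<open>\<open>Inf_V\<close> looks at the chosen representative of the class; its image
    is conjugate to that of \<open>K\<close>.\<close>
  then have "conj_class Q (proj G N ?K) = conj_class Q (proj G N K)"
    unfolding proj_def using K by (intro p.conj_class_img)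
  then show ?thesis
    using p.img_ncc[OF K] Q.conj_class_ncc_iff[OF pK[OF K]] Q.conj_class_ncc_iff[OF pK[OF r(1)]]
      G.conj_class_ncc_iff[OF K]
    by (auto simp: G.ext0_conj_class[OF K] Q.ext0_conj_class[OF pK[OF K]] Inf_V_def proj_def[symmetric])
qed

lemma ext0_Fix_V:
  assumes L: "subgroup L Q"
  shows "ext0 Q (Fix_V G N y) (conj_class Q L) = ext0 G y (conj_class G (preim G N L))"
proof -
  have r: "subgroup (rep (conj_class Q L)) Q" "conj_class Q (rep (conj_class Q L)) = conj_class Q L"
    using Q.rep_class Q.conj_class_in[OF L] by auto
  then have "conj_class G (p.pre (rep (conj_class Q L))) = conj_class G (p.pre L)"
    using p.conj_class_pre_iff L by simp
  then show ?thesis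
    using p.pre_ncc_iff[OF L] Q.conj_class_ncc_iff[OF L]
    by (simp add: Q.ext0_conj_class[OF L] G.ext0_conj_class p.subgroup_pre[OF L] preim_eq Fix_V_def)
qed

lemma proj_preim: "subgroup L Q \<Longrightarrow> proj G N (preim G N L) = L"
  unfolding preim_eq proj_def by (intro p.img_pre subgroup.subset)

lemma linear_map_Inf_V: "linear_map F2 (V_space Q) (V_space G) (Inf_V G N)"
proof (rule F2_linear_mapI[OF vectorspace_V_space vectorspace_V_space])
  fix x y
  show "Inf_V G N (x \<oplus>\<^bsub>V_space Q\<^esub> y) = Inf_V G N x \<oplus>\<^bsub>V_space G\<^esub> Inf_V G N y"
    by (rule G.V_space_eqI)
      (simp_all add: G.ext0_add ext0_Inf_V Q.ext0_add proj_def p.subgroup_img_is_subgroup,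
        simp_all add: V_space_sel Inf_V_def)
qed (simp add: V_space_sel Inf_V_def)

lemma linear_map_Fix_V: "linear_map F2 (V_space G) (V_space Q) (Fix_V G N)"
proof (rule F2_linear_mapI[OF vectorspace_V_space vectorspace_V_space])
  fix x y
  show "Fix_V G N (x \<oplus>\<^bsub>V_space G\<^esub> y) = Fix_V G N x \<oplus>\<^bsub>V_space Q\<^esub> Fix_V G N y"
    by (rule Q.V_space_eqI)
      (simp_all add: Q.ext0_add ext0_Fix_V G.ext0_add preim_eq p.subgroup_pre,
        simp_all add: V_space_sel Fix_V_def)
qed (simp add: V_space_sel Fix_V_def)

lemma Fix_V_Inf_V:
  assumes "x \<in> carrier (V_space Q)" shows "Fix_V G N (Inf_V G N x) = x"
proof (rule Q.V_space_eqI)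
  show "Fix_V G N (Inf_V G N x) \<in> carrier (V_space Q)" by (simp add: V_space_sel Fix_V_def)
  show "ext0 Q (Fix_V G N (Inf_V G N x)) (conj_class Q L) = ext0 Q x (conj_class Q L)" if L: "subgroup L Q" for L
    using ext0_Inf_V[of "preim G N L"] p.subgroup_pre[OF L] by (simp add: ext0_Fix_V[OF L] preim_eq[symmetric] proj_preim[OF L])
qed (rule assms)

lemma Inf_V_S2: "Inf_V G N ` S2 Q \<subseteq> S2 G"
proof
  fix y assume "y \<in> Inf_V G N ` S2 Q"
  then obtain x where x: "x \<in> S2 Q" "y = Inf_V G N x" by auto
  show "y \<in> S2 G"
    by (rule p.S2_infl[OF G.fin x(1)])
      (simp_all add: x(2) ext0_Inf_V proj_def[symmetric], simp add: V_space_sel Inf_V_def)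
qed

lemma Fix_V_S2: "Fix_V G N ` S2 G \<subseteq> S2 Q"
proof
  fix x assume "x \<in> Fix_V G N ` S2 G"
  then obtain y where y: "y \<in> S2 G" "x = Fix_V G N y" by auto
  show "x \<in> S2 Q"
    by (rule p.S2_fixp[OF G.fin y(1)])
      (simp_all add: y(2) ext0_Fix_V preim_eq, simp add: V_space_sel Fix_V_def)
qed

lemma finite_S2: "finite (S2 G)"
proof -
  have "S2 G \<subseteq> (\<lambda>S. \<lambda>C\<in>ncc_classes G. if C \<in> S then 1 else 0) ` Pow (ncc_classes G)"
    by (auto simp: S2_def S2_sets_def)
  then show ?thesis using G.finite_ncc_classes finite_subset by blast
qed

lemma proj_weyl_hom: "subgroup K G \<Longrightarrow> proj G N \<in> hom (weyl G K) (weyl Q (proj G N K))"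
  using p.weyl_hom[of K "proj G N"] by (simp add: proj_def)

lemma subgroup_proj: "subgroup K G \<Longrightarrow> subgroup (proj G N K) Q"
  unfolding proj_def by (rule p.subgroup_img_is_subgroup)

end

section \<open>Defect spaces of the quotient and commutation with Def\<close>

locale finite_quotient_reps = finite_quotient +
  fixes R :: "'a set set" and RQ :: "'a set set set"
  assumes R: "class_reps G R" and RQ: "class_reps Q RQ"
    and preim_reps: "\<And>L. L \<in> RQ \<Longrightarrow> preim G N L \<in> R"
begin

lemma defect_pullback_proj_preim:
  assumes L: "L \<in> RQ"
  shows "linear_map F2 (defect (weyl Q L)) (defect (weyl G (preim G N L)))
      (defect_pullback (weyl G (preim G N L)) (proj G N))"
    and "bij_betw (defect_pullback (weyl G (preim G N L)) (proj G N))
      (carrier (defect (weyl Q L))) (carrier (defect (weyl G (preim G N L))))"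
proof -
  have L': "subgroup L Q" by (rule Q.class_reps_subgroup[OF RQ L])
  have pL: "subgroup (preim G N L) G" using p.subgroup_pre[OF L'] by (simp add: preim_eq)
  have hom: "proj G N \<in> hom (weyl G (preim G N L)) (weyl Q L)"
    using proj_weyl_hom[OF pL] by (simp add: proj_preim[OF L'])
  have bij: "bij_betw (proj G N) (carrier (weyl G (preim G N L))) (carrier (weyl Q L))"
    using p.weyl_pre_bij[OF L', of "proj G N"] by (simp add: proj_def preim_eq)
  note W = G.group_weyl[OF pL] Q.group_weyl[OF L'] hom
  show "linear_map F2 (defect (weyl Q L)) (defect (weyl G (preim G N L)))
      (defect_pullback (weyl G (preim G N L)) (proj G N))"
    by (rule linear_map_defect_pullback[OF W])
  show "bij_betw (defect_pullback (weyl G (preim G N L)) (proj G N))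
      (carrier (defect (weyl Q L))) (carrier (defect (weyl G (preim G N L))))"
    by (rule bij_betw_defect_pullback[OF W bij])
qed

lemma linear_map_Inf_D: "linear_map F2 (D_space Q RQ) (D_space G R) (Inf_D G N R RQ)"
  unfolding D_space_def[of G] Inf_D_def[abs_def]
proof (rule linear_map_into_prod[OF Q.vectorspace_D_space[OF RQ]])
  fix K assume "K \<in> R"
  then have K: "subgroup K G" by (rule G.class_reps_subgroup[OF R])
  note pK = subgroup_proj[OF K]
  show "linear_map F2 (D_space Q RQ) (defect (weyl G K))
      (\<lambda>\<omega>. defect_pullback (weyl G K) (proj G N) (component Q RQ \<omega> (proj G N K)))"
    by (rule linear_map_comp[OF Q.linear_map_component[OF RQ pK]
        linear_map_defect_pullback[OF G.group_weyl[OF K] Q.group_weyl[OF pK] proj_weyl_hom[OF K]]])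
qed

lemma linear_map_Fix_D: "linear_map F2 (D_space G R) (D_space Q RQ) (Fix_D G N RQ)"
  unfolding D_space_def[of Q] Fix_D_def[abs_def]
proof (rule linear_map_into_prod[OF G.vectorspace_D_space[OF R]])
  fix L assume L: "L \<in> RQ"
  show "linear_map F2 (D_space G R) (defect (weyl Q L))
      (\<lambda>\<eta>. the_inv_into (carrier (defect (weyl Q L))) (defect_pullback (weyl G (preim G N L)) (proj G N))
          (\<eta> (preim G N L)))"
    by (rule linear_map_comp[OF G.linear_map_D_component[OF R preim_reps[OF L]]
        linear_map_the_inv_into[OF defect_pullback_proj_preim[OF L]]])
qed

lemma the_inv_into_pullback:
  assumes "L \<in> RQ" "\<omega> \<in> carrier (defect (weyl Q L))"
  shows "the_inv_into (carrier (defect (weyl Q L))) (defect_pullback (weyl G (preim G N L)) (proj G N))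
      (defect_pullback (weyl G (preim G N L)) (proj G N) \<omega>) = \<omega>"
  using defect_pullback_proj_preim(2)[OF assms(1)] assms(2)
  by (intro the_inv_into_f_f) (auto simp: bij_betw_def)

text \<open>At the representative \<open>preim G N L\<close>, inflation pulls back the component at
  its image, which is \<open>L\<close> itself; there \<open>component_rep\<close> returns
  \<open>\<omega> L\<close>, and the inverse in \<open>Fix_D\<close> undoes the pullback.\<close>

lemma Fix_D_Inf_D:
  assumes \<omega>: "\<omega> \<in> carrier (D_space Q RQ)" shows "Fix_D G N RQ (Inf_D G N R RQ \<omega>) = \<omega>"
proof (rule extensionalityI[of _ RQ])
  fix L assume L: "L \<in> RQ"
  have "\<omega> L \<in> carrier (defect (weyl Q L))" using \<omega> L by (auto simp: D_space_def prod_module_sel)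
  then show "Fix_D G N RQ (Inf_D G N R RQ \<omega>) L = \<omega> L"
    using L preim_reps[OF L] Q.component_rep[OF RQ L \<omega>] the_inv_into_pullback[OF L]
    by (simp add: Fix_D_def Inf_D_def proj_preim[OF Q.class_reps_subgroup[OF RQ L]])
qed (use \<omega> in \<open>auto simp: Fix_D_def D_space_def prod_module_sel PiE_def\<close>)

text \<open>\<open>component_Def\<close> identifies the component at \<open>proj G N K\<close> with
  the class of a local function, and its pullback is the local function of
  \<open>Inf_V G N x\<close> by \<open>ext0_Inf_V\<close>.\<close>

lemma Def_Inf_V: "Def G R (Inf_V G N x) = Inf_D G N R RQ (Def Q RQ x)"
proof -
  have "defect_class (weyl G K) (lam G (Inf_V G N x) K) =
      defect_pullback (weyl G K) (proj G N) (component Q RQ (Def Q RQ x) (proj G N K))" if "K \<in> R" for K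
  proof -
    have K: "subgroup K G" using that by (rule G.class_reps_subgroup[OF R])
    note pK = subgroup_proj[OF K]
    have "compose (carrier (weyl G K)) (lam Q x (proj G N K)) (proj G N) = lam G (Inf_V G N x) K"
      using p.lam_pullback[OF K, of "proj G N" "Inf_V G N x" x] by (simp add: ext0_Inf_V flip: proj_def)
    then show ?thesis
      using defect_pullback_class[OF G.group_weyl[OF K] Q.group_weyl[OF pK] proj_weyl_hom[OF K] Q.lam_Cl0[OF pK]]
      by (simp add: Q.component_Def[OF RQ pK])
  qed
  then show ?thesis unfolding Def_def[of G] Inf_D_def by (intro restrict_ext) simp
qed

text \<open>The local function of \<open>y\<close> at the preimage of \<open>L\<close> is the
  pullback of that of \<open>Fix_V G N y\<close> at \<open>L\<close>; inverting the pullback gives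
  the claim.\<close>

lemma Fix_D_Def: "Fix_D G N RQ (Def G R y) = Def Q RQ (Fix_V G N y)"
proof -
  have "the_inv_into (carrier (defect (weyl Q L))) (defect_pullback (weyl G (preim G N L)) (proj G N))
      (defect_class (weyl G (preim G N L)) (lam G y (preim G N L))) =
      defect_class (weyl Q L) (lam Q (Fix_V G N y) L)" if L: "L \<in> RQ" for L
  proof -
    have L': "subgroup L Q" by (rule Q.class_reps_subgroup[OF RQ L])
    have pL: "subgroup (preim G N L) G" using p.subgroup_pre[OF L'] by (simp add: preim_eq)
    have hom: "proj G N \<in> hom (weyl G (preim G N L)) (weyl Q L)"
      using proj_weyl_hom[OF pL] by (simp add: proj_preim[OF L'])
    \<comment> \<open>A subgroup \<open>M\<close> above a preimage contains the kernel, hence is the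
      preimage of its own image, and there \<open>Fix_V\<close> retains the value of
      \<open>y\<close>.\<close>
    have "ext0 G y (conj_class G M) = ext0 Q (Fix_V G N y) (conj_class Q (proj G N M))"
      if "subgroup M G" "preim G N L \<subseteq> M" for M
      using ext0_Fix_V[OF subgroup_proj[OF that(1)]] p.pre_img[OF that(1) L'] that(2)
      by (simp add: preim_eq proj_def)
    then have "compose (carrier (weyl G (preim G N L))) (lam Q (Fix_V G N y) L) (proj G N) = lam G y (preim G N L)"
      using p.lam_pullback[OF pL, of "proj G N" y "Fix_V G N y"] by (simp add: proj_preim[OF L'] flip: proj_def)
    then have "defect_class (weyl G (preim G N L)) (lam G y (preim G N L)) =
        defect_pullback (weyl G (preim G N L)) (proj G N) (defect_class (weyl Q L) (lam Q (Fix_V G N y) L))"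
      using defect_pullback_class[OF G.group_weyl[OF pL] Q.group_weyl[OF L'] hom Q.lam_Cl0[OF L']] by simp
    moreover have "defect_class (weyl Q L) (lam Q (Fix_V G N y) L) \<in> carrier (defect (weyl Q L))"
      using Q.lam_Cl0[OF L'] by (simp add: carrier_defect[OF Q.group_weyl[OF L']])
    ultimately show ?thesis using the_inv_into_pullback[OF L] by simp
  qed
  then show ?thesis unfolding Def_def[of Q] Fix_D_def by (intro restrict_ext) (simp add: Def_def preim_reps)
qed

text \<open>Immediate from \<open>Fix_D_Def\<close>, as \<open>Def\<close> of the quotient sends
  zero to zero.\<close>

lemma Def_ker_Fix: "Def G R ` ker_Fix_V G N \<subseteq> ker_Fix_D G N R RQ"
proof -
  interpret FV: linear_map F2 "V_space G" "V_space Q" "Fix_V G N" by (rule linear_map_Fix_V)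
  interpret FD: linear_map F2 "D_space G R" "D_space Q RQ" "Fix_D G N RQ" by (rule linear_map_Fix_D)
  interpret D: linear_map F2 "V_space G" "D_space G R" "Def G R" by (rule G.linear_map_Def[OF R])
  interpret DQ: linear_map F2 "V_space Q" "D_space Q RQ" "Def Q RQ" by (rule Q.linear_map_Def[OF RQ])
  show ?thesis
    using DQ.f0_is_0 by (auto simp: ker_Fix_V_def ker_Fix_D_def FV.ker_def FD.ker_def Fix_D_Def)
qed

end

theorem theorem6p13:
  fixes G :: "('a, 'b) monoid_scheme" and N :: "'a set"
    and R :: "'a set set" and RQ :: "'a set set set"
  assumes "group G" and "finite (carrier G)" and "N \<lhd> G"
    and "class_reps G R" and "class_reps (G Mod N) RQ"
    and "\<And>L. L \<in> RQ \<Longrightarrow> preim G N L \<in> R"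
  shows
    "linear_map F2 (V_space (G Mod N)) (V_space G) (Inf_V G N) \<and>
     linear_map F2 (V_space G) (V_space (G Mod N)) (Fix_V G N) \<and>
     linear_map F2 (D_space (G Mod N) RQ) (D_space G R) (Inf_D G N R RQ) \<and>
     linear_map F2 (D_space G R) (D_space (G Mod N) RQ) (Fix_D G N RQ) \<and>
     linear_map F2 (V_space G) (D_space G R) (Def G R) \<and>
     linear_map F2 (V_space (G Mod N)) (D_space (G Mod N) RQ) (Def (G Mod N) RQ) \<and>
     internal_direct_sum F2 (V_space G) (carrier (V_space G))
       (Inf_V G N ` carrier (V_space (G Mod N))) (ker_Fix_V G N) \<and>
     internal_direct_sum F2 (D_space G R) (carrier (D_space G R))
       (Inf_D G N R RQ ` carrier (D_space (G Mod N) RQ)) (ker_Fix_D G N R RQ) \<and>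
     inj_on (Inf_V G N) (carrier (V_space (G Mod N))) \<and>
     inj_on (Inf_D G N R RQ) (carrier (D_space (G Mod N) RQ)) \<and>
     (\<forall>x \<in> carrier (V_space (G Mod N)).
        Def G R (Inf_V G N x) = Inf_D G N R RQ (Def (G Mod N) RQ x)) \<and>
     Def G R ` ker_Fix_V G N \<subseteq> ker_Fix_D G N R RQ \<and>
     internal_direct_sum F2 (V_space G) (S2 G)
       (Inf_V G N ` S2 (G Mod N)) (S2 G \<inter> ker_Fix_V G N) \<and>
     vectorspace.dim F2 ((V_space G)\<lparr>carrier := S2 G\<rparr>) =
       vectorspace.dim F2 ((V_space (G Mod N))\<lparr>carrier := S2 (G Mod N)\<rparr>) +
       vectorspace.dim F2 ((V_space G)\<lparr>carrier := S2 G \<inter> ker_Fix_V G N\<rparr>)"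
proof -
  interpret finite_quotient_reps G N R RQ
    by (intro finite_quotient_reps.intro finite_quotient.intro finite_group.intro
        finite_group_axioms.intro finite_quotient_reps_axioms.intro assms)
  have V: "internal_direct_sum F2 (V_space G) (carrier (V_space G)) (Inf_V G N ` carrier (V_space Q)) (ker_Fix_V G N)"
    unfolding ker_Fix_V_def
    by (rule internal_direct_sum_carrier[OF linear_map_Inf_V linear_map_Fix_V]) (rule Fix_V_Inf_V)
  have D: "internal_direct_sum F2 (D_space G R) (carrier (D_space G R))
      (Inf_D G N R RQ ` carrier (D_space Q RQ)) (ker_Fix_D G N R RQ)"
    unfolding ker_Fix_D_def
    by (rule internal_direct_sum_carrier[OF linear_map_Inf_D linear_map_Fix_D]) (rule Fix_D_Inf_D)
  note S2 = G.subspace_S2 Q.subspace_S2 Inf_V_S2 Fix_V_S2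
  have S: "internal_direct_sum F2 (V_space G) (S2 G) (Inf_V G N ` S2 Q) (S2 G \<inter> ker_Fix_V G N)"
    unfolding ker_Fix_V_def
    by (rule internal_direct_sum_retraction[OF linear_map_Inf_V linear_map_Fix_V _ S2]) (rule Fix_V_Inf_V)
  have dim: "vectorspace.dim F2 ((V_space G)\<lparr>carrier := S2 G\<rparr>) =
      vectorspace.dim F2 ((V_space Q)\<lparr>carrier := S2 Q\<rparr>) +
      vectorspace.dim F2 ((V_space G)\<lparr>carrier := S2 G \<inter> ker_Fix_V G N\<rparr>)"
    unfolding ker_Fix_V_def
    by (rule dim_retraction[OF linear_map_Inf_V linear_map_Fix_V _ S2 finite_S2]) (rule Fix_V_Inf_V)
  have inj: "inj_on (Inf_V G N) (carrier (V_space Q))" "inj_on (Inf_D G N R RQ) (carrier (D_space Q RQ))"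
    using Fix_V_Inf_V Fix_D_Inf_D by (auto intro: inj_on_inverseI)
  show ?thesis
    by (intro conjI ballI linear_map_Inf_V linear_map_Fix_V linear_map_Inf_D linear_map_Fix_D
        G.linear_map_Def[OF R] Q.linear_map_Def[OF RQ] V D inj Def_Inf_V Def_ker_Fix S dim)
qed

end
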